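(* Let $\mathscr{V}$ be a topological category over $\mathsf{Set}$, with topological functor $|-| : \mathscr{V} \to \mathsf{Set}$, equipped with a symmetric monoidal structure $(\otimes, I)$ such that $|-|$ is strict symmetric monoidal with respect to the cartesian structure on $\mathsf{Set}$, and let $\mathcal{S}$ be a set. Let $\mathcal{T} = (\Sigma, \mathcal{E})$ be a $\mathscr{V}$-enriched $\mathcal{S}$-sorted equational theory with underlying classical $\mathcal{S}$-sorted equational theory $|\mathcal{T}| = (|\Sigma|, |\mathcal{E}|)$, and let $X$ be an object of $\mathscr{V}^{\mathcal{S}}$. Then the carrier object $U^{\mathcal{T}} F^{\mathcal{T}} X \in \mathrm{ob}\,\mathscr{V}^{\mathcal{S}}$ of the free $\mathcal{T}$-algebra $F^{\mathcal{T}} X$ on $X$ is the infimum, in the fibre of $\mathscr{V}^{\mathcal{S}}$ over the $\mathcal{S}$-sorted set $U^{|\mathcal{T}|} F^{|\mathcal{T}|}|X| = \mathsf{Term}_{|\Sigma|}(|X|)/{\sim^{|\mathcal{E}|}}$, of all the elements that are $\mathcal{T}$-compatible with $X$: $$U^{\mathcal{T}} F^{\mathcal{T}} X = \bigwedge\left\{B \in \mathsf{Fib}\left(\mathsf{Term}_{|\Sigma|}(|X|)/{\sim^{|\mathcal{E}|}}\right) \mid B \text{ is } \mathcal{T}\text{-compatible with } X\right\}.$$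
   Context: Topological categories. A concrete category over a category $\mathscr{X}$ is a category $\mathscr{V}$ with a faithful functor $|-| : \mathscr{V} \to \mathscr{X}$; an $\mathscr{X}$-morphism $f : |V| \to |W|$ is $\mathscr{V}$-admissible if it lifts (uniquely) to a morphism $V \to W$. The fibre $\mathsf{Fib}(X)$ is the preordered class of objects $V$ with $|V| = X$, where $V \leq V'$ iff $1_X$ is an admissible morphism $V \to V'$; $\mathscr{V}$ is amnestic if all fibres are partially ordered. A (possibly large) source $(f_i : V \to V_i)_{i}$ is initial if for all $W$ and $f : |W| \to |V|$, $f$ is admissible iff all $f_i \circ f$ are. $\mathscr{V}$ is topological over $\mathscr{X}$ if it is amnestic and every (possibly large) structured source $(f_i : X \to |V_i|)_i$ has an initial lift: an object $V$ with $|V| = X$, each $f_i$ admissible $V \to V_i$, and $(f_i : V \to V_i)_i$ initial. Then every fibre is a (possibly large) complete lattice. When $\mathscr{X} = \mathsf{Set}$, the indiscrete object $\mathsf{Indisc}\, Y$ on a set $Y$ is the greatest element of $\mathsf{Fib}(Y)$; every function $|V| \to Y$ is admissible as a morphism $V \to \mathsf{Indisc}\,Y$. The category $\mathscr{V}^{\mathcal{S}}$ is topological over $\mathsf{Set}^{\mathcal{S}}$ via $|(V_S)_{S}| = (|V_S|)_{S}$, with fibres ordered componentwise. One has $|X \otimes Y| = |X| \times |Y|$, $|X \times Y| = |X| \times |Y|$, and $|I|$ is a singleton. $\mathcal{S}^*$ is the set of finite sequences of elements of $\mathcal{S}$. Signatures. A $\mathscr{V}$-enriched $\mathcal{S}$-sorted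 signature is a set $\Sigma$ of operation symbols, each equipped with a type $((S_1, \ldots, S_n), S, P)$: input sorts $(S_1,\ldots,S_n) \in \mathcal{S}^*$, output sort $S \in \mathcal{S}$, parameter object $P \in \mathrm{ob}\,\mathscr{V}$. A $\Sigma$-algebra is an object $A = (A_S)_{S}$ of $\mathscr{V}^{\mathcal{S}}$ with, for each $\sigma \in \Sigma$ of type $((S_1, \ldots, S_n), S, P)$, a $\mathscr{V}$-morphism $\sigma^A : P \otimes (A_{S_1} \times \cdots \times A_{S_n}) \to A_S$. A morphism $f : A \to B$ of $\Sigma$-algebras is a morphism of $\mathscr{V}^{\mathcal{S}}$ with $f_S \circ \sigma^A = \sigma^B \circ (1_P \otimes (f_{S_1} \times \cdots \times f_{S_n}))$ for all $\sigma$. These form $\Sigma\text{-}\mathsf{Alg}$, with forgetful functor $U^\Sigma$ to $\mathscr{V}^{\mathcal{S}}$. A classical $\mathcal{S}$-sorted signature is the case $\mathscr{V} = \mathsf{Set}$ (cartesian) with all parameters equal to the one-point set (omitted from notation). $|\Sigma|$ is the classical signature with an operation symbol $\sigma_p$ with input sorts $(S_1,\ldots,S_n)$ and output sort $S$ for each $\sigma \in \Sigma$ of type $((S_1,\ldots,S_n),S,P)$ and each $p \in |P|$. Each $\Sigma$-algebra $A$ has an underlying $|\Sigma|$-algebra $|A|$ with carrier $(|A_S|)_S$ and $\sigma_p^{|A|} = \sigma^A(p, -)$. Enriched theories. For $P \in \mathrm{ob}\,\mathscr{V}$ and $\overline{S} = (S_1, \ldots, S_n) \in \mathcal{S}^*$,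 let $P \otimes U^{\overline{S}} : \Sigma\text{-}\mathsf{Alg} \to \mathscr{V}$ be $A \mapsto P \otimes (A_{S_1} \times \cdots \times A_{S_n})$, and $U^S$ be $A \mapsto A_S$. An algebraic $\Sigma$-operation of type $(\overline{S}, S, P)$ is a natural transformation $\omega : P \otimes U^{\overline{S}} \Rightarrow U^S$. An algebraic $\Sigma$-equation $\omega \doteq \nu$ is a pair of algebraic $\Sigma$-operations of the same type; $A$ satisfies it if $\omega_A = \nu_A$. A $\mathscr{V}$-enriched $\mathcal{S}$-sorted equational theory is a pair $\mathcal{T} = (\Sigma, \mathcal{E})$ with $\mathcal{E}$ a set of algebraic $\Sigma$-equations; $\mathcal{T}\text{-}\mathsf{Alg} \subseteq \Sigma\text{-}\mathsf{Alg}$ is the full subcategory of $\mathcal{T}$-algebras, i.e. $\Sigma$-algebras satisfying all equations in $\mathcal{E}$, and $U^{\mathcal{T}}$ is the restriction of $U^\Sigma$. Classical theories. For a classical signature, with fixed pairwise disjoint countably infinite sets of variables for each sort, a context $\overline{v}$ is a finite list $v_1 : S_1, \ldots, v_n : S_n$ of pairwise distinct sorted variables. Terms in context: each $[\overline{v} \vdash v_i : S_i]$, and $[\overline{v} \vdash \tau(t_1, \ldots, t_m) : T]$ for an operation symbol $\tau$ with input sorts $T_1, \ldots, T_m$, output sort $T$, and terms $[\overline{v} \vdash t_j : T_j]$. In an algebra $A$ a term $[\overline{v} \vdash t : S]$ is interpreted as a function $t^A : A_{S_1} \times \cdots \times A_{S_n} \to A_S$ in the usual recursive way. A syntactic equation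 $[\overline{v} \vdash s \doteq t : S]$ is satisfied by $A$ if $s^A = t^A$. A classical $\mathcal{S}$-sorted equational theory is a classical signature with a set of syntactic equations in context; its algebras are those satisfying these equations. Underlying classical theory $|\mathcal{T}| = (|\Sigma|, |\mathcal{E}|)$. For a $|\Sigma|$-algebra $D$, let $D^{\mathsf{Indisc}}$ be the $\Sigma$-algebra with carrier $(\mathsf{Indisc}\, D_S)_S$ and operations with underlying functions $(p, d_1, \ldots, d_n) \mapsto \sigma_p^D(d_1, \ldots, d_n)$. For an algebraic $\Sigma$-operation $\omega$ of type $((S_1, \ldots, S_n), S, P)$, $p \in |P|$, and a context $\overline{v} \equiv v_1 : S_1, \ldots, v_n : S_n$ of distinct variables, let $D$ be the $|\Sigma|$-algebra of $|\Sigma|$-terms in context $\overline{v}$ and let $t_{\omega, p} := \omega_{D^{\mathsf{Indisc}}}(p, v_1, \ldots, v_n) \in D_S$. Then $|\mathcal{E}|$ consists of the syntactic equations $[\overline{v} \vdash t_{\omega, p} \doteq t_{\nu, p} : S]$ for all $(\omega \doteq \nu) \in \mathcal{E}$ with parameter $P$ and all $p \in |P|$. A $\Sigma$-algebra $A$ is a $\mathcal{T}$-algebra iff $|A|$ is a $|\mathcal{T}|$-algebra. Classical free algebras. For an $\mathcal{S}$-sorted set $Y$, $\mathsf{Term}_{|\Sigma|}(Y)$ is the $\mathcal{S}$-sorted set of ground terms with constants from $Y$ (generated by $Y_S \subseteq \mathsf{Term}_{|\Sigma|}(Y)_S$ and closure under formal application of operation symbols); it carries the free $|\Sigma|$-algebra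 $F^{|\Sigma|} Y$. A $|\Sigma|$-congruence on a $|\Sigma|$-algebra $D$ is a family of equivalence relations $(\sim_S)_S$ on the sets $D_S$ compatible with all operations; the congruence $\sim^{|\mathcal{E}|}$ generated by $|\mathcal{E}|$ is the smallest one with $s^D(d_1, \ldots, d_n) \sim_S t^D(d_1, \ldots, d_n)$ for all $[\overline{v} \vdash s \doteq t : S]$ in $|\mathcal{E}|$ and all $d_i \in D_{S_i}$. Below $\sim^{|\mathcal{E}|}$ is this congruence on $F^{|\Sigma|}|X|$. The free $|\mathcal{T}|$-algebra $F^{|\mathcal{T}|}Y$ is the quotient algebra $F^{|\Sigma|} Y/{\sim^{|\mathcal{E}|}}$, with unit $y \mapsto [y]$. $F^{\mathcal{T}}$ denotes the left adjoint of $U^{\mathcal{T}}$ (which exists), chosen so that $F^{\mathcal{T}} \dashv U^{\mathcal{T}}$ strictly lifts $F^{|\mathcal{T}|} \dashv U^{|\mathcal{T}|}$; in particular the underlying $|\Sigma|$-algebra of $F^{\mathcal{T}} X$ is $F^{|\mathcal{T}|}|X|$, and the unit has underlying function $\eta : x \mapsto [x]$. Compatibility. An object $B$ of $\mathscr{V}^{\mathcal{S}}$ in the fibre over $\mathsf{Term}_{|\Sigma|}(|X|)/{\sim^{|\mathcal{E}|}}$ is $\mathcal{T}$-compatible with $X$ if: (1) the $\mathcal{S}$-sorted function $\eta : |X| \to \mathsf{Term}_{|\Sigma|}(|X|)/{\sim^{|\mathcal{E}|}} = |B|$, $x \mapsto [x]$, is an admissible morphism $X \to B$ of $\mathscr{V}^{\mathcal{S}}$;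 and (2) for each $\sigma \in \Sigma$ of type $((S_1, \ldots, S_n), S, P)$, the function $|P| \times |B_{S_1}| \times \cdots \times |B_{S_n}| \to |B_S|$, $(p, [t_1], \ldots, [t_n]) \mapsto [\sigma_p(t_1, \ldots, t_n)]$, is an admissible morphism $P \otimes (B_{S_1} \times \cdots \times B_{S_n}) \to B_S$ of $\mathscr{V}$. *)

theory Defs
  imports "HOL-Algebra.Order" "HOL-Library.FuncSet"
begin

section \<open>The category of sets\<close>

text \<open>
  HOL has no type of all sets, so the ambient set theory is axiomatised: the type \<open>'u\<close> plays the
  role of the class of all sets, and the \<^emph>\<open>small\<close> subclasses of \<open>'u\<close> are the sets, i.e. the objects
  of Set.  The morphisms of Set from \<open>A\<close> to \<open>B\<close> are the elements of \<open>A \<rightarrow>\<^sub>E B\<close>, composed by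
  \<^const>\<open>compose\<close>.  Only the closure properties below are assumed; the class of all sets and every
  Grothendieck universe containing an infinite set have them (power sets are not needed).  Sets of HOL type \<open>'u set\<close>,
  \<open>'v set\<close>, etc. that are not required to be small are the possibly large classes.
\<close>

record 'u universe =
  small :: "'u set \<Rightarrow> bool"
  upair :: "'u \<Rightarrow> 'u \<Rightarrow> 'u"
  upt   :: "'u"

locale set_universe =
  fixes U :: "('u, 'm) universe_scheme"
  assumes upair_inject: "upair U a b = upair U c d \<Longrightarrow> a = c \<and> b = d"
    and small_singleton: "small U {a}"
    and small_subset: "\<lbrakk>small U A; B \<subseteq> A\<rbrakk> \<Longrightarrow> small U B"
    and small_UN: "\<lbrakk>small U A; \<And>a. a \<in> A \<Longrightarrow> small U (F a)\<rbrakk> \<Longrightarrow> small U (\<Union>a\<in>A. F a)"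
    and small_infinite: "\<exists>A. small U A \<and> infinite A"

text \<open>Smallness for classes of entities of another type: being in bijection with a set.\<close>

definition small_sized :: "('u, 'm) universe_scheme \<Rightarrow> 'a set \<Rightarrow> bool" where
  "small_sized U A \<longleftrightarrow> (\<exists>f :: 'a \<Rightarrow> 'u. inj_on f A \<and> small U (f ` A))"

text \<open>
  The cartesian structure of Set: \<open>cart U A B\<close> is the binary product, \<open>{upt U}\<close> the terminal object,
  and \<open>tuples U [A\<^sub>1, \<dots>, A\<^sub>n]\<close> the \<open>n\<close>-ary product.
\<close>

definition ufst :: "('u, 'm) universe_scheme \<Rightarrow> 'u \<Rightarrow> 'u" where
  "ufst U z = (THE a. \<exists>b. z = upair U a b)"

definition usnd :: "('u, 'm) universe_scheme \<Rightarrow> 'u \<Rightarrow> 'u" where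
  "usnd U z = (THE b. \<exists>a. z = upair U a b)"

definition cart :: "('u, 'm) universe_scheme \<Rightarrow> 'u set \<Rightarrow> 'u set \<Rightarrow> 'u set" where
  "cart U A B = {upair U a b | a b. a \<in> A \<and> b \<in> B}"

definition cart_map ::
  "('u, 'm) universe_scheme \<Rightarrow> 'u set \<Rightarrow> 'u set \<Rightarrow> ('u \<Rightarrow> 'u) \<Rightarrow> ('u \<Rightarrow> 'u) \<Rightarrow> 'u \<Rightarrow> 'u" where
  "cart_map U A B f g = (\<lambda>z\<in>cart U A B. upair U (f (ufst U z)) (g (usnd U z)))"

definition tuple :: "('u, 'm) universe_scheme \<Rightarrow> 'u list \<Rightarrow> 'u" where
  "tuple U xs = foldr (upair U) xs (upt U)"

definition untuple :: "('u, 'm) universe_scheme \<Rightarrow> nat \<Rightarrow> 'u \<Rightarrow> 'u list" where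
  "untuple U n z = (THE xs. length xs = n \<and> tuple U xs = z)"

definition tuples :: "('u, 'm) universe_scheme \<Rightarrow> 'u set list \<Rightarrow> 'u set" where
  "tuples U As = tuple U ` listset As"

definition tuple_proj :: "('u, 'm) universe_scheme \<Rightarrow> 'u set list \<Rightarrow> nat \<Rightarrow> 'u \<Rightarrow> 'u" where
  "tuple_proj U As i = (\<lambda>z\<in>tuples U As. untuple U (length As) z ! i)"

definition tuple_map ::
  "('u, 'm) universe_scheme \<Rightarrow> 'u set list \<Rightarrow> ('u \<Rightarrow> 'u) list \<Rightarrow> 'u \<Rightarrow> 'u" where
  "tuple_map U As fs =
     (\<lambda>z\<in>tuples U As. tuple U (map2 (\<lambda>f x. f x) fs (untuple U (length As) z)))"


section \<open>Topological categories over Set\<close>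

text \<open>
  The faithful functor to Set is injective on each hom-class, so a morphism \<open>V \<rightarrow> W\<close> is identified
  with its underlying function: \<open>Hom C V W\<close> is the set of admissible functions from \<open>Und C V\<close> to
  \<open>Und C W\<close>.
\<close>

record ('u, 'v) concrete = "'u universe" +
  Obj :: "'v set"
  Und :: "'v \<Rightarrow> 'u set"
  Hom :: "'v \<Rightarrow> 'v \<Rightarrow> ('u \<Rightarrow> 'u) set"

locale concrete_category = set_universe C
  for C :: "('u, 'v, 'm) concrete_scheme" +
  assumes Und_small: "V \<in> Obj C \<Longrightarrow> small C (Und C V)"
    and Hom_subset: "\<lbrakk>V \<in> Obj C; W \<in> Obj C\<rbrakk> \<Longrightarrow> Hom C V W \<subseteq> Und C V \<rightarrow>\<^sub>E Und C W"
    and Hom_id: "V \<in> Obj C \<Longrightarrow> (\<lambda>x\<in>Und C V. x) \<in> Hom C V V"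
    and Hom_compose: "\<lbrakk>V \<in> Obj C; W \<in> Obj C; Z \<in> Obj C; f \<in> Hom C V W; g \<in> Hom C W Z\<rbrakk>
          \<Longrightarrow> compose (Und C V) g f \<in> Hom C V Z"

definition Fib :: "('u, 'v, 'm) concrete_scheme \<Rightarrow> 'u set \<Rightarrow> 'v gorder" where
  "Fib C Y = \<lparr>carrier = {V \<in> Obj C. Und C V = Y}, eq = (=),
              le = (\<lambda>V W. (\<lambda>x\<in>Y. x) \<in> Hom C V W)\<rparr>"

text \<open>
  A source is given by the class of pairs \<open>(f\<^sub>i, V\<^sub>i)\<close> of its members; neither initiality nor the
  notion of lift depends on how these are indexed.
\<close>

definition structured_source ::
  "('u, 'v, 'm) concrete_scheme \<Rightarrow> 'u set \<Rightarrow> (('u \<Rightarrow> 'u) \<times> 'v) set \<Rightarrow> bool" where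
  "structured_source C Y \<F> \<longleftrightarrow> small C Y \<and> (\<forall>(f, W)\<in>\<F>. W \<in> Obj C \<and> f \<in> Y \<rightarrow>\<^sub>E Und C W)"

definition initial_source ::
  "('u, 'v, 'm) concrete_scheme \<Rightarrow> 'v \<Rightarrow> (('u \<Rightarrow> 'u) \<times> 'v) set \<Rightarrow> bool" where
  "initial_source C V \<F> \<longleftrightarrow>
     (\<forall>(f, W)\<in>\<F>. f \<in> Hom C V W) \<and>
     (\<forall>W\<in>Obj C. \<forall>g \<in> Und C W \<rightarrow>\<^sub>E Und C V.
        g \<in> Hom C W V \<longleftrightarrow> (\<forall>(f, Z)\<in>\<F>. compose (Und C W) f g \<in> Hom C W Z))"

locale topological_category = concrete_category C
  for C :: "('u, 'v, 'm) concrete_scheme" +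
  assumes amnestic: "\<lbrakk>V \<in> carrier (Fib C Y); W \<in> carrier (Fib C Y);
                      le (Fib C Y) V W; le (Fib C Y) W V\<rbrakk> \<Longrightarrow> V = W"
    and initial_lift: "structured_source C Y \<F> \<Longrightarrow>
                       \<exists>V\<in>Obj C. Und C V = Y \<and> initial_source C V \<F>"

definition Indisc :: "('u, 'v, 'm) concrete_scheme \<Rightarrow> 'u set \<Rightarrow> 'v" where
  "Indisc C Y = (THE V. greatest (Fib C Y) V (carrier (Fib C Y)))"

text \<open>
  Finite categorical products, chosen over the cartesian products of Set (unique by amnesticity).
\<close>

definition is_product :: "('u, 'v, 'm) concrete_scheme \<Rightarrow> 'v list \<Rightarrow> 'v \<Rightarrow> bool" where
  "is_product C Vs Z \<longleftrightarrow>
     Z \<in> Obj C \<and> Und C Z = tuples C (map (Und C) Vs) \<and>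
     (\<forall>i<length Vs. tuple_proj C (map (Und C) Vs) i \<in> Hom C Z (Vs ! i)) \<and>
     (\<forall>W\<in>Obj C. \<forall>h. (\<forall>i<length Vs. h i \<in> Hom C W (Vs ! i)) \<longrightarrow>
        (\<exists>!k. k \<in> Hom C W Z \<and>
              (\<forall>i<length Vs. compose (Und C W) (tuple_proj C (map (Und C) Vs) i) k = h i)))"

definition Prod :: "('u, 'v, 'm) concrete_scheme \<Rightarrow> 'v list \<Rightarrow> 'v" where
  "Prod C Vs = (THE Z. is_product C Vs Z)"

text \<open>
  A symmetric monoidal structure for which the forgetful functor is strict symmetric monoidal.
  Strictness says that the tensor product of morphisms and all structure isomorphisms lie over those
  of the cartesian structure of Set, so the only data are the tensor product of objects and the unit
  object, and what has to hold is that the cartesian maps (and their inverses) are admissible;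
  functoriality, naturality and the coherence diagrams then hold because they hold in Set.
\<close>

record ('u, 'v) concrete_monoidal = "('u, 'v) concrete" +
  Ten :: "'v \<Rightarrow> 'v \<Rightarrow> 'v"
  Unt :: "'v"

locale topological_monoidal_category = topological_category C
  for C :: "('u, 'v, 'm) concrete_monoidal_scheme" +
  assumes Unt_Obj: "Unt C \<in> Obj C"
    and Und_Unt: "Und C (Unt C) = {upt C}"
    and Ten_Obj: "\<lbrakk>V \<in> Obj C; W \<in> Obj C\<rbrakk> \<Longrightarrow> Ten C V W \<in> Obj C"
    and Und_Ten: "\<lbrakk>V \<in> Obj C; W \<in> Obj C\<rbrakk> \<Longrightarrow> Und C (Ten C V W) = cart C (Und C V) (Und C W)"
    and Ten_Hom: "\<lbrakk>V \<in> Obj C; V' \<in> Obj C; W \<in> Obj C; W' \<in> Obj C;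
                   f \<in> Hom C V V'; g \<in> Hom C W W'\<rbrakk>
          \<Longrightarrow> cart_map C (Und C V) (Und C W) f g \<in> Hom C (Ten C V W) (Ten C V' W')"
    and assoc: "\<lbrakk>V \<in> Obj C; W \<in> Obj C; Z \<in> Obj C\<rbrakk> \<Longrightarrow>
          (\<lambda>z\<in>cart C (cart C (Und C V) (Und C W)) (Und C Z).
             upair C (ufst C (ufst C z)) (upair C (usnd C (ufst C z)) (usnd C z)))
          \<in> Hom C (Ten C (Ten C V W) Z) (Ten C V (Ten C W Z))"
    and assoc_inv: "\<lbrakk>V \<in> Obj C; W \<in> Obj C; Z \<in> Obj C\<rbrakk> \<Longrightarrow>
          (\<lambda>z\<in>cart C (Und C V) (cart C (Und C W) (Und C Z)).
             upair C (upair C (ufst C z) (ufst C (usnd C z))) (usnd C (usnd C z)))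
          \<in> Hom C (Ten C V (Ten C W Z)) (Ten C (Ten C V W) Z)"
    and lunit: "V \<in> Obj C \<Longrightarrow> (\<lambda>z\<in>cart C {upt C} (Und C V). usnd C z) \<in> Hom C (Ten C (Unt C) V) V"
    and lunit_inv: "V \<in> Obj C \<Longrightarrow> (\<lambda>x\<in>Und C V. upair C (upt C) x) \<in> Hom C V (Ten C (Unt C) V)"
    and runit: "V \<in> Obj C \<Longrightarrow> (\<lambda>z\<in>cart C (Und C V) {upt C}. ufst C z) \<in> Hom C (Ten C V (Unt C)) V"
    and runit_inv: "V \<in> Obj C \<Longrightarrow> (\<lambda>x\<in>Und C V. upair C x (upt C)) \<in> Hom C V (Ten C V (Unt C))"
    and symm: "\<lbrakk>V \<in> Obj C; W \<in> Obj C\<rbrakk> \<Longrightarrow>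
          (\<lambda>z\<in>cart C (Und C V) (Und C W). upair C (usnd C z) (ufst C z))
          \<in> Hom C (Ten C V W) (Ten C W V)"

text \<open>
  The category of \<open>S\<close>-sorted objects.  Families indexed by \<open>S\<close> are extensional functions, so that
  equality of families is equality in HOL.
\<close>

definition SObj :: "('u, 'v, 'm) concrete_scheme \<Rightarrow> 's set \<Rightarrow> ('s \<Rightarrow> 'v) set" where
  "SObj C S = S \<rightarrow>\<^sub>E Obj C"

definition SHom ::
  "('u, 'v, 'm) concrete_scheme \<Rightarrow> 's set \<Rightarrow> ('s \<Rightarrow> 'v) \<Rightarrow> ('s \<Rightarrow> 'v) \<Rightarrow> ('s \<Rightarrow> 'u \<Rightarrow> 'u) set" where
  "SHom C S X Y = (\<Pi>\<^sub>E s\<in>S. Hom C (X s) (Y s))"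

definition SFib ::
  "('u, 'v, 'm) concrete_scheme \<Rightarrow> 's set \<Rightarrow> ('s \<Rightarrow> 'u set) \<Rightarrow> ('s \<Rightarrow> 'v) gorder" where
  "SFib C S Y = \<lparr>carrier = {B \<in> SObj C S. \<forall>s\<in>S. Und C (B s) = Y s}, eq = (=),
                 le = (\<lambda>A B. \<forall>s\<in>S. le (Fib C (Y s)) (A s) (B s))\<rparr>"


section \<open>Classical equational theories\<close>

record ('s, 'f) csig =
  csorts :: "'s set"
  csyms  :: "'f set"
  cargs  :: "'f \<Rightarrow> 's list"
  cres   :: "'f \<Rightarrow> 's"

record ('s, 'f, 'x) calg =
  ccar :: "'s \<Rightarrow> 'x set"
  cop  :: "'f \<Rightarrow> 'x list \<Rightarrow> 'x"

text \<open>Equality of classical algebras, ignoring the values outside the sorts and the domains.\<close>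

definition calg_eq :: "('s, 'f) csig \<Rightarrow> ('s, 'f, 'x) calg \<Rightarrow> ('s, 'f, 'x) calg \<Rightarrow> bool" where
  "calg_eq \<Sigma> D D' \<longleftrightarrow>
     (\<forall>s\<in>csorts \<Sigma>. ccar D s = ccar D' s) \<and>
     (\<forall>f\<in>csyms \<Sigma>. \<forall>xs\<in>listset (map (ccar D) (cargs \<Sigma> f)). cop D f xs = cop D' f xs)"

text \<open>
  Terms over sorted constants.  The variables of sort \<open>s\<close> are the pairs \<open>(s, i)\<close> with \<open>i :: nat\<close>;
  terms in a context are the terms whose constants are the variables of the context.
\<close>

datatype ('s, 'f, 'c) trm = Const 's 'c | App 'f "('s, 'f, 'c) trm list"

inductive wf_trm :: "('s, 'f) csig \<Rightarrow> ('s \<Rightarrow> 'c set) \<Rightarrow> 's \<Rightarrow> ('s, 'f, 'c) trm \<Rightarrow> bool"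
  for \<Sigma> Y where
  Const: "\<lbrakk>s \<in> csorts \<Sigma>; c \<in> Y s\<rbrakk> \<Longrightarrow> wf_trm \<Sigma> Y s (Const s c)"
| App: "\<lbrakk>f \<in> csyms \<Sigma>; list_all2 (wf_trm \<Sigma> Y) (cargs \<Sigma> f) ts\<rbrakk> \<Longrightarrow> wf_trm \<Sigma> Y (cres \<Sigma> f) (App f ts)"

definition term_alg ::
  "('s, 'f) csig \<Rightarrow> ('s \<Rightarrow> 'c set) \<Rightarrow> ('s, 'f, ('s, 'f, 'c) trm) calg" where
  "term_alg \<Sigma> Y = \<lparr>ccar = (\<lambda>s. {t. wf_trm \<Sigma> Y s t}), cop = App\<rparr>"

primrec eval :: "('s, 'f, 'x) calg \<Rightarrow> ('s \<Rightarrow> 'c \<Rightarrow> 'x) \<Rightarrow> ('s, 'f, 'c) trm \<Rightarrow> 'x" where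
  "eval D \<rho> (Const s c) = \<rho> s c"
| "eval D \<rho> (App f ts) = cop D f (map (eval D \<rho>) ts)"

type_synonym 's ctx = "('s \<times> nat) list"

definition ctx_consts :: "'s ctx \<Rightarrow> 's \<Rightarrow> nat set" where
  "ctx_consts vs s = {i. (s, i) \<in> set vs}"

definition interp :: "('s, 'f, 'x) calg \<Rightarrow> 's ctx \<Rightarrow> ('s, 'f, nat) trm \<Rightarrow> 'x list \<Rightarrow> 'x" where
  "interp D vs t ds = eval D (\<lambda>s i. the (map_of (zip vs ds) (s, i))) t"

record ('s, 'f) ceqn =
  ceq_ctx  :: "'s ctx"
  ceq_sort :: 's
  ceq_lhs  :: "('s, 'f, nat) trm"
  ceq_rhs  :: "('s, 'f, nat) trm"

definition congruence ::
  "('s, 'f) csig \<Rightarrow> ('s, 'f, 'x) calg \<Rightarrow> ('s \<Rightarrow> ('x \<times> 'x) set) \<Rightarrow> bool" where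
  "congruence \<Sigma> D R \<longleftrightarrow>
     (\<forall>s\<in>csorts \<Sigma>. equiv (ccar D s) (R s)) \<and>
     (\<forall>f\<in>csyms \<Sigma>. \<forall>xs ys.
        length xs = length (cargs \<Sigma> f) \<and> length ys = length (cargs \<Sigma> f) \<and>
        (\<forall>i<length (cargs \<Sigma> f). (xs ! i, ys ! i) \<in> R (cargs \<Sigma> f ! i)) \<longrightarrow>
        (cop D f xs, cop D f ys) \<in> R (cres \<Sigma> f))"

definition generated_congruence ::
  "('s, 'f) csig \<Rightarrow> ('s, 'f, 'x) calg \<Rightarrow> ('s, 'f) ceqn set \<Rightarrow> 's \<Rightarrow> ('x \<times> 'x) set" where
  "generated_congruence \<Sigma> D E s =
     {(a, b). \<forall>R. congruence \<Sigma> D R \<and>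
        (\<forall>e\<in>E. \<forall>ds \<in> listset (map (\<lambda>(s, i). ccar D s) (ceq_ctx e)).
           (interp D (ceq_ctx e) (ceq_lhs e) ds, interp D (ceq_ctx e) (ceq_rhs e) ds)
             \<in> R (ceq_sort e))
        \<longrightarrow> (a, b) \<in> R s}"

text \<open>The union over all representatives is a single class when \<open>R\<close> is a congruence.\<close>

definition quotient_alg ::
  "('s, 'f) csig \<Rightarrow> ('s, 'f, 'x) calg \<Rightarrow> ('s \<Rightarrow> ('x \<times> 'x) set) \<Rightarrow> ('s, 'f, 'x set) calg" where
  "quotient_alg \<Sigma> D R =
     \<lparr>ccar = (\<lambda>s. ccar D s // R s),
      cop = (\<lambda>f Ks. \<Union>xs\<in>listset Ks. R (cres \<Sigma> f) `` {cop D f xs})\<rparr>"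

text \<open>
  Terms and classes of terms are not literally elements of \<open>'u\<close>; an algebra of them is regarded as
  an algebra in Set through a fixed bijection \<open>code\<close> of its elements with a set.
\<close>

definition elements :: "('s, 'f) csig \<Rightarrow> ('s, 'f, 'x) calg \<Rightarrow> 'x set" where
  "elements \<Sigma> D = (\<Union>s\<in>csorts \<Sigma>. ccar D s)"

definition code ::
  "('u, 'm) universe_scheme \<Rightarrow> ('s, 'f) csig \<Rightarrow> ('s, 'f, 'x) calg \<Rightarrow> 'x \<Rightarrow> 'u" where
  "code U \<Sigma> D = (SOME e. inj_on e (elements \<Sigma> D) \<and> small U (e ` elements \<Sigma> D))"

definition decode ::
  "('u, 'm) universe_scheme \<Rightarrow> ('s, 'f) csig \<Rightarrow> ('s, 'f, 'x) calg \<Rightarrow> 'u \<Rightarrow> 'x" where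
  "decode U \<Sigma> D = inv_into (elements \<Sigma> D) (code U \<Sigma> D)"

definition in_Set ::
  "('u, 'm) universe_scheme \<Rightarrow> ('s, 'f) csig \<Rightarrow> ('s, 'f, 'x) calg \<Rightarrow> ('s, 'f, 'u) calg" where
  "in_Set U \<Sigma> D =
     \<lparr>ccar = (\<lambda>s. code U \<Sigma> D ` ccar D s),
      cop = (\<lambda>f us. code U \<Sigma> D (cop D f (map (decode U \<Sigma> D) us)))\<rparr>"


section \<open>Enriched equational theories\<close>

record ('s, 'o, 'v) esig =
  sorts :: "'s set"
  syms  :: "'o set"
  args  :: "'o \<Rightarrow> 's list"
  res   :: "'o \<Rightarrow> 's"
  param :: "'o \<Rightarrow> 'v"

definition enriched_signature ::
  "('u, 'v, 'm) concrete_scheme \<Rightarrow> ('s, 'o, 'v) esig \<Rightarrow> bool" where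
  "enriched_signature C \<Sigma> \<longleftrightarrow>
     small_sized C (sorts \<Sigma>) \<and> small_sized C (syms \<Sigma>) \<and>
     (\<forall>\<sigma>\<in>syms \<Sigma>. set (args \<Sigma> \<sigma>) \<subseteq> sorts \<Sigma> \<and> res \<Sigma> \<sigma> \<in> sorts \<Sigma> \<and> param \<Sigma> \<sigma> \<in> Obj C)"

record ('s, 'o, 'u, 'v) ealg =
  car :: "'s \<Rightarrow> 'v"
  opn :: "'o \<Rightarrow> 'u \<Rightarrow> 'u"

text \<open>
  For a family \<open>A\<close> and sorts \<open>Ss = [S\<^sub>1, \<dots>, S\<^sub>n]\<close>, \<open>dom_obj C A Ss P\<close> is the object
  \<open>P \<otimes> (A\<^sub>S\<^sub>1 \<times> \<dots> \<times> A\<^sub>S\<^sub>n)\<close>, and \<open>dom_map C A Ss P f\<close> is the map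
  \<open>1\<^sub>P \<otimes> (f\<^sub>S\<^sub>1 \<times> \<dots> \<times> f\<^sub>S\<^sub>n)\<close> out of it.
\<close>

definition dom_obj ::
  "('u, 'v, 'm) concrete_monoidal_scheme \<Rightarrow> ('s \<Rightarrow> 'v) \<Rightarrow> 's list \<Rightarrow> 'v \<Rightarrow> 'v" where
  "dom_obj C A Ss P = Ten C P (Prod C (map A Ss))"

definition dom_map ::
  "('u, 'v, 'm) concrete_monoidal_scheme \<Rightarrow> ('s \<Rightarrow> 'v) \<Rightarrow> 's list \<Rightarrow> 'v \<Rightarrow>
   ('s \<Rightarrow> 'u \<Rightarrow> 'u) \<Rightarrow> 'u \<Rightarrow> 'u" where
  "dom_map C A Ss P f =
     cart_map C (Und C P) (tuples C (map (\<lambda>s. Und C (A s)) Ss))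
       (\<lambda>p\<in>Und C P. p) (tuple_map C (map (\<lambda>s. Und C (A s)) Ss) (map f Ss))"

definition is_alg ::
  "('u, 'v, 'm) concrete_monoidal_scheme \<Rightarrow> ('s, 'o, 'v) esig \<Rightarrow> ('s, 'o, 'u, 'v) ealg \<Rightarrow> bool"
  where
  "is_alg C \<Sigma> A \<longleftrightarrow>
     car A \<in> SObj C (sorts \<Sigma>) \<and>
     opn A \<in> (\<Pi>\<^sub>E \<sigma>\<in>syms \<Sigma>.
                Hom C (dom_obj C (car A) (args \<Sigma> \<sigma>) (param \<Sigma> \<sigma>)) (car A (res \<Sigma> \<sigma>)))"

definition alg_homs ::
  "('u, 'v, 'm) concrete_monoidal_scheme \<Rightarrow> ('s, 'o, 'v) esig \<Rightarrow>
   ('s, 'o, 'u, 'v) ealg \<Rightarrow> ('s, 'o, 'u, 'v) ealg \<Rightarrow> ('s \<Rightarrow> 'u \<Rightarrow> 'u) set" where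
  "alg_homs C \<Sigma> A B =
     {f \<in> SHom C (sorts \<Sigma>) (car A) (car B). \<forall>\<sigma>\<in>syms \<Sigma>.
        let T = Und C (dom_obj C (car A) (args \<Sigma> \<sigma>) (param \<Sigma> \<sigma>)) in
        compose T (f (res \<Sigma> \<sigma>)) (opn A \<sigma>)
          = compose T (opn B \<sigma>) (dom_map C (car A) (args \<Sigma> \<sigma>) (param \<Sigma> \<sigma>) f)}"

definition und_sig :: "('u, 'v, 'm) concrete_scheme \<Rightarrow> ('s, 'o, 'v) esig \<Rightarrow> ('s, 'o \<times> 'u) csig" where
  "und_sig C \<Sigma> =
     \<lparr>csorts = sorts \<Sigma>, csyms = (SIGMA \<sigma>:syms \<Sigma>. Und C (param \<Sigma> \<sigma>)),
      cargs = (\<lambda>(\<sigma>, p). args \<Sigma> \<sigma>), cres = (\<lambda>(\<sigma>, p). res \<Sigma> \<sigma>)\<rparr>"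

definition und_alg ::
  "('u, 'v, 'm) concrete_scheme \<Rightarrow> ('s, 'o, 'u, 'v) ealg \<Rightarrow> ('s, 'o \<times> 'u, 'u) calg" where
  "und_alg C A =
     \<lparr>ccar = (\<lambda>s. Und C (car A s)), cop = (\<lambda>(\<sigma>, p) ds. opn A \<sigma> (upair C p (tuple C ds)))\<rparr>"

text \<open>
  For a classical algebra \<open>D\<close> over the underlying signature, the function
  \<open>(p, d\<^sub>1, \<dots>, d\<^sub>n) \<mapsto> \<sigma>\<^sub>p\<^sup>D(d\<^sub>1, \<dots>, d\<^sub>n)\<close>.
\<close>

definition joint_op ::
  "('u, 'v, 'm) concrete_scheme \<Rightarrow> ('s, 'o, 'v) esig \<Rightarrow> ('s, 'o \<times> 'u, 'u) calg \<Rightarrow> 'o \<Rightarrow> 'u \<Rightarrow> 'u"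
  where
  "joint_op C \<Sigma> D \<sigma> =
     (\<lambda>z\<in>cart C (Und C (param \<Sigma> \<sigma>)) (tuples C (map (ccar D) (args \<Sigma> \<sigma>))).
        cop D (\<sigma>, ufst C z) (untuple C (length (args \<Sigma> \<sigma>)) (usnd C z)))"

definition indisc_alg ::
  "('u, 'v, 'm) concrete_scheme \<Rightarrow> ('s, 'o, 'v) esig \<Rightarrow> ('s, 'o \<times> 'u, 'u) calg \<Rightarrow>
   ('s, 'o, 'u, 'v) ealg" where
  "indisc_alg C \<Sigma> D =
     \<lparr>car = (\<lambda>s\<in>sorts \<Sigma>. Indisc C (ccar D s)), opn = (\<lambda>\<sigma>\<in>syms \<Sigma>. joint_op C \<Sigma> D \<sigma>)\<rparr>"

text \<open>Algebraic operations: natural transformations \<open>P \<otimes> U\<^sup>S\<^sup>s \<Rightarrow> U\<^sup>s\<close>, given by their components.\<close>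

definition alg_operation ::
  "('u, 'v, 'm) concrete_monoidal_scheme \<Rightarrow> ('s, 'o, 'v) esig \<Rightarrow> 's list \<Rightarrow> 's \<Rightarrow> 'v \<Rightarrow>
   (('s, 'o, 'u, 'v) ealg \<Rightarrow> 'u \<Rightarrow> 'u) \<Rightarrow> bool" where
  "alg_operation C \<Sigma> Ss s P \<omega> \<longleftrightarrow>
     set Ss \<subseteq> sorts \<Sigma> \<and> s \<in> sorts \<Sigma> \<and> P \<in> Obj C \<and>
     (\<forall>A. is_alg C \<Sigma> A \<longrightarrow> \<omega> A \<in> Hom C (dom_obj C (car A) Ss P) (car A s)) \<and>
     (\<forall>A B. is_alg C \<Sigma> A \<and> is_alg C \<Sigma> B \<longrightarrow>
        (\<forall>f \<in> alg_homs C \<Sigma> A B.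
           compose (Und C (dom_obj C (car A) Ss P)) (f s) (\<omega> A)
             = compose (Und C (dom_obj C (car A) Ss P)) (\<omega> B) (dom_map C (car A) Ss P f)))"

record ('s, 'o, 'u, 'v) aeqn =
  aeq_args  :: "'s list"
  aeq_res   :: 's
  aeq_param :: 'v
  aeq_lhs   :: "('s, 'o, 'u, 'v) ealg \<Rightarrow> 'u \<Rightarrow> 'u"
  aeq_rhs   :: "('s, 'o, 'u, 'v) ealg \<Rightarrow> 'u \<Rightarrow> 'u"

definition enriched_theory ::
  "('u, 'v, 'm) concrete_monoidal_scheme \<Rightarrow> ('s, 'o, 'v) esig \<Rightarrow> ('s, 'o, 'u, 'v) aeqn set \<Rightarrow> bool"
  where
  "enriched_theory C \<Sigma> E \<longleftrightarrow>
     enriched_signature C \<Sigma> \<and> small_sized C E \<and>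
     (\<forall>e\<in>E. alg_operation C \<Sigma> (aeq_args e) (aeq_res e) (aeq_param e) (aeq_lhs e) \<and>
            alg_operation C \<Sigma> (aeq_args e) (aeq_res e) (aeq_param e) (aeq_rhs e))"

definition is_theory_alg ::
  "('u, 'v, 'm) concrete_monoidal_scheme \<Rightarrow> ('s, 'o, 'v) esig \<Rightarrow> ('s, 'o, 'u, 'v) aeqn set \<Rightarrow>
   ('s, 'o, 'u, 'v) ealg \<Rightarrow> bool" where
  "is_theory_alg C \<Sigma> E A \<longleftrightarrow> is_alg C \<Sigma> A \<and> (\<forall>e\<in>E. aeq_lhs e A = aeq_rhs e A)"

text \<open>
  The term \<open>t\<^bsub>\<omega>,p\<^esub>\<close>: the value of the component of \<open>\<omega>\<close> at the indiscrete algebra of terms in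
  context, at the parameter \<open>p\<close> and the tuple of variables.
\<close>

definition und_term ::
  "('u, 'v, 'm) concrete_scheme \<Rightarrow> ('s, 'o, 'v) esig \<Rightarrow> (('s, 'o, 'u, 'v) ealg \<Rightarrow> 'u \<Rightarrow> 'u) \<Rightarrow>
   's ctx \<Rightarrow> 'u \<Rightarrow> ('s, 'o \<times> 'u, nat) trm" where
  "und_term C \<Sigma> \<omega> vs p =
     (let D = term_alg (und_sig C \<Sigma>) (ctx_consts vs) in
      decode C (und_sig C \<Sigma>) D
        (\<omega> (indisc_alg C \<Sigma> (in_Set C (und_sig C \<Sigma>) D))
           (upair C p (tuple C (map (\<lambda>(s, i). code C (und_sig C \<Sigma>) D (Const s i)) vs)))))"

definition und_eqns ::
  "('u, 'v, 'm) concrete_scheme \<Rightarrow> ('s, 'o, 'v) esig \<Rightarrow> ('s, 'o, 'u, 'v) aeqn set \<Rightarrow>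
   ('s, 'o \<times> 'u) ceqn set" where
  "und_eqns C \<Sigma> E =
     {\<lparr>ceq_ctx = vs, ceq_sort = aeq_res e,
       ceq_lhs = und_term C \<Sigma> (aeq_lhs e) vs p, ceq_rhs = und_term C \<Sigma> (aeq_rhs e) vs p\<rparr>
      | e vs p. e \<in> E \<and> distinct vs \<and> map fst vs = aeq_args e \<and> p \<in> Und C (aeq_param e)}"


section \<open>Free algebras and compatibility\<close>

text \<open>
  The \<open>S\<close>-sorted set of classes of ground terms with constants in \<open>|X|\<close>, as the free algebra of the
  underlying classical theory, and its copy in Set.
\<close>

definition class_alg ::
  "('u, 'v, 'm) concrete_scheme \<Rightarrow> ('s, 'o, 'v) esig \<Rightarrow> ('s, 'o, 'u, 'v) aeqn set \<Rightarrow> ('s \<Rightarrow> 'v) \<Rightarrow>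
   ('s, 'o \<times> 'u, ('s, 'o \<times> 'u, 'u) trm set) calg" where
  "class_alg C \<Sigma> E X =
     (let T = term_alg (und_sig C \<Sigma>) (\<lambda>s. Und C (X s)) in
      quotient_alg (und_sig C \<Sigma>) T (generated_congruence (und_sig C \<Sigma>) T (und_eqns C \<Sigma> E)))"

definition free_calg ::
  "('u, 'v, 'm) concrete_scheme \<Rightarrow> ('s, 'o, 'v) esig \<Rightarrow> ('s, 'o, 'u, 'v) aeqn set \<Rightarrow> ('s \<Rightarrow> 'v) \<Rightarrow>
   ('s, 'o \<times> 'u, 'u) calg" where
  "free_calg C \<Sigma> E X = in_Set C (und_sig C \<Sigma>) (class_alg C \<Sigma> E X)"

definition free_unit ::
  "('u, 'v, 'm) concrete_scheme \<Rightarrow> ('s, 'o, 'v) esig \<Rightarrow> ('s, 'o, 'u, 'v) aeqn set \<Rightarrow> ('s \<Rightarrow> 'v) \<Rightarrow>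
   's \<Rightarrow> 'u \<Rightarrow> 'u" where
  "free_unit C \<Sigma> E X =
     (\<lambda>s\<in>sorts \<Sigma>. \<lambda>x\<in>Und C (X s).
        code C (und_sig C \<Sigma>) (class_alg C \<Sigma> E X)
          (generated_congruence (und_sig C \<Sigma>) (term_alg (und_sig C \<Sigma>) (\<lambda>s. Und C (X s)))
             (und_eqns C \<Sigma> E) s `` {Const s x}))"

text \<open>
  The free algebra on \<open>X\<close>: an algebra whose underlying classical algebra is the free one, with
  \<^const>\<open>free_unit\<close> as a universal arrow from \<open>X\<close> to the forgetful functor.
\<close>

definition is_free_alg ::
  "('u, 'v, 'm) concrete_monoidal_scheme \<Rightarrow> ('s, 'o, 'v) esig \<Rightarrow> ('s, 'o, 'u, 'v) aeqn set \<Rightarrow>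
   ('s \<Rightarrow> 'v) \<Rightarrow> ('s, 'o, 'u, 'v) ealg \<Rightarrow> bool" where
  "is_free_alg C \<Sigma> E X A \<longleftrightarrow>
     is_theory_alg C \<Sigma> E A \<and>
     calg_eq (und_sig C \<Sigma>) (und_alg C A) (free_calg C \<Sigma> E X) \<and>
     free_unit C \<Sigma> E X \<in> SHom C (sorts \<Sigma>) X (car A) \<and>
     (\<forall>B. is_theory_alg C \<Sigma> E B \<longrightarrow>
        (\<forall>f \<in> SHom C (sorts \<Sigma>) X (car B).
           \<exists>!h. h \<in> alg_homs C \<Sigma> A B \<and>
                (\<forall>s\<in>sorts \<Sigma>. compose (Und C (X s)) (h s) (free_unit C \<Sigma> E X s) = f s)))"

definition free_alg ::
  "('u, 'v, 'm) concrete_monoidal_scheme \<Rightarrow> ('s, 'o, 'v) esig \<Rightarrow> ('s, 'o, 'u, 'v) aeqn set \<Rightarrow>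
   ('s \<Rightarrow> 'v) \<Rightarrow> ('s, 'o, 'u, 'v) ealg" where
  "free_alg C \<Sigma> E X = (SOME A. is_free_alg C \<Sigma> E X A)"

definition compatible ::
  "('u, 'v, 'm) concrete_monoidal_scheme \<Rightarrow> ('s, 'o, 'v) esig \<Rightarrow> ('s, 'o, 'u, 'v) aeqn set \<Rightarrow>
   ('s \<Rightarrow> 'v) \<Rightarrow> ('s \<Rightarrow> 'v) \<Rightarrow> bool" where
  "compatible C \<Sigma> E X B \<longleftrightarrow>
     free_unit C \<Sigma> E X \<in> SHom C (sorts \<Sigma>) X B \<and>
     (\<forall>\<sigma>\<in>syms \<Sigma>. joint_op C \<Sigma> (free_calg C \<Sigma> E X) \<sigma>
                    \<in> Hom C (dom_obj C B (args \<Sigma> \<sigma>) (param \<Sigma> \<sigma>)) (B (res \<Sigma> \<sigma>)))"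

end

theory Submission
  imports Defs
begin

text \<open>
  An algebraic operation is determined by its underlying terms (naturality, through the indiscrete
  term algebra), so an enriched algebra satisfies \<open>\<E>\<close> as soon as its underlying classical algebra
  satisfies \<open>|\<E>|\<close>.  Hence a family compatible with \<open>X\<close> is the same as a theory algebra on the classical
  free algebra with admissible unit.  The initial lift of the identities into all compatible families
  is again compatible, and it is free: for a theory algebra \<open>M\<close> and \<open>f : X \<rightarrow> M\<close>, the initial lift of
  the classical extension of \<open>f\<close> is one of the compatible families.  Conversely, freeness yields for
  every compatible \<open>B\<close> a homomorphism from the free algebra to \<open>B\<close> under \<open>X\<close>; its underlying function
  is the identity, so the free algebra lies below \<open>B\<close>.
\<close>

section \<open>Small classes\<close>

text \<open>Terms and classes of terms are not elements of \<open>'u\<close>, and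
  \<open>code\<close> is a bijection with a set only once their class is known to be small-sized.
  Power sets are not at hand, so terms are collected in countably many stages, each obtained by
  small unions, products and lists. The tensor product need not preserve initial sources, so the
  domain of an operation on the least family need not be the infimum of its domains on the
  compatible families. Functoriality suffices: the identity into each compatible \<open>B\<close>
  induces an admissible map of domains, and the target is an infimum. A function into an indiscrete
  object is always admissible. Classical homomorphisms into an indiscrete algebra are therefore
  enriched ones, and naturality becomes available along arbitrary assignments of elements to
  variables. \<open>free_alg\<close> is a Hilbert choice. The algebra on the least family shows that
  the choice has a value; the comparison with the compatible families then concerns an arbitrary
  free algebra, without identifying it with the constructed one.\<close>

context set_universe
begin

lemma small_image: "small U A \<Longrightarrow> small U (f ` A)"
  using small_UN[of A "\<lambda>a. {f a}"] small_singleton by (simp add: UNION_singleton_eq_range)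

lemma small_sized_small: "small U A \<Longrightarrow> small_sized U A"
  unfolding small_sized_def by (rule exI[of _ id]) simp

lemma small_sized_singleton: "small_sized U {a}"
  unfolding small_sized_def using small_singleton by auto

lemma small_sized_subset: "small_sized U A \<Longrightarrow> B \<subseteq> A \<Longrightarrow> small_sized U B"
  unfolding small_sized_def using small_subset by (meson image_mono inj_on_subset)

lemma small_sized_image:
  assumes "small_sized U A"
  shows "small_sized U (f ` A)"
proof -
  obtain e where e: "inj_on e A" "small U (e ` A)"
    using assms unfolding small_sized_def by blast
  \<comment> \<open>An element of the image is coded by the code of a chosen preimage; distinct
    elements have distinct preimages.\<close>
  have "inj_on (e \<circ> inv_into A f) (f ` A)"
    by (intro comp_inj_on inj_on_inv_into inj_on_subset[OF e(1)])
       (auto intro: inv_into_into)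
  moreover have "small U ((e \<circ> inv_into A f) ` (f ` A))"
    by (rule small_subset[OF e(2)]) (auto intro: inv_into_into)
  ultimately show ?thesis unfolding small_sized_def by blast
qed

text \<open>An element is coded by a pair: the code of an index and the code of the element in the
  member with that index. Members may overlap, so \<open>c\<close> fixes one index for each
  element.\<close>

lemma small_sized_UN:
  assumes "small_sized U A" "\<And>a. a \<in> A \<Longrightarrow> small_sized U (F a)"
  shows "small_sized U (\<Union>a\<in>A. F a)"
proof -
  obtain g where g: "inj_on g A" "small U (g ` A)"
    using assms(1) unfolding small_sized_def by blast
  obtain e where e: "\<And>a. a \<in> A \<Longrightarrow> inj_on (e a) (F a) \<and> small U (e a ` F a)"
    using assms(2) unfolding small_sized_def by metis
  define c where "c b = (SOME a. a \<in> A \<and> b \<in> F a)" for b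
  have c: "c b \<in> A \<and> b \<in> F (c b)" if b: "b \<in> (\<Union>a\<in>A. F a)" for b
    unfolding c_def by (rule someI_ex) (use b in blast)
  let ?h = "\<lambda>b. upair U (g (c b)) (e (c b) b)"
  have "inj_on ?h (\<Union>a\<in>A. F a)"
  proof (rule inj_onI)
    fix b b' assume b: "b \<in> (\<Union>a\<in>A. F a)" and b': "b' \<in> (\<Union>a\<in>A. F a)" and eq: "?h b = ?h b'"
    from eq have "g (c b) = g (c b')" "e (c b) b = e (c b') b'"
      using upair_inject by blast+
    with c[OF b] c[OF b'] g(1) e show "b = b'" by (metis inj_onD)
  qed
  moreover have "small U (?h ` (\<Union>a\<in>A. F a))"
  proof (rule small_subset)
    \<comment> \<open>\<open>small_UN\<close> wants an index set inside the universe, so the codes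
      \<open>g a\<close> serve as indices and \<open>inv_into A g\<close> recovers
      \<open>a\<close>.\<close>
    show "small U (\<Union>u\<in>g ` A. upair U u ` e (inv_into A g u) ` F (inv_into A g u))"
      using e by (intro small_UN g(2) small_image) (simp add: inv_into_into)
    show "?h ` (\<Union>a\<in>A. F a) \<subseteq> (\<Union>u\<in>g ` A. upair U u ` e (inv_into A g u) ` F (inv_into A g u))"
    proof
      fix z assume "z \<in> ?h ` (\<Union>a\<in>A. F a)"
      then obtain b where b: "b \<in> (\<Union>a\<in>A. F a)" "z = ?h b" by blast
      then have "inv_into A g (g (c b)) = c b" using c[OF b(1)] g(1) by simp
      then show "z \<in> (\<Union>u\<in>g ` A. upair U u ` e (inv_into A g u) ` F (inv_into A g u))"
        using c[OF b(1)] b(2) by (intro UN_I[of "g (c b)"]) auto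
    qed
  qed
  ultimately show ?thesis unfolding small_sized_def by blast
qed

text \<open>The axiom that some small set is infinite enters here; it makes countable unions and
  sets of variables available.\<close>

lemma small_sized_nat: "small_sized U (UNIV :: nat set)"
proof -
  obtain A where A: "small U A" "infinite A" using small_infinite by blast
  then obtain e :: "nat \<Rightarrow> 'u" where "inj e" "range e \<subseteq> A"
    using infinite_countable_subset by blast
  then show ?thesis unfolding small_sized_def using A(1) small_subset by blast
qed

lemma small_sized_nat_set: "small_sized U (A :: nat set)"
  by (rule small_sized_subset[OF small_sized_nat]) simp

lemma small_sized_Sigma:
  assumes "small_sized U A" "\<And>a. a \<in> A \<Longrightarrow> small_sized U (B a)"
  shows "small_sized U (Sigma A B)"
proof -
  have "Sigma A B = (\<Union>a\<in>A. Pair a ` B a)" by auto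
  then show ?thesis using assms by (simp add: small_sized_UN small_sized_image)
qed

lemma small_sized_Un:
  assumes "small_sized U A" "small_sized U B"
  shows "small_sized U (A \<union> B)"
proof -
  have "A \<union> B = (\<Union>n\<in>{0,1::nat}. if n = 0 then A else B)" by auto
  moreover have "small_sized U (\<Union>n\<in>{0,1::nat}. if n = 0 then A else B)"
    by (rule small_sized_UN[OF small_sized_nat_set]) (simp add: assms)
  ultimately show ?thesis by simp
qed

lemma small_sized_lists:
  assumes "small_sized U A"
  shows "small_sized U (lists A)"
proof -
  have len: "small_sized U {xs. set xs \<subseteq> A \<and> length xs = n}" for n
  proof (induction n)
    case 0
    have "{xs. set xs \<subseteq> A \<and> length xs = 0} = {[]}" by auto
    then show ?case by (metis small_sized_singleton)
  next
    case (Suc n)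
    have "{xs. set xs \<subseteq> A \<and> length xs = Suc n}
            = (\<lambda>(x, xs). x # xs) ` (A \<times> {xs. set xs \<subseteq> A \<and> length xs = n})"
      by (auto simp: length_Suc_conv image_iff)
    then show ?case by (simp add: small_sized_image small_sized_Sigma Suc assms)
  qed
  have "lists A = (\<Union>n. {xs. set xs \<subseteq> A \<and> length xs = n})" by (auto simp: lists_eq_set)
  then show ?thesis using small_sized_UN[OF small_sized_nat len] by simp
qed

end

section \<open>Classical algebras and homomorphisms\<close>

lemma listset_iff: "xs \<in> listset As \<longleftrightarrow> list_all2 (\<in>) xs As"
  by (induction As arbitrary: xs) (auto simp: set_Cons_def list_all2_Cons2)

lemma listset_length: "xs \<in> listset As \<Longrightarrow> length xs = length As"
  by (auto simp: listset_iff list_all2_conv_all_nth)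

text \<open>The records \<open>csig\<close> and \<open>calg\<close> carry no typing conditions.
  \<open>csignature\<close> and \<open>calgebra\<close> add the closure conditions that signatures
  and algebras have by definition.\<close>

definition csignature :: "('s, 'f) csig \<Rightarrow> bool" where
  "csignature \<Sigma> \<longleftrightarrow> (\<forall>f\<in>csyms \<Sigma>. set (cargs \<Sigma> f) \<subseteq> csorts \<Sigma> \<and> cres \<Sigma> f \<in> csorts \<Sigma>)"

definition calgebra :: "('s, 'f) csig \<Rightarrow> ('s, 'f, 'x) calg \<Rightarrow> bool" where
  "calgebra \<Sigma> D \<longleftrightarrow>
     (\<forall>f\<in>csyms \<Sigma>. \<forall>xs\<in>listset (map (ccar D) (cargs \<Sigma> f)). cop D f xs \<in> ccar D (cres \<Sigma> f))"

text \<open>Values off the carriers are left free, whereas the members of \<open>alg_homs\<close>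
  are extensional families; \<open>chom_restrict\<close> passes from the former to the
  latter.\<close>

definition chom ::
  "('s, 'f) csig \<Rightarrow> ('s, 'f, 'x) calg \<Rightarrow> ('s, 'f, 'y) calg \<Rightarrow> ('s \<Rightarrow> 'x \<Rightarrow> 'y) \<Rightarrow> bool" where
  "chom \<Sigma> D D' h \<longleftrightarrow>
     (\<forall>s\<in>csorts \<Sigma>. h s \<in> ccar D s \<rightarrow> ccar D' s) \<and>
     (\<forall>f\<in>csyms \<Sigma>. \<forall>xs\<in>listset (map (ccar D) (cargs \<Sigma> f)).
        h (cres \<Sigma> f) (cop D f xs) = cop D' f (map2 h (cargs \<Sigma> f) xs))"

lemma chomD:
  assumes "chom \<Sigma> D D' h"
  shows chom_in: "\<lbrakk>s \<in> csorts \<Sigma>; x \<in> ccar D s\<rbrakk> \<Longrightarrow> h s x \<in> ccar D' s"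
    and chom_cop: "\<lbrakk>f \<in> csyms \<Sigma>; xs \<in> listset (map (ccar D) (cargs \<Sigma> f))\<rbrakk> \<Longrightarrow>
           h (cres \<Sigma> f) (cop D f xs) = cop D' f (map2 h (cargs \<Sigma> f) xs)"
  using assms unfolding chom_def by blast+

lemma listset_map2:
  assumes "xs \<in> listset (map A ss)" "\<And>s x. s \<in> set ss \<Longrightarrow> x \<in> A s \<Longrightarrow> h s x \<in> B s"
  shows "map2 h ss xs \<in> listset (map B ss)"
  using assms unfolding listset_iff
  by (auto simp: list_all2_conv_all_nth)

section \<open>Evaluation of terms and its compatibility with homomorphisms\<close>

lemma eval_in:
  assumes "wf_trm \<Sigma> Y s t" "calgebra \<Sigma> D"
    and "\<And>s c. s \<in> csorts \<Sigma> \<Longrightarrow> c \<in> Y s \<Longrightarrow> \<rho> s c \<in> ccar D s"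
  shows "eval D \<rho> t \<in> ccar D s"
  using assms(1)
proof induction
  case (Const s c)
  then show ?case using assms(3) by simp
next
  case (App f ts)
  have "map (eval D \<rho>) ts \<in> listset (map (ccar D) (cargs \<Sigma> f))"
    using App(2) by (auto simp: listset_iff list_all2_conv_all_nth)
  then show ?case using assms(2) App(1) unfolding calgebra_def by simp
qed

text \<open>Induction runs over the typing derivation, which supplies the sort at which
  \<open>h\<close> is applied to each subterm. The two environments are related only on the
  constants that the typing allows.\<close>

lemma eval_hom:
  assumes "wf_trm \<Sigma> Y s t" "chom \<Sigma> D D' h" "calgebra \<Sigma> D"
    and "\<And>s c. s \<in> csorts \<Sigma> \<Longrightarrow> c \<in> Y s \<Longrightarrow> \<rho> s c \<in> ccar D s"
    and "\<And>s c. s \<in> csorts \<Sigma> \<Longrightarrow> c \<in> Y s \<Longrightarrow> \<rho>' s c = h s (\<rho> s c)"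
  shows "h s (eval D \<rho> t) = eval D' \<rho>' t"
  using assms(1)
proof induction
  case (Const s c)
  then show ?case using assms(5) by simp
next
  case (App f ts)
  have ts: "map (eval D \<rho>) ts \<in> listset (map (ccar D) (cargs \<Sigma> f))"
    using App(2) by (auto simp: listset_iff list_all2_conv_all_nth intro: eval_in[OF _ assms(3,4)])
  have "map2 h (cargs \<Sigma> f) (map (eval D \<rho>) ts) = map (eval D' \<rho>') ts"
    using App(2) by (auto simp: list_all2_conv_all_nth intro!: nth_equalityI)
  then show ?case using chom_cop[OF assms(2) App(1) ts] by simp
qed

lemma wf_trm_sort: "wf_trm \<Sigma> Y s t \<Longrightarrow> csignature \<Sigma> \<Longrightarrow> s \<in> csorts \<Sigma>"
  by (induction rule: wf_trm.induct) (auto simp: csignature_def)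

lemma term_alg_simps [simp]:
  "ccar (term_alg \<Sigma> Y) s = {t. wf_trm \<Sigma> Y s t}" "cop (term_alg \<Sigma> Y) f ts = App f ts"
  by (simp_all add: term_alg_def)

lemma calgebra_term_alg: "calgebra \<Sigma> (term_alg \<Sigma> Y)"
  unfolding calgebra_def
  by (auto simp: listset_iff list_all2_conv_all_nth intro!: wf_trm.App)

text \<open>This is the existence half of the freeness of the term algebra. \<open>eval\<close> does
  not look at sorts, so the extension of \<open>\<rho>\<close> is a constant family.\<close>

lemma chom_eval:
  assumes "calgebra \<Sigma> D" "\<And>s c. s \<in> csorts \<Sigma> \<Longrightarrow> c \<in> Y s \<Longrightarrow> \<rho> s c \<in> ccar D s"
  shows "chom \<Sigma> (term_alg \<Sigma> Y) D (\<lambda>_. eval D \<rho>)"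
  unfolding chom_def
proof (intro conjI ballI funcsetI)
  fix f xs assume "f \<in> csyms \<Sigma>" "xs \<in> listset (map (ccar (term_alg \<Sigma> Y)) (cargs \<Sigma> f))"
  then have "length xs = length (cargs \<Sigma> f)" by (auto simp: listset_iff list_all2_conv_all_nth)
  then have "map2 (\<lambda>_. eval D \<rho>) (cargs \<Sigma> f) xs = map (eval D \<rho>) xs"
    by (auto intro: nth_equalityI)
  then show "eval D \<rho> (cop (term_alg \<Sigma> Y) f xs) = cop D f (map2 (\<lambda>_. eval D \<rho>) (cargs \<Sigma> f) xs)"
    by simp
qed (auto intro: eval_in[OF _ assms])

lemma eval_Const: "eval (term_alg \<Sigma> Y) Const t = t"
  by (induction t) (auto simp: map_idI)

text \<open>This is the uniqueness half of the freeness of the term algebra: evaluation at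
  \<open>Const\<close> is the identity on terms, and \<open>eval_hom\<close> pushes it along
  \<open>h\<close>.\<close>

lemma eval_term_hom:
  assumes "wf_trm \<Sigma> Y s t" "chom \<Sigma> (term_alg \<Sigma> Y) D h"
  shows "eval D (\<lambda>s c. h s (Const s c)) t = h s t"
  using eval_hom[OF assms calgebra_term_alg, of Const "\<lambda>s c. h s (Const s c)"]
  by (simp add: eval_Const wf_trm.Const)

lemma map_of_zip_map2:
  assumes "length ds = length vs" "v \<in> set vs"
  shows "the (map_of (zip vs (map2 h vs ds)) v) = h v (the (map_of (zip vs ds) v))"
  using assms by (induction ds vs rule: list_induct2) auto

lemma map_of_zip_in:
  assumes "list_all2 (\<lambda>d v. P v d) ds vs" "v \<in> set vs"
  shows "P v (the (map_of (zip vs ds) v))"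
  using assms by (induction rule: list_all2_induct) auto

lemma ctx_env_in:
  assumes "ds \<in> listset (map (\<lambda>(s, i). A s) vs)" "c \<in> ctx_consts vs s"
  shows "the (map_of (zip vs ds) (s, c)) \<in> A s"
proof -
  have "list_all2 (\<lambda>d v. d \<in> A (fst v)) ds vs"
    using assms(1) by (auto simp: listset_iff list_all2_conv_all_nth split: prod.splits)
  from map_of_zip_in[OF this, of "(s, c)"] assms(2) show ?thesis
    by (simp add: ctx_consts_def)
qed

lemma interp_in:
  assumes "wf_trm \<Sigma> (ctx_consts vs) s t" "calgebra \<Sigma> D" "ds \<in> listset (map (\<lambda>(s, i). ccar D s) vs)"
  shows "interp D vs t ds \<in> ccar D s"
  unfolding interp_def by (rule eval_in[OF assms(1,2)]) (rule ctx_env_in[OF assms(3)])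

lemma interp_hom:
  assumes "wf_trm \<Sigma> (ctx_consts vs) s t" "chom \<Sigma> D D' h" "calgebra \<Sigma> D"
    and "ds \<in> listset (map (\<lambda>(s, i). ccar D s) vs)"
  shows "h s (interp D vs t ds) = interp D' vs t (map2 (\<lambda>(s, i). h s) vs ds)"
  unfolding interp_def
proof (rule eval_hom[OF assms(1-3)])
  fix s c assume c: "c \<in> ctx_consts vs s"
  show "the (map_of (zip vs ds) (s, c)) \<in> ccar D s" by (rule ctx_env_in[OF assms(4) c])
  have "length ds = length vs" using assms(4) by (auto simp: listset_iff list_all2_conv_all_nth)
  then show "the (map_of (zip vs (map2 (\<lambda>(s, i). h s) vs ds)) (s, c))
               = h s (the (map_of (zip vs ds) (s, c)))"
    using c by (subst map_of_zip_map2) (auto simp: ctx_consts_def)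
qed

text \<open>Regarding \<open>calg_eq\<close> as an identity homomorphism turns statements on equal
  algebras into instances of statements on homomorphisms.\<close>

lemma chom_id:
  assumes "calg_eq \<Sigma> D D'"
  shows "chom \<Sigma> D D' (\<lambda>_ x. x)"
  unfolding chom_def
proof (intro conjI ballI)
  fix f xs assume f: "f \<in> csyms \<Sigma>" "xs \<in> listset (map (ccar D) (cargs \<Sigma> f))"
  then have "length (cargs \<Sigma> f) = length xs" by (auto simp: listset_iff list_all2_conv_all_nth)
  then have "map2 (\<lambda>_ x. x) (cargs \<Sigma> f) xs = xs" by (auto intro: nth_equalityI)
  then show "cop D f xs = cop D' f (map2 (\<lambda>_ x. x) (cargs \<Sigma> f) xs)"
    using assms f by (simp add: calg_eq_def)
qed (use assms in \<open>auto simp: calg_eq_def\<close>)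

lemma eval_cong:
  assumes "wf_trm \<Sigma> Y s t" "\<And>s c. s \<in> csorts \<Sigma> \<Longrightarrow> c \<in> Y s \<Longrightarrow> \<rho> s c = \<rho>' s c"
  shows "eval D \<rho> t = eval D \<rho>' t"
  using assms(1)
proof induction
  case (App f ts)
  then have "map (eval D \<rho>) ts = map (eval D \<rho>') ts"
    by (auto simp: list_all2_conv_all_nth in_set_conv_nth)
  then show ?case by (simp only: eval.simps)
qed (simp add: assms(2))

definition sat :: "('s, 'f, 'x) calg \<Rightarrow> ('s, 'f) ceqn \<Rightarrow> bool" where
  "sat D e \<longleftrightarrow> (\<forall>ds \<in> listset (map (\<lambda>(s, i). ccar D s) (ceq_ctx e)).
     interp D (ceq_ctx e) (ceq_lhs e) ds = interp D (ceq_ctx e) (ceq_rhs e) ds)"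

definition wf_ceqn :: "('s, 'f) csig \<Rightarrow> ('s, 'f) ceqn \<Rightarrow> bool" where
  "wf_ceqn \<Sigma> e \<longleftrightarrow> wf_trm \<Sigma> (ctx_consts (ceq_ctx e)) (ceq_sort e) (ceq_lhs e) \<and>
                     wf_trm \<Sigma> (ctx_consts (ceq_ctx e)) (ceq_sort e) (ceq_rhs e)"

section \<open>The free classical algebra\<close>

text \<open>The kernel pair of the evaluation homomorphism, cut down to well-formed terms so that it
  is a relation on the carriers. It serves to factor evaluation through the quotient by the
  generated congruence.\<close>

definition kernel ::
  "('s, 'f) csig \<Rightarrow> ('s \<Rightarrow> 'c set) \<Rightarrow> ('s, 'f, 'x) calg \<Rightarrow> ('s \<Rightarrow> 'c \<Rightarrow> 'x) \<Rightarrow> 's \<Rightarrow>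
   (('s, 'f, 'c) trm \<times> ('s, 'f, 'c) trm) set" where
  "kernel \<Sigma> Y D \<rho> s = {(t, t'). wf_trm \<Sigma> Y s t \<and> wf_trm \<Sigma> Y s t' \<and> eval D \<rho> t = eval D \<rho> t'}"

lemma congruence_kernel:
  "congruence \<Sigma> (term_alg \<Sigma> Y) (kernel \<Sigma> Y D \<rho>)"
  unfolding congruence_def
proof (intro conjI ballI allI impI)
  fix s
  show "equiv (ccar (term_alg \<Sigma> Y) s) (kernel \<Sigma> Y D \<rho> s)"
    by (rule equivI) (auto simp: kernel_def refl_on_def sym_on_def trans_on_def)
next
  fix f xs ys assume f: "f \<in> csyms \<Sigma>"
    and "length xs = length (cargs \<Sigma> f) \<and> length ys = length (cargs \<Sigma> f) \<and>
         (\<forall>i<length (cargs \<Sigma> f). (xs ! i, ys ! i) \<in> kernel \<Sigma> Y D \<rho> (cargs \<Sigma> f ! i))"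
  then have *: "wf_trm \<Sigma> Y (cres \<Sigma> f) (App f xs)" "wf_trm \<Sigma> Y (cres \<Sigma> f) (App f ys)"
    "map (eval D \<rho>) xs = map (eval D \<rho>) ys"
    by (auto simp: kernel_def list_all2_conv_all_nth intro!: wf_trm.App nth_equalityI)
  show "(cop (term_alg \<Sigma> Y) f xs, cop (term_alg \<Sigma> Y) f ys) \<in> kernel \<Sigma> Y D \<rho> (cres \<Sigma> f)"
    using * by (simp add: kernel_def)
qed

text \<open>Evaluation is a homomorphism, so it carries an instance of the equation among terms to
  an instance in \<open>D\<close>, where both sides agree.\<close>

lemma kernel_contains:
  assumes "calgebra \<Sigma> D" "\<And>s c. s \<in> csorts \<Sigma> \<Longrightarrow> c \<in> Y s \<Longrightarrow> \<rho> s c \<in> ccar D s"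
    and "wf_ceqn \<Sigma> e" "sat D e"
    and ds: "ds \<in> listset (map (\<lambda>(s, i). ccar (term_alg \<Sigma> Y) s) (ceq_ctx e))"
  shows "(interp (term_alg \<Sigma> Y) (ceq_ctx e) (ceq_lhs e) ds,
          interp (term_alg \<Sigma> Y) (ceq_ctx e) (ceq_rhs e) ds) \<in> kernel \<Sigma> Y D \<rho> (ceq_sort e)"
proof -
  let ?T = "term_alg \<Sigma> Y" and ?vs = "ceq_ctx e"
  have wf: "wf_trm \<Sigma> (ctx_consts ?vs) (ceq_sort e) (ceq_lhs e)"
       "wf_trm \<Sigma> (ctx_consts ?vs) (ceq_sort e) (ceq_rhs e)"
    using assms(3) by (auto simp: wf_ceqn_def)
  let ?ds = "map2 (\<lambda>(s, i). eval D \<rho>) ?vs ds"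
  have "?ds \<in> listset (map (\<lambda>(s, i). ccar D s) ?vs)"
    using ds by (intro listset_map2[OF ds]) (auto intro: eval_in[OF _ assms(1,2)])
  then have "interp D ?vs (ceq_lhs e) ?ds = interp D ?vs (ceq_rhs e) ?ds"
    using assms(4) by (simp add: sat_def)
  then have "eval D \<rho> (interp ?T ?vs (ceq_lhs e) ds) = eval D \<rho> (interp ?T ?vs (ceq_rhs e) ds)"
    using interp_hom[OF wf(1) chom_eval[OF assms(1,2)] calgebra_term_alg ds]
          interp_hom[OF wf(2) chom_eval[OF assms(1,2)] calgebra_term_alg ds] by simp
  moreover note interp_in[OF wf(1) calgebra_term_alg ds] interp_in[OF wf(2) calgebra_term_alg ds]
  ultimately show ?thesis by (simp add: kernel_def)
qed

lemma generated_congruence_least: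
  assumes "congruence \<Sigma> D R"
    and "\<And>e ds. \<lbrakk>e \<in> E; ds \<in> listset (map (\<lambda>(s, i). ccar D s) (ceq_ctx e))\<rbrakk> \<Longrightarrow>
           (interp D (ceq_ctx e) (ceq_lhs e) ds, interp D (ceq_ctx e) (ceq_rhs e) ds) \<in> R (ceq_sort e)"
  shows "generated_congruence \<Sigma> D E s \<subseteq> R s"
  using assms unfolding generated_congruence_def by blast

lemma generated_congruence_contains:
  assumes "e \<in> E" "ds \<in> listset (map (\<lambda>(s, i). ccar D s) (ceq_ctx e))"
  shows "(interp D (ceq_ctx e) (ceq_lhs e) ds, interp D (ceq_ctx e) (ceq_rhs e) ds)
           \<in> generated_congruence \<Sigma> D E (ceq_sort e)"
  using assms unfolding generated_congruence_def by blast

lemma generated_congruence_kernel: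
  assumes "calgebra \<Sigma> D" "\<And>s c. s \<in> csorts \<Sigma> \<Longrightarrow> c \<in> Y s \<Longrightarrow> \<rho> s c \<in> ccar D s"
    and "\<And>e. e \<in> E \<Longrightarrow> wf_ceqn \<Sigma> e \<and> sat D e"
  shows "generated_congruence \<Sigma> (term_alg \<Sigma> Y) E s \<subseteq> kernel \<Sigma> Y D \<rho> s"
  using assms by (intro generated_congruence_least congruence_kernel kernel_contains) auto

text \<open>All closure properties pass to an intersection of congruences, but containment in the
  carriers needs at least one relation in the intersected family. The total relation on well-formed
  terms is such a relation.\<close>

lemma congruence_generated:
  assumes "\<And>e. e \<in> E \<Longrightarrow> wf_ceqn \<Sigma> e"
  shows "congruence \<Sigma> (term_alg \<Sigma> Y) (generated_congruence \<Sigma> (term_alg \<Sigma> Y) E)"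
proof -
  let ?T = "term_alg \<Sigma> Y"
  define Q where "Q R \<longleftrightarrow> congruence \<Sigma> ?T R \<and>
        (\<forall>e\<in>E. \<forall>ds \<in> listset (map (\<lambda>(s, i). ccar ?T s) (ceq_ctx e)).
           (interp ?T (ceq_ctx e) (ceq_lhs e) ds, interp ?T (ceq_ctx e) (ceq_rhs e) ds)
             \<in> R (ceq_sort e))" for R
  have G: "generated_congruence \<Sigma> ?T E s = {(a, b). \<forall>R. Q R \<longrightarrow> (a, b) \<in> R s}" for s
    unfolding generated_congruence_def Q_def by blast
  \<comment> \<open>The kernel of the evaluation in the one-point algebra is the total relation.\<close>
  let ?one = "\<lparr>ccar = (\<lambda>_. {()}), cop = (\<lambda>_ _. ())\<rparr>"
  have sub: "generated_congruence \<Sigma> ?T E s \<subseteq> kernel \<Sigma> Y ?one (\<lambda>_ _. ()) s" for s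
    using assms by (intro generated_congruence_kernel) (auto simp: calgebra_def sat_def)
  have eq: "Q R \<Longrightarrow> s \<in> csorts \<Sigma> \<Longrightarrow> equiv (ccar ?T s) (R s)" for R s
    by (simp add: Q_def congruence_def)
  show ?thesis
    unfolding congruence_def
  proof (intro conjI ballI allI impI)
    fix s assume s: "s \<in> csorts \<Sigma>"
    show "equiv (ccar ?T s) (generated_congruence \<Sigma> ?T E s)"
    proof (rule equivI)
      show "generated_congruence \<Sigma> ?T E s \<subseteq> ccar ?T s \<times> ccar ?T s"
        using sub[of s] by (auto simp: kernel_def)
      show "refl_on (ccar ?T s) (generated_congruence \<Sigma> ?T E s)"
        using eq[OF _ s] unfolding G equiv_def refl_on_def by blast
      show "sym (generated_congruence \<Sigma> ?T E s)"
        using eq[OF _ s] unfolding G equiv_def sym_def by blast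
      show "trans (generated_congruence \<Sigma> ?T E s)"
        using eq[OF _ s] unfolding G equiv_def trans_def by blast
    qed
  next
    fix f xs ys assume "f \<in> csyms \<Sigma>"
     "length xs = length (cargs \<Sigma> f) \<and> length ys = length (cargs \<Sigma> f) \<and>
        (\<forall>i<length (cargs \<Sigma> f). (xs ! i, ys ! i) \<in> generated_congruence \<Sigma> ?T E (cargs \<Sigma> f ! i))"
    then show "(cop ?T f xs, cop ?T f ys) \<in> generated_congruence \<Sigma> ?T E (cres \<Sigma> f)"
      unfolding G by (auto simp: Q_def congruence_def)
  qed
qed

section \<open>Quotient algebras and surjective homomorphisms\<close>

lemma quotient_alg_simps:
  "ccar (quotient_alg \<Sigma> D R) s = ccar D s // R s"
  "cop (quotient_alg \<Sigma> D R) f Ks = (\<Union>xs\<in>listset Ks. R (cres \<Sigma> f) `` {cop D f xs})"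
  by (simp_all add: quotient_alg_def)

lemma chom_quotient:
  assumes sig: "csignature \<Sigma>" and R: "congruence \<Sigma> D R" and D: "calgebra \<Sigma> D"
  shows "chom \<Sigma> D (quotient_alg \<Sigma> D R) (\<lambda>s x. R s `` {x})"
  unfolding chom_def
proof (intro conjI ballI funcsetI)
  fix s x assume "s \<in> csorts \<Sigma>" "x \<in> ccar D s"
  then show "R s `` {x} \<in> ccar (quotient_alg \<Sigma> D R) s"
    by (simp add: quotient_alg_simps quotientI)
next
  fix f xs assume f: "f \<in> csyms \<Sigma>" and xs: "xs \<in> listset (map (ccar D) (cargs \<Sigma> f))"
  let ?ss = "cargs \<Sigma> f"
  let ?Ks = "map2 (\<lambda>s x. R s `` {x}) ?ss xs"
  have ss: "set ?ss \<subseteq> csorts \<Sigma>" "cres \<Sigma> f \<in> csorts \<Sigma>" using sig f by (auto simp: csignature_def)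
  then have eqv: "equiv (ccar D (?ss ! i)) (R (?ss ! i))" if "i < length ?ss" for i
    using R subsetD[OF ss(1) nth_mem[OF that]] by (simp add: congruence_def)
  have eqr: "equiv (ccar D (cres \<Sigma> f)) (R (cres \<Sigma> f))"
    using R ss by (auto simp: congruence_def)
  have len: "length xs = length ?ss" and xi: "\<And>i. i < length ?ss \<Longrightarrow> xs ! i \<in> ccar D (?ss ! i)"
    using xs by (auto simp: listset_iff list_all2_conv_all_nth)
  \<comment> \<open>The quotient operation is a union over all tuples of representatives.
    \<open>self\<close> keeps this union nonempty, and \<open>same\<close> makes all its members
    equal, so it is a single class.\<close>
  have self: "xs \<in> listset ?Ks"
    using len xi eqv by (auto simp: listset_iff list_all2_conv_all_nth equiv_def refl_on_def)
  have same: "R (cres \<Sigma> f) `` {cop D f ys} = R (cres \<Sigma> f) `` {cop D f xs}" if "ys \<in> listset ?Ks" for ys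
  proof -
    have "length ys = length ?ss" "\<forall>i<length ?ss. (xs ! i, ys ! i) \<in> R (?ss ! i)"
      using that len by (auto simp: listset_iff list_all2_conv_all_nth)
    then have "(cop D f xs, cop D f ys) \<in> R (cres \<Sigma> f)"
      using R f len by (auto simp: congruence_def)
    then show ?thesis using eqr by (metis equiv_class_eq)
  qed
  show "R (cres \<Sigma> f) `` {cop D f xs} = cop (quotient_alg \<Sigma> D R) f ?Ks"
    unfolding quotient_alg_simps using self same by blast
qed

text \<open>Preimages are chosen componentwise. For a quotient map this replaces a tuple of classes
  by a tuple of representatives.\<close>

lemma listset_map2_surj:
  assumes surj: "\<And>s y. s \<in> S \<Longrightarrow> y \<in> B s \<Longrightarrow> \<exists>x\<in>A s. h s x = y"
    and f: "set ss \<subseteq> S" and ys: "ys \<in> listset (map B ss)"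
  obtains xs where "xs \<in> listset (map A ss)" "map2 h ss xs = ys"
proof -
  have "\<exists>xs\<in>listset (map A ss). map2 h ss xs = ys"
    using f ys
  proof (induction ss arbitrary: ys)
    case Nil
    then show ?case by simp
  next
    case (Cons s ss)
    then obtain y ys' where y: "ys = y # ys'" "y \<in> B s" "ys' \<in> listset (map B ss)"
      by (auto simp: set_Cons_def)
    with Cons obtain xs where "xs\<in>listset (map A ss)" "map2 h ss xs = ys'" by auto
    moreover obtain x where "x \<in> A s" "h s x = y" using surj[of s y] y Cons by auto
    ultimately show ?case using y by (intro bexI[of _ "x # xs"]) (auto simp: set_Cons_def)
  qed
  then show thesis using that by blast
qed

text \<open>Each argument tuple in \<open>D'\<close> lifts along \<open>h\<close>, so closure under
  the operations is inherited from \<open>D\<close>.\<close>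

lemma calgebra_image:
  assumes h: "chom \<Sigma> D D' h" "csignature \<Sigma>" "calgebra \<Sigma> D"
    and surj: "\<And>s y. s \<in> csorts \<Sigma> \<Longrightarrow> y \<in> ccar D' s \<Longrightarrow> \<exists>x\<in>ccar D s. h s x = y"
  shows "calgebra \<Sigma> D'"
  unfolding calgebra_def
proof (intro ballI)
  fix f ys assume f: "f \<in> csyms \<Sigma>" and ys: "ys \<in> listset (map (ccar D') (cargs \<Sigma> f))"
  have ss: "set (cargs \<Sigma> f) \<subseteq> csorts \<Sigma>" "cres \<Sigma> f \<in> csorts \<Sigma>"
    using h(2) f by (auto simp: csignature_def)
  obtain xs where xs: "xs \<in> listset (map (ccar D) (cargs \<Sigma> f))" "map2 h (cargs \<Sigma> f) xs = ys"
    by (rule listset_map2_surj[where A = "ccar D" and h = h, OF surj ss(1) ys])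
  have "cop D f xs \<in> ccar D (cres \<Sigma> f)" using h(3) f xs(1) by (auto simp: calgebra_def)
  with chom_cop[OF h(1) f xs(1)] chom_in[OF h(1) ss(2)] xs(2)
  show "cop D' f ys \<in> ccar D' (cres \<Sigma> f)" by metis
qed

lemma chom_comp:
  assumes "chom \<Sigma> D D' h" "chom \<Sigma> D' D'' k" "csignature \<Sigma>"
  shows "chom \<Sigma> D D'' (\<lambda>s x. k s (h s x))"
  unfolding chom_def
proof (intro conjI ballI funcsetI)
  fix s x assume "s \<in> csorts \<Sigma>" "x \<in> ccar D s"
  then show "k s (h s x) \<in> ccar D'' s" using assms(1,2) by (meson chom_in)
next
  fix f xs assume f: "f \<in> csyms \<Sigma>" and xs: "xs \<in> listset (map (ccar D) (cargs \<Sigma> f))"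
  have "map2 h (cargs \<Sigma> f) xs \<in> listset (map (ccar D') (cargs \<Sigma> f))"
    using assms(1,3) f by (intro listset_map2[OF xs]) (auto simp: csignature_def intro: chom_in)
  moreover have "map2 k (cargs \<Sigma> f) (map2 h (cargs \<Sigma> f) xs) = map2 (\<lambda>s x. k s (h s x)) (cargs \<Sigma> f) xs"
    by (auto intro: nth_equalityI)
  ultimately show "k (cres \<Sigma> f) (h (cres \<Sigma> f) (cop D f xs))
      = cop D'' f (map2 (\<lambda>s x. k s (h s x)) (cargs \<Sigma> f) xs)"
    using chom_cop[OF assms(1) f xs] chom_cop[OF assms(2) f] by simp
qed

context set_universe
begin

section \<open>Copies of classical algebras inside the universe, and smallness of term
  algebras\<close>

lemma code_inj:
  assumes "small_sized U (elements \<Sigma> D)"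
  shows "inj_on (code U \<Sigma> D) (elements \<Sigma> D)" "small U (code U \<Sigma> D ` elements \<Sigma> D)"
  using assms someI_ex[of "\<lambda>e. inj_on e (elements \<Sigma> D) \<and> small U (e ` elements \<Sigma> D)"]
  unfolding small_sized_def code_def by blast+

lemma decode_code:
  assumes "small_sized U (elements \<Sigma> D)" "s \<in> csorts \<Sigma>" "x \<in> ccar D s"
  shows "decode U \<Sigma> D (code U \<Sigma> D x) = x"
  using assms code_inj(1)[OF assms(1)] unfolding decode_def elements_def
  by (intro inv_into_f_f) auto

lemma chom_in_Set:
  assumes "small_sized U (elements \<Sigma> D)" "csignature \<Sigma>"
  shows "chom \<Sigma> D (in_Set U \<Sigma> D) (\<lambda>s. code U \<Sigma> D)"
  unfolding chom_def
proof (intro conjI ballI funcsetI)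
  fix f xs assume f: "f \<in> csyms \<Sigma>" and xs: "xs \<in> listset (map (ccar D) (cargs \<Sigma> f))"
  have "decode U \<Sigma> D (code U \<Sigma> D (xs ! i)) = xs ! i" if "i < length xs" for i
    using xs assms(2) f that unfolding listset_iff csignature_def
    by (intro decode_code[OF assms(1), of "cargs \<Sigma> f ! i"])
       (auto simp: list_all2_conv_all_nth subset_iff)
  moreover have "length xs = length (cargs \<Sigma> f)"
    using xs by (auto simp: listset_iff list_all2_conv_all_nth)
  ultimately have "map (decode U \<Sigma> D) (map2 (\<lambda>s. code U \<Sigma> D) (cargs \<Sigma> f) xs) = xs"
    by (auto intro: nth_equalityI)
  then show "code U \<Sigma> D (cop D f xs)
               = cop (in_Set U \<Sigma> D) f (map2 (\<lambda>s. code U \<Sigma> D) (cargs \<Sigma> f) xs)"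
    by (simp add: in_Set_def)
qed (simp add: in_Set_def)

lemma ccar_in_Set: "ccar (in_Set U \<Sigma> D) s = code U \<Sigma> D ` ccar D s"
  by (simp add: in_Set_def)

lemma calgebra_in_Set:
  assumes "small_sized U (elements \<Sigma> D)" "csignature \<Sigma>" "calgebra \<Sigma> D"
  shows "calgebra \<Sigma> (in_Set U \<Sigma> D)"
  by (rule calgebra_image[OF chom_in_Set[OF assms(1,2)] assms(2,3)]) (auto simp: in_Set_def)

lemma small_in_Set:
  assumes "small_sized U (elements \<Sigma> D)" "s \<in> csorts \<Sigma>"
  shows "small U (ccar (in_Set U \<Sigma> D) s)"
  by (rule small_subset[OF code_inj(2)[OF assms(1)]])
     (use assms(2) in \<open>auto simp: in_Set_def elements_def\<close>)

text \<open>Terms are gathered in stages \<open>T n\<close>, starting from the constants and adding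
  one layer of applications at each step. The stages ignore arities and sorts; this only enlarges
  them and keeps each step a small construction.\<close>

lemma small_sized_terms:
  assumes "small_sized U (csorts \<Sigma>)" "small_sized U (csyms \<Sigma>)"
    and "\<And>s. s \<in> csorts \<Sigma> \<Longrightarrow> small_sized U (Y s)"
  shows "small_sized U (elements \<Sigma> (term_alg \<Sigma> Y))"
proof -
  define T where "T = rec_nat ((\<lambda>(s, c). Const s c) ` Sigma (csorts \<Sigma>) Y)
     (\<lambda>n A. A \<union> (\<lambda>(f, ts). App f ts) ` (csyms \<Sigma> \<times> lists A))"
  have T0: "T 0 = (\<lambda>(s, c). Const s c) ` Sigma (csorts \<Sigma>) Y"
    and TS: "T (Suc n) = T n \<union> (\<lambda>(f, ts). App f ts) ` (csyms \<Sigma> \<times> lists (T n))" for n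
    by (simp_all add: T_def)
  have small: "small_sized U (T n)" for n
  proof (induction n)
    case 0
    then show ?case unfolding T0 by (intro small_sized_image small_sized_Sigma assms)
  next
    case (Suc n)
    then show ?case
      unfolding TS by (intro small_sized_Un small_sized_image small_sized_Sigma small_sized_lists assms)
  qed
  have mono: "T m \<subseteq> T n" if "m \<le> n" for m n
    using lift_Suc_mono_le[of T, OF _ that] by (simp add: TS)
  have "\<exists>n. t \<in> T n" if "wf_trm \<Sigma> Y s t" for s t
    using that
  proof induction
    case (Const s c)
    then show ?case using T0 by (intro exI[of _ 0]) force
  next
    case (App f ts)
    \<comment> \<open>The stages increase and a term has finitely many arguments, so one stage
      contains them all.\<close>
    have "\<exists>n. set ts \<subseteq> T n"
      using App(2)
    proof (induction rule: list_all2_induct)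
      case (Cons s ss t ts)
      then obtain m n where "t \<in> T m" "set ts \<subseteq> T n" by blast
      then have "set (t # ts) \<subseteq> T (max m n)"
        using mono[of m "max m n"] mono[of n "max m n"] by auto
      then show ?case by blast
    qed simp
    then obtain n where "set ts \<subseteq> T n" by blast
    then have "App f ts \<in> T (Suc n)" using App(1) by (auto simp: TS image_iff)
    then show ?case by blast
  qed
  then have "elements \<Sigma> (term_alg \<Sigma> Y) \<subseteq> (\<Union>n. T n)" by (auto simp: elements_def)
  then show ?thesis
    by (rule small_sized_subset[OF small_sized_UN[OF small_sized_nat small]])
qed

text \<open>A class is determined by its sort and a representative, so the classes lie in an image
  of a class of pairs.\<close>

lemma small_sized_quotient:
  assumes "small_sized U (csorts \<Sigma>)" "small_sized U (elements \<Sigma> D)"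
  shows "small_sized U (elements \<Sigma> (quotient_alg \<Sigma> D R))"
proof (rule small_sized_subset)
  show "small_sized U ((\<lambda>(s, x). R s `` {x}) ` (csorts \<Sigma> \<times> elements \<Sigma> D))"
    using assms by (intro small_sized_image small_sized_Sigma)
  show "elements \<Sigma> (quotient_alg \<Sigma> D R) \<subseteq> (\<lambda>(s, x). R s `` {x}) ` (csorts \<Sigma> \<times> elements \<Sigma> D)"
    by (force simp: elements_def quotient_alg_simps quotient_def)
qed

end

section \<open>Products and indiscrete objects\<close>

context set_universe
begin

section \<open>Pairs and tuples in the universe\<close>

lemma upair_eq_iff [simp]: "upair U a b = upair U c d \<longleftrightarrow> a = c \<and> b = d"
  using upair_inject by blast

lemma ufst_upair [simp]: "ufst U (upair U a b) = a"
  unfolding ufst_def by (rule the_equality) auto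

lemma usnd_upair [simp]: "usnd U (upair U a b) = b"
  unfolding usnd_def by (rule the_equality) auto

lemma upair_in_cart [simp]: "upair U a b \<in> cart U A B \<longleftrightarrow> a \<in> A \<and> b \<in> B"
  by (auto simp: cart_def)

text \<open>Equal lengths are required because a tuple is a nested pair ending in
  \<open>upt U\<close>, and \<open>upt U\<close> may itself be a pair.\<close>

lemma tuple_eq_iff: "length xs = length ys \<Longrightarrow> tuple U xs = tuple U ys \<longleftrightarrow> xs = ys"
  by (induction xs ys rule: list_induct2) (auto simp: tuple_def)

lemma untuple_tuple [simp]: "length xs = n \<Longrightarrow> untuple U n (tuple U xs) = xs"
  unfolding untuple_def by (rule the_equality) (auto simp: tuple_eq_iff)

lemma tuple_in_tuples: "xs \<in> listset As \<Longrightarrow> tuple U xs \<in> tuples U As"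
  by (simp add: tuples_def)

lemma tuplesE:
  assumes "z \<in> tuples U As"
  obtains xs where "z = tuple U xs" "xs \<in> listset As"
  using assms by (auto simp: tuples_def)

lemma cart_tuplesE:
  assumes "z \<in> cart U A (tuples U As)"
  obtains a xs where "z = upair U a (tuple U xs)" "a \<in> A" "xs \<in> listset As"
  using assms by (auto simp: cart_def tuples_def)

lemma tuple_proj_tuple [simp]: "xs \<in> listset As \<Longrightarrow> tuple_proj U As i (tuple U xs) = xs ! i"
  by (simp add: tuple_proj_def tuple_in_tuples listset_length)

lemma tuple_proj_funcset: "i < length As \<Longrightarrow> tuple_proj U As i \<in> tuples U As \<rightarrow>\<^sub>E As ! i"
  by (auto simp: tuple_proj_def elim!: tuplesE)
     (auto simp: listset_iff list_all2_conv_all_nth)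

lemma tuples_eqI:
  assumes "z \<in> tuples U As" "z' \<in> tuples U As"
    and "\<And>i. i < length As \<Longrightarrow> tuple_proj U As i z = tuple_proj U As i z'"
  shows "z = z'"
  using assms by (auto elim!: tuplesE simp: listset_length intro!: arg_cong[of _ _ "tuple U"] nth_equalityI)

lemma tuple_map_tuple [simp]:
  "xs \<in> listset As \<Longrightarrow> tuple_map U As fs (tuple U xs) = tuple U (map2 (\<lambda>f x. f x) fs xs)"
  by (simp add: tuple_map_def tuple_in_tuples listset_length)

lemma tuple_map_funcset:
  assumes "length fs = length As" "length Bs = length As"
    and "\<And>i. i < length As \<Longrightarrow> fs ! i \<in> As ! i \<rightarrow> Bs ! i"
  shows "tuple_map U As fs \<in> tuples U As \<rightarrow>\<^sub>E tuples U Bs"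
proof (rule PiE_I)
  fix z assume "z \<in> tuples U As"
  then obtain xs where xs: "z = tuple U xs" "xs \<in> listset As" by (rule tuplesE)
  then have "map2 (\<lambda>f x. f x) fs xs \<in> listset Bs"
    using assms(1,2) funcset_mem[OF assms(3)] by (simp add: listset_iff list_all2_conv_all_nth)
  then show "tuple_map U As fs z \<in> tuples U Bs"
    using xs by (simp add: tuple_in_tuples)
qed (simp add: tuple_map_def)

lemma small_tuples: "(\<And>A. A \<in> set As \<Longrightarrow> small U A) \<Longrightarrow> small U (tuples U As)"
proof (induction As)
  case Nil
  then show ?case by (simp add: tuples_def small_singleton)
next
  case (Cons A As)
  have "tuples U (A # As) \<subseteq> (\<Union>a\<in>A. upair U a ` tuples U As)"
    by (auto simp: tuples_def set_Cons_def tuple_def)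
  moreover have "small U (\<Union>a\<in>A. upair U a ` tuples U As)"
    using Cons by (intro small_UN small_image) auto
  ultimately show ?case using small_subset by blast
qed

end

context concrete_category
begin

lemma Hom_funcset: "f \<in> Hom C V W \<Longrightarrow> V \<in> Obj C \<Longrightarrow> W \<in> Obj C \<Longrightarrow> f \<in> Und C V \<rightarrow>\<^sub>E Und C W"
  using Hom_subset by blast

end

context topological_category
begin

section \<open>Indiscrete objects and finite products as initial lifts\<close>

lemma amnesticI:
  assumes "V \<in> Obj C" "W \<in> Obj C" "Und C V = Y" "Und C W = Y"
    and "(\<lambda>x\<in>Y. x) \<in> Hom C V W" "(\<lambda>x\<in>Y. x) \<in> Hom C W V"
  shows "V = W"
  using assms by (intro amnestic[of V Y W]) (auto simp: Fib_def)

text \<open>The initial lift of the empty source has every function into it admissible, since there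
  are no legs to test. Hence it is the greatest object of the fibre, and amnesticity identifies it
  with the one named by \<open>Indisc\<close>.\<close>

lemma Indisc:
  assumes "small C Y"
  shows Indisc_Obj: "Indisc C Y \<in> Obj C" and Und_Indisc: "Und C (Indisc C Y) = Y"
    and Hom_Indisc: "\<lbrakk>W \<in> Obj C; f \<in> Und C W \<rightarrow>\<^sub>E Y\<rbrakk> \<Longrightarrow> f \<in> Hom C W (Indisc C Y)"
proof -
  have "structured_source C Y {}" using assms by (simp add: structured_source_def)
  then obtain V where V: "V \<in> Obj C" "Und C V = Y" "initial_source C V {}"
    using initial_lift by blast
  then have H: "f \<in> Hom C W V" if "W \<in> Obj C" "f \<in> Und C W \<rightarrow>\<^sub>E Y" for f W
    using that by (auto simp: initial_source_def)
  have g: "greatest (Fib C Y) V (carrier (Fib C Y))"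
    using V H by (auto simp: greatest_def Fib_def)
  have "Indisc C Y = V"
    unfolding Indisc_def
  proof (rule the_equality[of "\<lambda>V. greatest (Fib C Y) V (carrier (Fib C Y))", OF g])
    fix W assume W: "greatest (Fib C Y) W (carrier (Fib C Y))"
    show "W = V"
      by (rule amnestic[of _ Y]) (use W g in \<open>auto simp: greatest_def\<close>)
  qed
  with V H show "Indisc C Y \<in> Obj C" "Und C (Indisc C Y) = Y"
     "\<lbrakk>W \<in> Obj C; f \<in> Und C W \<rightarrow>\<^sub>E Y\<rbrakk> \<Longrightarrow> f \<in> Hom C W (Indisc C Y)" by auto
qed

text \<open>The projections are jointly injective, so the mediating map between two products over
  the same cartesian product is the identity function. It is admissible both ways, and amnesticity
  applies.\<close>

lemma is_product_unique:
  assumes "is_product C Vs Z" "is_product C Vs Z'"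
  shows "Z = Z'"
proof -
  let ?As = "map (Und C) Vs"
  have *: "(\<lambda>x\<in>tuples C ?As. x) \<in> Hom C W W'"
    if W: "is_product C Vs W" and W': "is_product C Vs W'" for W W'
  proof -
    have O: "W \<in> Obj C" "W' \<in> Obj C" "Und C W = tuples C ?As" "Und C W' = tuples C ?As"
      using W W' by (auto simp: is_product_def)
    have "\<forall>i<length Vs. tuple_proj C ?As i \<in> Hom C W (Vs ! i)"
      using W by (auto simp: is_product_def)
    then obtain k where k: "k \<in> Hom C W W'"
      "\<And>i. i < length Vs \<Longrightarrow> compose (Und C W) (tuple_proj C ?As i) k = tuple_proj C ?As i"
      using W' O(1) unfolding is_product_def by meson
    have kf: "k \<in> tuples C ?As \<rightarrow>\<^sub>E tuples C ?As" using Hom_funcset[OF k(1)] O by simp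
    have "k = (\<lambda>x\<in>tuples C ?As. x)"
    proof (rule PiE_ext[OF kf])
      fix z assume z: "z \<in> tuples C ?As"
      have "k z = z"
      proof (rule tuples_eqI)
        fix i assume "i < length ?As"
        then have "compose (Und C W) (tuple_proj C ?As i) k z = tuple_proj C ?As i z"
          using k(2) by simp
        then show "tuple_proj C ?As i (k z) = tuple_proj C ?As i z"
          using z O by (simp add: compose_def)
      qed (use z kf in auto)
      then show "k z = (\<lambda>x\<in>tuples C ?As. x) z" using z by simp
    qed auto
    then show ?thesis using k(1) by simp
  qed
  show ?thesis
    using *[OF assms] *[OF assms(2,1)] assms by (intro amnesticI) (auto simp: is_product_def)
qed

text \<open>The product is the initial lift of the cartesian projections. Tupling the given maps
  yields the mediating function, and initiality makes it admissible.\<close>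

lemma is_product_Prod:
  assumes "set Vs \<subseteq> Obj C"
  shows "is_product C Vs (Prod C Vs)"
proof -
  let ?As = "map (Und C) Vs"
  let ?\<F> = "{(tuple_proj C ?As i, Vs ! i) | i. i < length Vs}"
  have Vs: "Vs ! i \<in> Obj C" if "i < length Vs" for i using assms that by auto
  have "structured_source C (tuples C ?As) ?\<F>"
    unfolding structured_source_def using assms Vs tuple_proj_funcset[of _ ?As]
    by (auto intro!: small_tuples Und_small simp del: PiE_iff)
  then obtain Z where Z: "Z \<in> Obj C" "Und C Z = tuples C ?As" "initial_source C Z ?\<F>"
    using initial_lift by blast
  have "is_product C Vs Z"
    unfolding is_product_def
  proof (intro conjI allI impI ballI)
    fix i assume "i < length Vs"
    then show "tuple_proj C ?As i \<in> Hom C Z (Vs ! i)"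
      using Z(3) unfolding initial_source_def by blast
  next
    fix W h assume W: "W \<in> Obj C" and h: "\<forall>i<length Vs. h i \<in> Hom C W (Vs ! i)"
    have hf: "h i \<in> Und C W \<rightarrow>\<^sub>E Und C (Vs ! i)" if "i < length Vs" for i
      using h W Vs that Hom_funcset by blast
    define k where "k = (\<lambda>w\<in>Und C W. tuple C (map (\<lambda>i. h i w) [0..<length Vs]))"
    have l: "map (\<lambda>i. h i w) [0..<length Vs] \<in> listset ?As" if "w \<in> Und C W" for w
      using hf that by (auto simp: listset_iff list_all2_conv_all_nth)
    have kf: "k \<in> Und C W \<rightarrow>\<^sub>E Und C Z"
      using l Z(2) by (auto simp: k_def tuple_in_tuples)
    have kp: "compose (Und C W) (tuple_proj C ?As i) k = h i" if i: "i < length Vs" for i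
    proof
      fix w
      show "compose (Und C W) (tuple_proj C ?As i) k w = h i w"
      proof (cases "w \<in> Und C W")
        case True
        then show ?thesis using l[OF True] i by (simp add: compose_def k_def)
      next
        case False
        then show ?thesis using PiE_arb[OF hf[OF i] False] by (simp add: compose_def)
      qed
    qed
    have kH: "k \<in> Hom C W Z"
    proof -
      have "\<forall>(f, V)\<in>?\<F>. compose (Und C W) f k \<in> Hom C W V" using kp h by auto
      then show ?thesis using Z(3) W kf unfolding initial_source_def by blast
    qed
    show "\<exists>!k. k \<in> Hom C W Z \<and> (\<forall>i<length Vs. compose (Und C W) (tuple_proj C ?As i) k = h i)"
    proof (intro ex1I[of _ k] conjI allI impI kH kp)
      fix k' assume k': "k' \<in> Hom C W Z \<and> (\<forall>i<length Vs. compose (Und C W) (tuple_proj C ?As i) k' = h i)"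
      then have k'f: "k' \<in> Und C W \<rightarrow>\<^sub>E Und C Z" using Hom_funcset[of k' W Z] W Z(1) by simp
      show "k' = k"
      proof (rule PiE_ext[OF k'f kf])
        fix w assume w: "w \<in> Und C W"
        show "k' w = k w"
        proof (rule tuples_eqI)
          fix i assume "i < length ?As"
          then have "compose (Und C W) (tuple_proj C ?As i) k' w = compose (Und C W) (tuple_proj C ?As i) k w"
            using k' kp by simp
          then show "tuple_proj C ?As i (k' w) = tuple_proj C ?As i (k w)"
            using w by (simp add: compose_def)
        qed (use w k'f kf Z(2) in auto)
      qed
    qed
  qed (use Z in auto)
  then show ?thesis
    unfolding Prod_def using is_product_unique by (metis theI)
qed

lemma Prod:
  assumes "set Vs \<subseteq> Obj C"
  shows Prod_Obj: "Prod C Vs \<in> Obj C"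
    and Und_Prod: "Und C (Prod C Vs) = tuples C (map (Und C) Vs)"
    and Hom_proj: "i < length Vs \<Longrightarrow> tuple_proj C (map (Und C) Vs) i \<in> Hom C (Prod C Vs) (Vs ! i)"
  using is_product_Prod[OF assms] unfolding is_product_def by blast+

text \<open>The universal property returns some admissible map with the prescribed components; joint
  injectivity of the projections shows that its underlying function is the given
  \<open>g\<close>.\<close>

lemma Hom_Prod:
  assumes Vs: "set Vs \<subseteq> Obj C" and W: "W \<in> Obj C"
    and g: "g \<in> Und C W \<rightarrow>\<^sub>E tuples C (map (Und C) Vs)"
    and proj: "\<And>i. i < length Vs \<Longrightarrow> compose (Und C W) (tuple_proj C (map (Und C) Vs) i) g \<in> Hom C W (Vs ! i)"
  shows "g \<in> Hom C W (Prod C Vs)"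
proof -
  let ?As = "map (Und C) Vs"
  let ?h = "\<lambda>i. compose (Und C W) (tuple_proj C ?As i) g"
  have "\<forall>i<length Vs. ?h i \<in> Hom C W (Vs ! i)" using proj by simp
  then have "\<exists>!k. k \<in> Hom C W (Prod C Vs)
      \<and> (\<forall>i<length Vs. compose (Und C W) (tuple_proj C ?As i) k = ?h i)"
    using is_product_Prod[OF Vs] W unfolding is_product_def by (elim conjE) (drule (1) bspec, drule spec, erule (1) mp)
  then obtain k where k: "k \<in> Hom C W (Prod C Vs)"
    "\<forall>i<length Vs. compose (Und C W) (tuple_proj C ?As i) k = ?h i"
    by (elim ex1E conjE)
  have kf: "k \<in> Und C W \<rightarrow>\<^sub>E tuples C ?As"
    using Hom_funcset[OF k(1) W Prod_Obj[OF Vs]] Und_Prod[OF Vs] by simp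
  have "g = k"
  proof (rule PiE_ext[OF g kf])
    fix w assume w: "w \<in> Und C W"
    show "g w = k w"
    proof (rule tuples_eqI)
      fix i assume "i < length ?As"
      then have "compose (Und C W) (tuple_proj C ?As i) k w = compose (Und C W) (tuple_proj C ?As i) g w"
        using k by simp
      then show "tuple_proj C ?As i (g w) = tuple_proj C ?As i (k w)"
        using w by (simp add: compose_def)
    qed (use w g kf in auto)
  qed
  with k show ?thesis by simp
qed

lemma tuple_map_Hom:
  assumes Vs: "set Vs \<subseteq> Obj C" and Ws: "set Ws \<subseteq> Obj C"
    and len: "length fs = length Vs" "length Ws = length Vs"
    and f: "\<And>i. i < length Vs \<Longrightarrow> fs ! i \<in> Hom C (Vs ! i) (Ws ! i)"
  shows "tuple_map C (map (Und C) Vs) fs \<in> Hom C (Prod C Vs) (Prod C Ws)"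
proof (rule Hom_Prod[OF Ws Prod_Obj[OF Vs]])
  let ?As = "map (Und C) Vs" and ?Bs = "map (Und C) Ws"
  have O: "Vs ! i \<in> Obj C" "Ws ! i \<in> Obj C" if "i < length Vs" for i
    using Vs Ws len that by auto
  have ff: "fs ! i \<in> Und C (Vs ! i) \<rightarrow>\<^sub>E Und C (Ws ! i)" if "i < length Vs" for i
    using Hom_funcset[OF f] O that by blast
  show tm: "tuple_map C ?As fs \<in> Und C (Prod C Vs) \<rightarrow>\<^sub>E tuples C ?Bs"
    unfolding Und_Prod[OF Vs]
    by (rule tuple_map_funcset) (use len ff in auto)
  fix i assume "i < length Ws"
  then have i: "i < length Vs" using len by simp
  have "compose (Und C (Prod C Vs)) (tuple_proj C ?Bs i) (tuple_map C ?As fs)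
          = compose (Und C (Prod C Vs)) (fs ! i) (tuple_proj C ?As i)"
    unfolding compose_def Und_Prod[OF Vs]
  proof (rule restrict_ext)
    fix z assume "z \<in> tuples C ?As"
    then obtain xs where xs: "z = tuple C xs" "xs \<in> listset ?As" by (rule tuplesE)
    then have "map2 (\<lambda>f x. f x) fs xs \<in> listset ?Bs"
      using ff len by (fastforce simp: listset_iff list_all2_conv_all_nth)
    then show "tuple_proj C ?Bs i (tuple_map C ?As fs z) = (fs ! i) (tuple_proj C ?As i z)"
      using xs i len listset_length[OF xs(2)] by simp
  qed
  also have "\<dots> \<in> Hom C (Prod C Vs) (Ws ! i)"
    using Hom_compose[OF Prod_Obj[OF Vs] _ _ Hom_proj[OF Vs i] f[OF i]] O[OF i] by simp
  finally show "compose (Und C (Prod C Vs)) (tuple_proj C ?Bs i) (tuple_map C ?As fs)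
                  \<in> Hom C (Prod C Vs) (Ws ! i)" .
qed

end

context topological_monoidal_category
begin

section \<open>Domains of operations as a functor of the carrier family\<close>

lemma dom_obj:
  assumes "P \<in> Obj C" "\<And>s. s \<in> set Ss \<Longrightarrow> A s \<in> Obj C"
  shows dom_obj_Obj: "dom_obj C A Ss P \<in> Obj C"
    and Und_dom_obj: "Und C (dom_obj C A Ss P)
                        = cart C (Und C P) (tuples C (map (\<lambda>s. Und C (A s)) Ss))"
proof -
  have Vs: "set (map A Ss) \<subseteq> Obj C" using assms by auto
  show "dom_obj C A Ss P \<in> Obj C"
    unfolding dom_obj_def by (rule Ten_Obj[OF assms(1) Prod_Obj[OF Vs]])
  show "Und C (dom_obj C A Ss P) = cart C (Und C P) (tuples C (map (\<lambda>s. Und C (A s)) Ss))"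
    unfolding dom_obj_def Und_Ten[OF assms(1) Prod_Obj[OF Vs]] Und_Prod[OF Vs]
    by (simp add: comp_def)
qed

text \<open>Functoriality of the product followed by functoriality of the tensor product with
  \<open>P\<close>. Applied to identities between different objects of a fibre, it makes the
  formation of domains monotone.\<close>

lemma dom_map_Hom:
  assumes "P \<in> Obj C" "\<And>s. s \<in> set Ss \<Longrightarrow> A s \<in> Obj C" "\<And>s. s \<in> set Ss \<Longrightarrow> B s \<in> Obj C"
    and "\<And>s. s \<in> set Ss \<Longrightarrow> f s \<in> Hom C (A s) (B s)"
  shows "dom_map C A Ss P f \<in> Hom C (dom_obj C A Ss P) (dom_obj C B Ss P)"
proof -
  have A: "set (map A Ss) \<subseteq> Obj C" and B: "set (map B Ss) \<subseteq> Obj C" using assms by auto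
  have "tuple_map C (map (Und C) (map A Ss)) (map f Ss) \<in> Hom C (Prod C (map A Ss)) (Prod C (map B Ss))"
    using assms(4) by (intro tuple_map_Hom A B) auto
  from Ten_Hom[OF assms(1,1) Prod_Obj[OF A] Prod_Obj[OF B] Hom_id[OF assms(1)] this]
  show ?thesis
    unfolding dom_map_def dom_obj_def Und_Prod[OF A] by (simp add: comp_def)
qed

lemma dom_map_apply:
  assumes "p \<in> Und C P" "xs \<in> listset (map (\<lambda>s. Und C (A s)) Ss)"
  shows "dom_map C A Ss P f (upair C p (tuple C xs)) = upair C p (tuple C (map2 f Ss xs))"
proof -
  have "map2 (\<lambda>f x. f x) (map f Ss) xs = map2 f Ss xs"
    by (auto intro: nth_equalityI)
  then show ?thesis
    using assms by (simp add: dom_map_def cart_map_def tuple_in_tuples)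
qed

end

section \<open>Enriched algebras and their underlying classical algebras\<close>

text \<open>A homomorphism is tested only on carriers and on well-typed argument tuples, which is
  where \<open>calg_eq\<close> gives agreement.\<close>

lemma chom_cong:
  assumes h: "chom \<Sigma> D1 D1' h" and sig: "csignature \<Sigma>"
    and eq: "calg_eq \<Sigma> D1 D2" "calg_eq \<Sigma> D1' D2'"
  shows "chom \<Sigma> D2 D2' h"
  unfolding chom_def
proof (intro conjI ballI funcsetI)
  fix s x assume "s \<in> csorts \<Sigma>" "x \<in> ccar D2 s"
  then show "h s x \<in> ccar D2' s" using chom_in[OF h] eq by (auto simp: calg_eq_def)
next
  fix f xs assume f: "f \<in> csyms \<Sigma>" and xs2: "xs \<in> listset (map (ccar D2) (cargs \<Sigma> f))"
  have ss: "set (cargs \<Sigma> f) \<subseteq> csorts \<Sigma>" using sig f by (auto simp: csignature_def)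
  then have "map (ccar D2) (cargs \<Sigma> f) = map (ccar D1) (cargs \<Sigma> f)"
    using eq(1) by (auto simp: calg_eq_def)
  with xs2 have xs: "xs \<in> listset (map (ccar D1) (cargs \<Sigma> f))" by simp
  have "map2 h (cargs \<Sigma> f) xs \<in> listset (map (ccar D1') (cargs \<Sigma> f))"
    using ss by (intro listset_map2[OF xs] chom_in[OF h]) auto
  then show "h (cres \<Sigma> f) (cop D2 f xs) = cop D2' f (map2 h (cargs \<Sigma> f) xs)"
    using chom_cop[OF h f xs] eq f xs by (simp add: calg_eq_def)
qed

lemma chom_restrict:
  assumes h: "chom \<Sigma> D D' h" and sig: "csignature \<Sigma>" and D: "calgebra \<Sigma> D"
  shows "chom \<Sigma> D D' (\<lambda>s\<in>csorts \<Sigma>. \<lambda>x\<in>ccar D s. h s x)" (is "chom _ _ _ ?h")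
  unfolding chom_def
proof (intro conjI ballI funcsetI)
  fix s x assume "s \<in> csorts \<Sigma>" "x \<in> ccar D s"
  then show "?h s x \<in> ccar D' s" using chom_in[OF h] by auto
next
  fix f xs assume f: "f \<in> csyms \<Sigma>" and xs: "xs \<in> listset (map (ccar D) (cargs \<Sigma> f))"
  have ss: "set (cargs \<Sigma> f) \<subseteq> csorts \<Sigma>" "cres \<Sigma> f \<in> csorts \<Sigma>"
    using sig f by (auto simp: csignature_def)
  have "map2 ?h (cargs \<Sigma> f) xs = map2 h (cargs \<Sigma> f) xs"
  proof (rule nth_equalityI)
    fix i assume "i < length (map2 ?h (cargs \<Sigma> f) xs)"
    then show "map2 ?h (cargs \<Sigma> f) xs ! i = map2 h (cargs \<Sigma> f) xs ! i"
      using xs subsetD[OF ss(1) nth_mem, of i] by (auto simp: listset_iff list_all2_conv_all_nth)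
  qed simp
  moreover have "cop D f xs \<in> ccar D (cres \<Sigma> f)" using D f xs by (auto simp: calgebra_def)
  moreover have "?h (cres \<Sigma> f) (cop D f xs) = h (cres \<Sigma> f) (cop D f xs)"
    using ss(2) calculation(2) by simp
  ultimately show "?h (cres \<Sigma> f) (cop D f xs) = cop D' f (map2 ?h (cargs \<Sigma> f) xs)"
    using chom_cop[OF h f xs] by (simp only:)
qed

text \<open>\<open>calg_eq\<close> reads the domains of operations off its first argument. The two
  algebras have the same domains because argument sorts are sorts of the signature.\<close>

lemma calg_eq_sym:
  assumes "calg_eq \<Sigma> D D'" "csignature \<Sigma>" shows "calg_eq \<Sigma> D' D"
proof -
  have "map (ccar D') (cargs \<Sigma> f) = map (ccar D) (cargs \<Sigma> f)" if "f \<in> csyms \<Sigma>" for f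
    using assms that by (auto simp: calg_eq_def csignature_def)
  then show ?thesis using assms(1) unfolding calg_eq_def by metis
qed

lemma calg_eq_refl: "calg_eq \<Sigma> D D"
  by (simp add: calg_eq_def)

context set_universe
begin

lemma chom_decode:
  assumes "small_sized U (elements \<Sigma> D)" "csignature \<Sigma>" "calgebra \<Sigma> D"
  shows "chom \<Sigma> (in_Set U \<Sigma> D) D (\<lambda>_. decode U \<Sigma> D)"
  unfolding chom_def
proof (intro conjI ballI funcsetI)
  fix s u assume "s \<in> csorts \<Sigma>" "u \<in> ccar (in_Set U \<Sigma> D) s"
  then show "decode U \<Sigma> D u \<in> ccar D s"
    using decode_code[OF assms(1)] by (auto simp: ccar_in_Set)
next
  fix f us assume f: "f \<in> csyms \<Sigma>" and us: "us \<in> listset (map (ccar (in_Set U \<Sigma> D)) (cargs \<Sigma> f))"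
  have ss: "set (cargs \<Sigma> f) \<subseteq> csorts \<Sigma>" "cres \<Sigma> f \<in> csorts \<Sigma>"
    using assms(2) f by (auto simp: csignature_def)
  have eq: "map2 (\<lambda>_. decode U \<Sigma> D) (cargs \<Sigma> f) us = map (decode U \<Sigma> D) us"
    using us by (auto simp: listset_iff list_all2_conv_all_nth intro!: nth_equalityI)
  have "map2 (\<lambda>_. decode U \<Sigma> D) (cargs \<Sigma> f) us \<in> listset (map (ccar D) (cargs \<Sigma> f))"
    using ss by (intro listset_map2[OF us]) (auto simp: ccar_in_Set decode_code[OF assms(1)])
  then have "cop D f (map (decode U \<Sigma> D) us) \<in> ccar D (cres \<Sigma> f)"
    using assms(3) f unfolding eq by (simp add: calgebra_def)
  then show "decode U \<Sigma> D (cop (in_Set U \<Sigma> D) f us) = cop D f (map2 (\<lambda>_. decode U \<Sigma> D) (cargs \<Sigma> f) us)"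
    unfolding eq using decode_code[OF assms(1) ss(2)] by (simp add: in_Set_def)
qed

end

lemma und_sig_simps [simp]:
  "csorts (und_sig C \<Sigma>) = sorts \<Sigma>"
  "csyms (und_sig C \<Sigma>) = (SIGMA \<sigma>:syms \<Sigma>. Und C (param \<Sigma> \<sigma>))"
  "cargs (und_sig C \<Sigma>) (\<sigma>, p) = args \<Sigma> \<sigma>" "cres (und_sig C \<Sigma>) (\<sigma>, p) = res \<Sigma> \<sigma>"
  by (simp_all add: und_sig_def)

lemma und_alg_simps [simp]:
  "ccar (und_alg C A) s = Und C (car A s)"
  "cop (und_alg C A) (\<sigma>, p) xs = opn A \<sigma> (upair C p (tuple C xs))"
  by (simp_all add: und_alg_def)

text \<open>Carriers and operations are given independently, so that the indiscrete algebras and the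
  algebras carried by compatible families are instances of one construction.\<close>

definition enr_alg ::
  "('u, 'v, 'm) concrete_scheme \<Rightarrow> ('s, 'o, 'v) esig \<Rightarrow> ('s \<Rightarrow> 'v) \<Rightarrow> ('s, 'o \<times> 'u, 'u) calg \<Rightarrow>
   ('s, 'o, 'u, 'v) ealg" where
  "enr_alg C \<Sigma> A D = \<lparr>car = (\<lambda>s\<in>sorts \<Sigma>. A s), opn = (\<lambda>\<sigma>\<in>syms \<Sigma>. joint_op C \<Sigma> D \<sigma>)\<rparr>"

lemma indisc_alg_eq: "indisc_alg C \<Sigma> D = enr_alg C \<Sigma> (\<lambda>s. Indisc C (ccar D s)) D"
  by (simp add: indisc_alg_def enr_alg_def)

locale signature_over = topological_monoidal_category C
  for C :: "('u, 'v, 'm) concrete_monoidal_scheme" +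
  fixes \<Sigma> :: "('s, 'o, 'v) esig"
  assumes sig: "enriched_signature C \<Sigma>"
begin

section \<open>Enriched algebras built from classical ones, and enriched homomorphisms\<close>

lemma param_Obj: "\<sigma> \<in> syms \<Sigma> \<Longrightarrow> param \<Sigma> \<sigma> \<in> Obj C"
  and args_sorts: "\<sigma> \<in> syms \<Sigma> \<Longrightarrow> set (args \<Sigma> \<sigma>) \<subseteq> sorts \<Sigma>"
  and res_sort: "\<sigma> \<in> syms \<Sigma> \<Longrightarrow> res \<Sigma> \<sigma> \<in> sorts \<Sigma>"
  using sig by (auto simp: enriched_signature_def)

lemma csig: "csignature (und_sig C \<Sigma>)"
  using args_sorts res_sort by (auto simp: csignature_def)

lemma small_sized_und_terms:
  assumes "\<And>s. s \<in> sorts \<Sigma> \<Longrightarrow> small_sized C (Y s)"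
  shows "small_sized C (elements (und_sig C \<Sigma>) (term_alg (und_sig C \<Sigma>) Y))"
proof (rule small_sized_terms)
  show "small_sized C (csyms (und_sig C \<Sigma>))"
    unfolding und_sig_simps
    using sig by (intro small_sized_Sigma small_sized_small Und_small) (auto simp: enriched_signature_def)
qed (use sig assms in \<open>auto simp: enriched_signature_def\<close>)

lemma joint_op_apply:
  assumes "p \<in> Und C (param \<Sigma> \<sigma>)" "xs \<in> listset (map (ccar D) (args \<Sigma> \<sigma>))"
  shows "joint_op C \<Sigma> D \<sigma> (upair C p (tuple C xs)) = cop D (\<sigma>, p) xs"
  using assms listset_length[OF assms(2)] by (simp add: joint_op_def tuple_in_tuples)

lemma dom_obj_args:
  assumes "A ` sorts \<Sigma> \<subseteq> Obj C" "\<sigma> \<in> syms \<Sigma>"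
  shows dom_obj_args_Obj: "dom_obj C A (args \<Sigma> \<sigma>) (param \<Sigma> \<sigma>) \<in> Obj C"
    and Und_dom_obj_args: "Und C (dom_obj C A (args \<Sigma> \<sigma>) (param \<Sigma> \<sigma>))
          = cart C (Und C (param \<Sigma> \<sigma>)) (tuples C (map (\<lambda>s. Und C (A s)) (args \<Sigma> \<sigma>)))"
proof -
  have "A s \<in> Obj C" if "s \<in> set (args \<Sigma> \<sigma>)" for s
    using assms args_sorts that by auto
  from dom_obj[where A = A, OF param_Obj[OF assms(2)] this]
  show "dom_obj C A (args \<Sigma> \<sigma>) (param \<Sigma> \<sigma>) \<in> Obj C"
       "Und C (dom_obj C A (args \<Sigma> \<sigma>) (param \<Sigma> \<sigma>))
          = cart C (Und C (param \<Sigma> \<sigma>)) (tuples C (map (\<lambda>s. Und C (A s)) (args \<Sigma> \<sigma>)))"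
    by (blast, blast)
qed

lemma is_alg_car: "is_alg C \<Sigma> A \<Longrightarrow> s \<in> sorts \<Sigma> \<Longrightarrow> car A s \<in> Obj C"
  by (auto simp: is_alg_def SObj_def)

lemma is_alg_car_image: "is_alg C \<Sigma> A \<Longrightarrow> car A ` sorts \<Sigma> \<subseteq> Obj C"
  using is_alg_car by blast

lemma is_alg_opn:
  assumes "is_alg C \<Sigma> A" "\<sigma> \<in> syms \<Sigma>"
  shows "opn A \<sigma> \<in> Hom C (dom_obj C (car A) (args \<Sigma> \<sigma>) (param \<Sigma> \<sigma>)) (car A (res \<Sigma> \<sigma>))"
  using assms by (auto simp: is_alg_def)

lemma calgebra_und_alg:
  assumes "is_alg C \<Sigma> A"
  shows "calgebra (und_sig C \<Sigma>) (und_alg C A)"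
  unfolding calgebra_def
proof (intro ballI)
  fix f xs assume "f \<in> csyms (und_sig C \<Sigma>)"
    and xs: "xs \<in> listset (map (ccar (und_alg C A)) (cargs (und_sig C \<Sigma>) f))"
  then obtain \<sigma> p where f: "f = (\<sigma>, p)" "\<sigma> \<in> syms \<Sigma>" "p \<in> Und C (param \<Sigma> \<sigma>)" by auto
  have "opn A \<sigma> \<in> Und C (dom_obj C (car A) (args \<Sigma> \<sigma>) (param \<Sigma> \<sigma>)) \<rightarrow>\<^sub>E Und C (car A (res \<Sigma> \<sigma>))"
    using assms f by (intro Hom_funcset is_alg_opn dom_obj_args_Obj is_alg_car_image is_alg_car res_sort)
  then have "opn A \<sigma> (upair C p (tuple C xs)) \<in> Und C (car A (res \<Sigma> \<sigma>))"
    by (rule PiE_mem)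
      (use f xs in \<open>simp add: Und_dom_obj_args[OF is_alg_car_image[OF assms]] und_alg_def tuple_in_tuples\<close>)
  then show "cop (und_alg C A) f xs \<in> ccar (und_alg C A) (cres (und_sig C \<Sigma>) f)"
    using f by simp
qed

lemma is_alg_enr_alg:
  assumes A: "\<And>s. s \<in> sorts \<Sigma> \<Longrightarrow> A s \<in> Obj C"
    and j: "\<And>\<sigma>. \<sigma> \<in> syms \<Sigma> \<Longrightarrow>
          joint_op C \<Sigma> D \<sigma> \<in> Hom C (dom_obj C A (args \<Sigma> \<sigma>) (param \<Sigma> \<sigma>)) (A (res \<Sigma> \<sigma>))"
  shows "is_alg C \<Sigma> (enr_alg C \<Sigma> A D)"
proof -
  have "dom_obj C (\<lambda>s\<in>sorts \<Sigma>. A s) (args \<Sigma> \<sigma>) (param \<Sigma> \<sigma>) = dom_obj C A (args \<Sigma> \<sigma>) (param \<Sigma> \<sigma>)"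
    if "\<sigma> \<in> syms \<Sigma>" for \<sigma>
    unfolding dom_obj_def using args_sorts[OF that]
    by (intro arg_cong[of _ _ "\<lambda>x. Ten C _ (Prod C x)"]) (auto simp: subset_iff)
  then show ?thesis
    using A j res_sort by (auto simp: is_alg_def enr_alg_def SObj_def)
qed

lemma und_alg_enr_alg:
  assumes "\<And>s. s \<in> sorts \<Sigma> \<Longrightarrow> Und C (A s) = ccar D s"
  shows "calg_eq (und_sig C \<Sigma>) (und_alg C (enr_alg C \<Sigma> A D)) D"
  unfolding calg_eq_def
proof (intro conjI ballI)
  fix s assume "s \<in> csorts (und_sig C \<Sigma>)"
  then show "ccar (und_alg C (enr_alg C \<Sigma> A D)) s = ccar D s" using assms by (simp add: enr_alg_def)
next
  fix f xs assume "f \<in> csyms (und_sig C \<Sigma>)"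
    and xs: "xs \<in> listset (map (ccar (und_alg C (enr_alg C \<Sigma> A D))) (cargs (und_sig C \<Sigma>) f))"
  then obtain \<sigma> p where f: "f = (\<sigma>, p)" "\<sigma> \<in> syms \<Sigma>" "p \<in> Und C (param \<Sigma> \<sigma>)" by auto
  have "map (ccar (und_alg C (enr_alg C \<Sigma> A D))) (args \<Sigma> \<sigma>) = map (ccar D) (args \<Sigma> \<sigma>)"
    using args_sorts[OF f(2)] assms by (auto simp: enr_alg_def)
  with xs f have "xs \<in> listset (map (ccar D) (args \<Sigma> \<sigma>))" by simp
  from joint_op_apply[OF f(3) this] show "cop (und_alg C (enr_alg C \<Sigma> A D)) f xs = cop D f xs"
    using f by (simp add: enr_alg_def)
qed

text \<open>Faithfulness of the forgetful functor separates a homomorphism into admissibility and a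
  classical condition. An equation between maps on the domain is tested at the elements given by a
  parameter and a tuple.\<close>

lemma alg_homs_iff:
  assumes A: "is_alg C \<Sigma> A" and B: "is_alg C \<Sigma> B"
  shows "h \<in> alg_homs C \<Sigma> A B \<longleftrightarrow>
     h \<in> SHom C (sorts \<Sigma>) (car A) (car B) \<and> chom (und_sig C \<Sigma>) (und_alg C A) (und_alg C B) h"
proof -
  have "(let T = Und C (dom_obj C (car A) (args \<Sigma> \<sigma>) (param \<Sigma> \<sigma>)) in
          compose T (h (res \<Sigma> \<sigma>)) (opn A \<sigma>)
            = compose T (opn B \<sigma>) (dom_map C (car A) (args \<Sigma> \<sigma>) (param \<Sigma> \<sigma>) h)) \<longleftrightarrow>
        (\<forall>p\<in>Und C (param \<Sigma> \<sigma>). \<forall>xs\<in>listset (map (ccar (und_alg C A)) (args \<Sigma> \<sigma>)).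
           h (res \<Sigma> \<sigma>) (cop (und_alg C A) (\<sigma>, p) xs)
             = cop (und_alg C B) (\<sigma>, p) (map2 h (args \<Sigma> \<sigma>) xs))" (is "?L = ?R")
    if s: "\<sigma> \<in> syms \<Sigma>" for \<sigma>
  proof -
    have U: "Und C (dom_obj C (car A) (args \<Sigma> \<sigma>) (param \<Sigma> \<sigma>))
               = cart C (Und C (param \<Sigma> \<sigma>)) (tuples C (map (ccar (und_alg C A)) (args \<Sigma> \<sigma>)))"
      using Und_dom_obj_args[OF is_alg_car_image[OF A] s] by (simp add: und_alg_def)
    have "?L \<longleftrightarrow> (\<forall>z\<in>cart C (Und C (param \<Sigma> \<sigma>)) (tuples C (map (ccar (und_alg C A)) (args \<Sigma> \<sigma>))).
        h (res \<Sigma> \<sigma>) (opn A \<sigma> z) = opn B \<sigma> (dom_map C (car A) (args \<Sigma> \<sigma>) (param \<Sigma> \<sigma>) h z))"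
      unfolding Let_def U compose_def by (auto simp: fun_eq_iff restrict_def)
    also have "\<dots> \<longleftrightarrow> (\<forall>p\<in>Und C (param \<Sigma> \<sigma>). \<forall>xs\<in>listset (map (ccar (und_alg C A)) (args \<Sigma> \<sigma>)).
        h (res \<Sigma> \<sigma>) (opn A \<sigma> (upair C p (tuple C xs)))
          = opn B \<sigma> (dom_map C (car A) (args \<Sigma> \<sigma>) (param \<Sigma> \<sigma>) h (upair C p (tuple C xs))))"
      by (auto simp: tuple_in_tuples elim!: cart_tuplesE)
    also have "\<dots> \<longleftrightarrow> ?R"
      using dom_map_apply[of _ "param \<Sigma> \<sigma>" _ "car A" "args \<Sigma> \<sigma>" h] by (simp add: und_alg_def)
    finally show ?thesis .
  qed
  moreover have "h s x \<in> Und C (car B s)"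
    if "h \<in> SHom C (sorts \<Sigma>) (car A) (car B)" "s \<in> sorts \<Sigma>" "x \<in> Und C (car A s)" for s x
  proof -
    have "h s \<in> Hom C (car A s) (car B s)" using that by (auto simp: SHom_def)
    from Hom_funcset[OF this] A B that(2,3) show ?thesis by (auto simp: is_alg_car)
  qed
  ultimately show ?thesis
    unfolding alg_homs_def chom_def by auto
qed

lemma small_carD: "is_alg C \<Sigma> A \<Longrightarrow> s \<in> sorts \<Sigma> \<Longrightarrow> small C (ccar (und_alg C A) s)"
  by (simp add: Und_small is_alg_car)

lemma is_alg_indisc:
  assumes D: "calgebra (und_sig C \<Sigma>) D" and small: "\<And>s. s \<in> sorts \<Sigma> \<Longrightarrow> small C (ccar D s)"
  shows "is_alg C \<Sigma> (indisc_alg C \<Sigma> D)"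
  unfolding indisc_alg_eq
proof (rule is_alg_enr_alg)
  let ?A = "\<lambda>s. Indisc C (ccar D s)"
  show O: "?A s \<in> Obj C" if "s \<in> sorts \<Sigma>" for s
    using small[OF that] by (rule Indisc_Obj)
  fix \<sigma> assume s: "\<sigma> \<in> syms \<Sigma>"
  have O': "?A ` sorts \<Sigma> \<subseteq> Obj C" using O by blast
  have m: "map (\<lambda>s. Und C (?A s)) (args \<Sigma> \<sigma>) = map (ccar D) (args \<Sigma> \<sigma>)"
    using args_sorts[OF s] small by (auto simp: Und_Indisc)
  show "joint_op C \<Sigma> D \<sigma> \<in> Hom C (dom_obj C ?A (args \<Sigma> \<sigma>) (param \<Sigma> \<sigma>)) (?A (res \<Sigma> \<sigma>))"
  proof (rule Hom_Indisc[OF small[OF res_sort[OF s]] dom_obj_args_Obj[OF O' s]])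
    show "joint_op C \<Sigma> D \<sigma> \<in> Und C (dom_obj C ?A (args \<Sigma> \<sigma>) (param \<Sigma> \<sigma>)) \<rightarrow>\<^sub>E ccar D (res \<Sigma> \<sigma>)"
      unfolding Und_dom_obj_args[OF O' s] m
    proof (rule PiE_I)
      fix z assume "z \<in> cart C (Und C (param \<Sigma> \<sigma>)) (tuples C (map (ccar D) (args \<Sigma> \<sigma>)))"
      then obtain p xs where z: "z = upair C p (tuple C xs)" "p \<in> Und C (param \<Sigma> \<sigma>)"
        "xs \<in> listset (map (ccar D) (args \<Sigma> \<sigma>))" by (rule cart_tuplesE)
      have "cop D (\<sigma>, p) xs \<in> ccar D (cres (und_sig C \<Sigma>) (\<sigma>, p))"
        using D s z unfolding calgebra_def by fastforce
      then show "joint_op C \<Sigma> D \<sigma> z \<in> ccar D (res \<Sigma> \<sigma>)"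
        using z by (simp add: joint_op_apply)
    qed (simp add: joint_op_def)
  qed
qed

lemma und_alg_indisc:
  assumes "\<And>s. s \<in> sorts \<Sigma> \<Longrightarrow> small C (ccar D s)"
  shows "calg_eq (und_sig C \<Sigma>) (und_alg C (indisc_alg C \<Sigma> D)) D"
  unfolding indisc_alg_eq by (rule und_alg_enr_alg) (simp add: Und_Indisc assms)

text \<open>Admissibility into an indiscrete object is automatic, so the classical condition is all
  that is asked. The restriction makes the family extensional, as membership in
  \<open>alg_homs\<close> requires.\<close>

lemma hom_to_indisc:
  assumes A: "is_alg C \<Sigma> A" and D: "calgebra (und_sig C \<Sigma>) D"
    and small: "\<And>s. s \<in> sorts \<Sigma> \<Longrightarrow> small C (ccar D s)"
    and h: "chom (und_sig C \<Sigma>) (und_alg C A) D h"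
  shows "(\<lambda>s\<in>sorts \<Sigma>. \<lambda>x\<in>Und C (car A s). h s x) \<in> alg_homs C \<Sigma> A (indisc_alg C \<Sigma> D)"
    (is "?h \<in> _")
proof -
  have I: "is_alg C \<Sigma> (indisc_alg C \<Sigma> D)" by (rule is_alg_indisc[OF D small])
  show ?thesis
    unfolding alg_homs_iff[OF A I]
  proof
    show "?h \<in> SHom C (sorts \<Sigma>) (car A) (car (indisc_alg C \<Sigma> D))"
      unfolding SHom_def
    proof (rule PiE_I)
      fix s assume s: "s \<in> sorts \<Sigma>"
      have "?h s \<in> Und C (car A s) \<rightarrow>\<^sub>E ccar D s"
        using chom_in[OF h, of s] s by auto
      then show "?h s \<in> Hom C (car A s) (car (indisc_alg C \<Sigma> D) s)"
        using Hom_Indisc[OF small[OF s] is_alg_car[OF A s]] s by (simp add: indisc_alg_def)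
    qed simp
    have "chom (und_sig C \<Sigma>) (und_alg C A) D ?h"
      using chom_restrict[OF h csig calgebra_und_alg[OF A]] by simp
    then show "chom (und_sig C \<Sigma>) (und_alg C A) (und_alg C (indisc_alg C \<Sigma> D)) ?h"
      by (rule chom_cong[OF _ csig calg_eq_refl calg_eq_sym[OF und_alg_indisc[OF small] csig]])
  qed
qed

section \<open>Algebraic operations and their underlying terms\<close>

lemma alg_operation_in:
  assumes "alg_operation C \<Sigma> Ss s P \<omega>" "is_alg C \<Sigma> A"
  shows "\<omega> A \<in> cart C (Und C P) (tuples C (map (ccar (und_alg C A)) Ss)) \<rightarrow>\<^sub>E Und C (car A s)"
proof -
  have *: "P \<in> Obj C" "set Ss \<subseteq> sorts \<Sigma>" "s \<in> sorts \<Sigma>"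
    "\<omega> A \<in> Hom C (dom_obj C (car A) Ss P) (car A s)"
    using assms by (auto simp: alg_operation_def)
  have O: "car A s' \<in> Obj C" if "s' \<in> set Ss" for s'
    using * is_alg_car[OF assms(2)] that by auto
  have "\<omega> A \<in> Und C (dom_obj C (car A) Ss P) \<rightarrow>\<^sub>E Und C (car A s)"
    by (rule Hom_funcset[OF *(4) dom_obj_Obj[where A = "car A", OF *(1) O] is_alg_car[OF assms(2) *(3)]])
  moreover have "Und C (dom_obj C (car A) Ss P) = cart C (Und C P) (tuples C (map (\<lambda>s. Und C (car A s)) Ss))"
    by (rule Und_dom_obj[OF *(1) O])
  ultimately show ?thesis by (simp add: und_alg_def)
qed

lemma alg_operation_natural:
  assumes \<omega>: "alg_operation C \<Sigma> Ss s P \<omega>" and A: "is_alg C \<Sigma> A" and B: "is_alg C \<Sigma> B"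
    and h: "h \<in> alg_homs C \<Sigma> A B"
    and p: "p \<in> Und C P" and xs: "xs \<in> listset (map (ccar (und_alg C A)) Ss)"
  shows "h s (\<omega> A (upair C p (tuple C xs))) = \<omega> B (upair C p (tuple C (map2 h Ss xs)))"
proof -
  have *: "P \<in> Obj C" "set Ss \<subseteq> sorts \<Sigma>" using \<omega> by (auto simp: alg_operation_def)
  have O: "car A s' \<in> Obj C" if "s' \<in> set Ss" for s'
    using * is_alg_car[OF A] that by auto
  let ?T = "Und C (dom_obj C (car A) Ss P)"
  have xs': "xs \<in> listset (map (\<lambda>s. Und C (car A s)) Ss)" using xs by (simp add: und_alg_def)
  have T: "upair C p (tuple C xs) \<in> ?T"
    by (subst Und_dom_obj[OF *(1) O]) (use p xs' in \<open>simp_all add: tuple_in_tuples\<close>)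
  have "compose ?T (h s) (\<omega> A) (upair C p (tuple C xs))
          = compose ?T (\<omega> B) (dom_map C (car A) Ss P h) (upair C p (tuple C xs))"
    using \<omega> A B h unfolding alg_operation_def by simp
  then show ?thesis using T by (simp add: compose_def dom_map_apply[OF p xs'])
qed

text \<open>
  Naturality along the homomorphism from the indiscrete term algebra that sends the variables to
  given elements, and along the identity from \<open>A\<close> to its indiscrete version, shows that an algebraic
  operation is determined by its underlying terms.
\<close>

lemma und_term:
  assumes \<omega>: "alg_operation C \<Sigma> Ss s P \<omega>" and vs: "distinct vs" "map fst vs = Ss"
    and p: "p \<in> Und C P"
  shows wf_und_term: "wf_trm (und_sig C \<Sigma>) (ctx_consts vs) s (und_term C \<Sigma> \<omega> vs p)"
    and interp_und_term: "\<lbrakk>is_alg C \<Sigma> A; xs \<in> listset (map (ccar (und_alg C A)) Ss)\<rbrakk> \<Longrightarrow>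
          \<omega> A (upair C p (tuple C xs)) = interp (und_alg C A) vs (und_term C \<Sigma> \<omega> vs p) xs"
proof -
  let ?S = "und_sig C \<Sigma>"
  let ?T = "term_alg ?S (ctx_consts vs)"
  let ?D = "in_Set C ?S ?T"
  let ?I = "indisc_alg C \<Sigma> ?D"
  define cs where "cs = map (\<lambda>(s, i). code C ?S ?T (Const s i)) vs"
  have small: "small_sized C (elements ?S ?T)"
    by (rule small_sized_und_terms) (rule small_sized_nat_set)
  have smallD: "small C (ccar ?D s)" if "s \<in> sorts \<Sigma>" for s
    using small_in_Set[OF small] that by simp
  have D: "calgebra ?S ?D" by (rule calgebra_in_Set[OF small csig calgebra_term_alg])
  have I: "is_alg C \<Sigma> ?I" by (rule is_alg_indisc[OF D smallD])
  have Ieq: "calg_eq ?S (und_alg C ?I) ?D" by (rule und_alg_indisc[OF smallD])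
  have ss: "set Ss \<subseteq> sorts \<Sigma>" "s \<in> sorts \<Sigma>" using \<omega> by (auto simp: alg_operation_def)
  have wfv: "Const (fst v) (snd v) \<in> ccar ?T (fst v)" if "v \<in> set vs" for v
  proof -
    have "fst v \<in> set (map fst vs)" using that by simp
    then have "fst v \<in> csorts ?S" using ss(1) by (auto simp: vs(2))
    moreover have "snd v \<in> ctx_consts vs (fst v)" using that by (simp add: ctx_consts_def)
    ultimately show ?thesis by (simp add: wf_trm.Const)
  qed
  have mI: "map (ccar (und_alg C ?I)) Ss = map (ccar ?D) Ss"
    using Ieq ss(1) by (auto simp: calg_eq_def)
  have cs: "cs \<in> listset (map (ccar (und_alg C ?I)) Ss)"
    unfolding mI unfolding vs(2)[symmetric] cs_def listset_iff
    using wfv by (auto simp: list_all2_conv_all_nth ccar_in_Set case_prod_unfold simp del: term_alg_simps)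
  define x where "x = \<omega> ?I (upair C p (tuple C cs))"
  have "x \<in> Und C (car ?I s)"
    unfolding x_def by (rule PiE_mem[OF alg_operation_in[OF \<omega> I]])
      (use p cs in \<open>simp add: tuple_in_tuples del: und_alg_simps\<close>)
  also have "Und C (car ?I s) = ccar ?D s" using Ieq ss(2) by (auto simp: calg_eq_def)
  finally have x: "x \<in> ccar ?D s" .
  have t: "und_term C \<Sigma> \<omega> vs p = decode C ?S ?T x"
    unfolding und_term_def Let_def x_def cs_def ..
  have "decode C ?S ?T x \<in> ccar ?T s"
    using chom_in[OF chom_decode[OF small csig calgebra_term_alg] _ x] ss(2) by simp
  then show "wf_trm ?S (ctx_consts vs) s (und_term C \<Sigma> \<omega> vs p)" unfolding t by simp
  fix A xs assume A: "is_alg C \<Sigma> A" and xs: "xs \<in> listset (map (ccar (und_alg C A)) Ss)"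
  let ?A = "und_alg C A"
  let ?J = "indisc_alg C \<Sigma> ?A"
  define \<rho> where "\<rho> = (\<lambda>s i. the (map_of (zip vs xs) (s, i)))"
  have cA: "calgebra ?S ?A" by (rule calgebra_und_alg[OF A])
  have smallA: "small C (ccar ?A s)" if "s \<in> sorts \<Sigma>" for s by (rule small_carD[OF A that])
  have J: "is_alg C \<Sigma> ?J" by (rule is_alg_indisc[OF cA smallA])
  have len: "length xs = length vs" "length Ss = length vs"
    using listset_length[OF xs] vs(2) by auto
  have xs': "xs \<in> listset (map (\<lambda>(s, i). ccar ?A s) vs)"
    using xs unfolding vs(2)[symmetric] by (simp add: case_prod_unfold comp_def)
  have \<rho>: "\<rho> s c \<in> ccar ?A s" if "c \<in> ctx_consts vs s" for s c
    unfolding \<rho>_def by (rule ctx_env_in[OF xs' that])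
  \<comment> \<open>Decoding an element to a term and evaluating it at \<open>\<rho>\<close> sends
    the variables to \<open>xs\<close>.\<close>
  have g: "chom ?S (und_alg C ?I) ?A (\<lambda>s u. eval ?A \<rho> (decode C ?S ?T u))"
    by (rule chom_cong[OF _ csig calg_eq_sym[OF Ieq csig] calg_eq_refl],
        rule chom_comp[OF chom_decode[OF small csig calgebra_term_alg] chom_eval[OF cA \<rho>] csig])
  \<comment> \<open>The evaluation need not be admissible from the indiscrete \<open>?I\<close> into
    \<open>A\<close>. Both it and the identity of \<open>A\<close> are admissible into
    \<open>?J\<close>, where the two naturality squares are compared.\<close>
  let ?g = "\<lambda>s\<in>sorts \<Sigma>. \<lambda>u\<in>Und C (car ?I s). eval ?A \<rho> (decode C ?S ?T u)"
  let ?f = "\<lambda>s\<in>sorts \<Sigma>. \<lambda>x\<in>Und C (car A s). x"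
  have gH: "?g \<in> alg_homs C \<Sigma> ?I ?J" by (rule hom_to_indisc[OF I cA smallA g])
  have idA: "chom ?S ?A ?A (\<lambda>_ x. x)" by (rule chom_id[OF calg_eq_refl])
  have fH: "?f \<in> alg_homs C \<Sigma> A ?J" by (rule hom_to_indisc[OF A cA smallA idA])
  have ssn: "Ss ! i \<in> sorts \<Sigma>" if "i < length Ss" for i using ss(1) that by auto
  have "map2 ?f Ss xs = xs"
    using xs len ssn by (auto simp: listset_iff list_all2_conv_all_nth intro!: nth_equalityI)
  with alg_operation_natural[OF \<omega> A J fH p xs]
  have 1: "?f s (\<omega> A (upair C p (tuple C xs))) = \<omega> ?J (upair C p (tuple C xs))" by simp
  have "\<omega> A (upair C p (tuple C xs)) \<in> Und C (car A s)"
    by (rule PiE_mem[OF alg_operation_in[OF \<omega> A]])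
      (use p xs in \<open>simp add: tuple_in_tuples del: und_alg_simps\<close>)
  with 1 ss(2) have 2: "\<omega> A (upair C p (tuple C xs)) = \<omega> ?J (upair C p (tuple C xs))" by simp
  have "map2 ?g Ss cs = xs"
  proof (rule nth_equalityI)
    fix i assume "i < length (map2 ?g Ss cs)"
    then have i: "i < length vs" "i < length Ss" "i < length cs" using len by (auto simp: cs_def)
    have "fst (vs ! i) = Ss ! i" using vs(2) i by auto
    then have v: "vs ! i = (Ss ! i, snd (vs ! i))" by (metis prod.collapse)
    have csi: "cs ! i = code C ?S ?T (Const (Ss ! i) (snd (vs ! i)))"
      unfolding cs_def using i v by (metis (no_types, lifting) nth_map case_prod_conv)
    have "Const (Ss ! i) (snd (vs ! i)) \<in> ccar ?T (Ss ! i)"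
      using wfv[OF nth_mem[OF i(1)]] v by (metis fst_conv)
    then have d: "decode C ?S ?T (cs ! i) = Const (Ss ! i) (snd (vs ! i))"
      unfolding csi using ssn[OF i(2)] by (intro decode_code[OF small]) auto
    have "cs ! i \<in> Und C (car ?I (Ss ! i))"
      using cs i by (auto simp: listset_iff list_all2_conv_all_nth)
    then have "map2 ?g Ss cs ! i = \<rho> (Ss ! i) (snd (vs ! i))"
      using i d ssn[OF i(2)] by simp
    also have "\<dots> = the (map_of (zip vs xs) (vs ! i))" unfolding \<rho>_def v[symmetric] ..
    \<comment> \<open>Distinctness of the variables makes the lookup return the entry at the same
      position.\<close>
    also have "\<dots> = xs ! i" using map_of_zip_nth[of vs xs i] vs(1) len i by simp
    finally show "map2 ?g Ss cs ! i = xs ! i" .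
  qed (use len in \<open>simp add: cs_def\<close>)
  with alg_operation_natural[OF \<omega> I J gH p cs]
  have "?g s x = \<omega> ?J (upair C p (tuple C xs))" by (simp add: x_def)
  moreover have "?g s x = eval ?A \<rho> (decode C ?S ?T x)"
    using ss(2) \<open>x \<in> Und C (car ?I s)\<close> by simp
  ultimately show "\<omega> A (upair C p (tuple C xs)) = interp ?A vs (und_term C \<Sigma> \<omega> vs p) xs"
    unfolding 2 t interp_def \<rho>_def[symmetric] by simp
qed

end

section \<open>The free algebra\<close>

text \<open>The identity is a homomorphism from \<open>D\<close> to \<open>D'\<close>, so
  well-formed terms have equal interpretations. The condition on sorts ensures that the context
  ranges over the same tuples in both algebras.\<close>

lemma calg_eq_sat:
  assumes eq: "calg_eq \<Sigma> D D'" and D: "calgebra \<Sigma> D" and e: "wf_ceqn \<Sigma> e" "sat D' e"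
    and sorts: "fst ` set (ceq_ctx e) \<subseteq> csorts \<Sigma>"
  shows "sat D e"
  unfolding sat_def
proof
  let ?vs = "ceq_ctx e"
  fix ds assume ds: "ds \<in> listset (map (\<lambda>(s, i). ccar D s) ?vs)"
  have m: "map (\<lambda>(s, i). ccar D s) ?vs = map (\<lambda>(s, i). ccar D' s) ?vs"
    using eq sorts by (auto simp: calg_eq_def)
  have "map2 (\<lambda>(s, i) x. x) ?vs ds = ds"
    using ds by (auto dest!: listset_length intro: nth_equalityI simp: case_prod_unfold)
  then have "interp D ?vs t ds = interp D' ?vs t ds" if "wf_trm \<Sigma> (ctx_consts ?vs) (ceq_sort e) t" for t
    using interp_hom[OF that chom_id[OF eq] D ds] by simp
  then show "interp D ?vs (ceq_lhs e) ds = interp D ?vs (ceq_rhs e) ds"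
    using e ds unfolding m by (simp add: wf_ceqn_def sat_def)
qed

text \<open>Argument tuples of \<open>F\<close> lift along the surjection \<open>q\<close> to
  \<open>T\<close>, where the homomorphism property of \<open>g\<close> applies. This descends
  homomorphisms to quotients.\<close>

lemma chom_factor:
  assumes q: "chom \<Sigma> T F q" and g: "chom \<Sigma> T D g" and sig: "csignature \<Sigma>" and T: "calgebra \<Sigma> T"
    and surj: "\<And>s y. s \<in> csorts \<Sigma> \<Longrightarrow> y \<in> ccar F s \<Longrightarrow> \<exists>t\<in>ccar T s. q s t = y"
    and hq: "\<And>s t. s \<in> csorts \<Sigma> \<Longrightarrow> t \<in> ccar T s \<Longrightarrow> h s (q s t) = g s t"
  shows "chom \<Sigma> F D h"
  unfolding chom_def
proof (intro conjI ballI funcsetI)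
  fix s y assume "s \<in> csorts \<Sigma>" "y \<in> ccar F s"
  then show "h s y \<in> ccar D s" using surj hq chom_in[OF g] by metis
next
  fix f ys assume f: "f \<in> csyms \<Sigma>" and ys: "ys \<in> listset (map (ccar F) (cargs \<Sigma> f))"
  have ss: "set (cargs \<Sigma> f) \<subseteq> csorts \<Sigma>" "cres \<Sigma> f \<in> csorts \<Sigma>"
    using sig f by (auto simp: csignature_def)
  obtain ts where ts: "ts \<in> listset (map (ccar T) (cargs \<Sigma> f))" "map2 q (cargs \<Sigma> f) ts = ys"
    by (rule listset_map2_surj[where A = "ccar T" and h = q, OF surj ss(1) ys])
  have "map2 h (cargs \<Sigma> f) ys = map2 g (cargs \<Sigma> f) ts"
  proof (rule nth_equalityI)
    fix i assume "i < length (map2 h (cargs \<Sigma> f) ys)"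
    then show "map2 h (cargs \<Sigma> f) ys ! i = map2 g (cargs \<Sigma> f) ts ! i"
      using ts subsetD[OF ss(1) nth_mem, of i] hq
      by (auto simp: listset_iff list_all2_conv_all_nth)
  qed (simp add: ts(2)[symmetric])
  moreover have "cop T f ts \<in> ccar T (cres \<Sigma> f)" using T f ts(1) by (auto simp: calgebra_def)
  ultimately show "h (cres \<Sigma> f) (cop F f ys) = cop D f (map2 h (cargs \<Sigma> f) ys)"
    using chom_cop[OF q f ts(1)] chom_cop[OF g f ts(1)] hq[OF ss(2)] ts(2) by metis
qed

locale theory_over = signature_over C \<Sigma>
  for C :: "('u, 'v, 'm) concrete_monoidal_scheme" and \<Sigma> :: "('s, 'o, 'v) esig" +
  fixes E :: "('s, 'o, 'u, 'v) aeqn set" and X :: "'s \<Rightarrow> 'v"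
  assumes thy: "enriched_theory C \<Sigma> E" and X: "X \<in> SObj C (sorts \<Sigma>)"
begin

abbreviation "S \<equiv> und_sig C \<Sigma>"
abbreviation "Y \<equiv> \<lambda>s. Und C (X s)"
abbreviation "T \<equiv> term_alg S Y"
abbreviation "R \<equiv> generated_congruence S T (und_eqns C \<Sigma> E)"
abbreviation "K \<equiv> class_alg C \<Sigma> E X"
abbreviation "F \<equiv> free_calg C \<Sigma> E X"
abbreviation "\<eta> \<equiv> free_unit C \<Sigma> E X"

section \<open>The underlying classical theory and its algebras\<close>

lemma X_Obj: "s \<in> sorts \<Sigma> \<Longrightarrow> X s \<in> Obj C"
  using X by (auto simp: SObj_def)

lemma und_eqns_cases:
  assumes "e \<in> und_eqns C \<Sigma> E"
  obtains a p where "a \<in> E" "p \<in> Und C (aeq_param a)" "distinct (ceq_ctx e)"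
    "map fst (ceq_ctx e) = aeq_args a" "ceq_sort e = aeq_res a"
    "ceq_lhs e = und_term C \<Sigma> (aeq_lhs a) (ceq_ctx e) p"
    "ceq_rhs e = und_term C \<Sigma> (aeq_rhs a) (ceq_ctx e) p"
    "alg_operation C \<Sigma> (aeq_args a) (aeq_res a) (aeq_param a) (aeq_lhs a)"
    "alg_operation C \<Sigma> (aeq_args a) (aeq_res a) (aeq_param a) (aeq_rhs a)"
  using assms thy unfolding und_eqns_def enriched_theory_def by auto

lemma und_eqns_ctx:
  assumes "e \<in> und_eqns C \<Sigma> E"
  shows "fst ` set (ceq_ctx e) \<subseteq> csorts S"
  using assms
proof (rule und_eqns_cases)
  fix a assume "map fst (ceq_ctx e) = aeq_args a"
    "alg_operation C \<Sigma> (aeq_args a) (aeq_res a) (aeq_param a) (aeq_lhs a)"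
  then show ?thesis by (metis alg_operation_def set_map und_sig_simps(1))
qed

lemma wf_und_eqns: "e \<in> und_eqns C \<Sigma> E \<Longrightarrow> wf_ceqn S e"
  by (erule und_eqns_cases) (simp add: wf_ceqn_def wf_und_term)

text \<open>By \<open>interp_und_term\<close>, the components of an operation at \<open>A\<close>
  are the interpretations of its underlying terms. Equality of components at all parameters and
  tuples is therefore satisfaction of the syntactic equations.\<close>

lemma theory_alg_iff:
  assumes A: "is_alg C \<Sigma> A"
  shows "is_theory_alg C \<Sigma> E A \<longleftrightarrow> (\<forall>e\<in>und_eqns C \<Sigma> E. sat (und_alg C A) e)"
proof (intro iffI ballI)
  fix e assume L: "is_theory_alg C \<Sigma> E A" and e: "e \<in> und_eqns C \<Sigma> E"
  from e obtain a p where a: "a \<in> E" "p \<in> Und C (aeq_param a)" "distinct (ceq_ctx e)"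
    "map fst (ceq_ctx e) = aeq_args a"
    "ceq_lhs e = und_term C \<Sigma> (aeq_lhs a) (ceq_ctx e) p"
    "ceq_rhs e = und_term C \<Sigma> (aeq_rhs a) (ceq_ctx e) p"
    "alg_operation C \<Sigma> (aeq_args a) (aeq_res a) (aeq_param a) (aeq_lhs a)"
    "alg_operation C \<Sigma> (aeq_args a) (aeq_res a) (aeq_param a) (aeq_rhs a)"
    by (rule und_eqns_cases)
  show "sat (und_alg C A) e"
    unfolding sat_def
  proof
    fix ds assume "ds \<in> listset (map (\<lambda>(s, i). ccar (und_alg C A) s) (ceq_ctx e))"
    then have ds: "ds \<in> listset (map (ccar (und_alg C A)) (aeq_args a))"
      unfolding a(4)[symmetric] by (simp add: case_prod_unfold comp_def)
    show "interp (und_alg C A) (ceq_ctx e) (ceq_lhs e) ds = interp (und_alg C A) (ceq_ctx e) (ceq_rhs e) ds"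
      using L a(1) unfolding a(5,6)
        interp_und_term[OF a(7) a(3,4,2) A ds, symmetric] interp_und_term[OF a(8) a(3,4,2) A ds, symmetric]
      by (simp add: is_theory_alg_def)
  qed
next
  assume L: "\<forall>e\<in>und_eqns C \<Sigma> E. sat (und_alg C A) e"
  have "aeq_lhs a A = aeq_rhs a A" if a: "a \<in> E" for a
  proof -
    \<comment> \<open>Numbering the variables by position keeps them distinct even when sorts
      repeat. The set of underlying equations contains an instance for every such context, and this
      one is enough.\<close>
    define vs where "vs = zip (aeq_args a) [0..<length (aeq_args a)]"
    have vs: "distinct vs" "map fst vs = aeq_args a"
      by (simp_all add: vs_def distinct_zipI2)
    have l: "alg_operation C \<Sigma> (aeq_args a) (aeq_res a) (aeq_param a) (aeq_lhs a)"
      and r: "alg_operation C \<Sigma> (aeq_args a) (aeq_res a) (aeq_param a) (aeq_rhs a)"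
      using thy a by (auto simp: enriched_theory_def)
    show ?thesis
    proof (rule PiE_ext[OF alg_operation_in[OF l A] alg_operation_in[OF r A]])
      fix z assume "z \<in> cart C (Und C (aeq_param a)) (tuples C (map (ccar (und_alg C A)) (aeq_args a)))"
      then obtain p xs where z: "z = upair C p (tuple C xs)" "p \<in> Und C (aeq_param a)"
        and xs: "xs \<in> listset (map (ccar (und_alg C A)) (aeq_args a))" by (rule cart_tuplesE)
      have xs': "xs \<in> listset (map (\<lambda>(s, i). ccar (und_alg C A) s) vs)"
        using xs unfolding vs(2)[symmetric] by (simp add: case_prod_unfold comp_def)
      have "\<lparr>ceq_ctx = vs, ceq_sort = aeq_res a, ceq_lhs = und_term C \<Sigma> (aeq_lhs a) vs p,
             ceq_rhs = und_term C \<Sigma> (aeq_rhs a) vs p\<rparr> \<in> und_eqns C \<Sigma> E"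
        unfolding und_eqns_def using a vs z(2) by blast
      then have "interp (und_alg C A) vs (und_term C \<Sigma> (aeq_lhs a) vs p) xs
                   = interp (und_alg C A) vs (und_term C \<Sigma> (aeq_rhs a) vs p) xs"
        using L xs' by (fastforce simp: sat_def)
      then show "aeq_lhs a A z = aeq_rhs a A z"
        unfolding z(1) interp_und_term[OF l vs z(2) A xs] interp_und_term[OF r vs z(2) A xs] .
    qed
  qed
  then show "is_theory_alg C \<Sigma> E A" using A by (simp add: is_theory_alg_def)
qed

text \<open>The quotient map followed by the coding. Through it, elements of the free classical
  algebra are handled by representing terms instead of sets of terms and their codes.\<close>

definition cls :: "'s \<Rightarrow> ('s, 'o \<times> 'u, 'u) trm \<Rightarrow> 'u" where
  "cls s t = code C S K (R s `` {t})"

lemma class_alg_eq: "K = quotient_alg S T R"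
  by (simp add: class_alg_def Let_def)

lemma congruence_R: "congruence S T R"
  by (rule congruence_generated[OF wf_und_eqns])

lemma equiv_R: "s \<in> sorts \<Sigma> \<Longrightarrow> equiv {t. wf_trm S Y s t} (R s)"
  using congruence_R by (simp add: congruence_def)

lemma small_K: "small_sized C (elements S K)"
  unfolding class_alg_eq
proof (rule small_sized_quotient)
  show "small_sized C (csorts S)" using sig by (simp add: enriched_signature_def)
  show "small_sized C (elements S T)"
    by (intro small_sized_und_terms small_sized_small Und_small X_Obj)
qed

lemma chom_cls: "chom S T F cls"
  using chom_comp[OF chom_quotient[OF csig congruence_R calgebra_term_alg]
      chom_in_Set[OF small_K csig, unfolded class_alg_eq] csig]
  unfolding cls_def free_calg_def class_alg_eq .

lemma cls_in: "s \<in> sorts \<Sigma> \<Longrightarrow> wf_trm S Y s t \<Longrightarrow> cls s t \<in> ccar F s"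
  using chom_in[OF chom_cls] by simp

lemma cls_surj:
  assumes "s \<in> csorts S" "y \<in> ccar F s"
  shows "\<exists>t\<in>ccar T s. cls s t = y"
  using assms by (auto simp: free_calg_def ccar_in_Set class_alg_eq quotient_alg_simps cls_def elim!: quotientE)

lemma clsE:
  assumes "s \<in> sorts \<Sigma>" "y \<in> ccar F s"
  obtains t where "wf_trm S Y s t" "y = cls s t"
  using cls_surj assms by auto

lemma cls_eqD:
  assumes s: "s \<in> sorts \<Sigma>" and t: "wf_trm S Y s t" "wf_trm S Y s t'" and eq: "cls s t = cls s t'"
  shows "(t, t') \<in> R s"
proof -
  have "R s `` {t} \<in> elements S K" "R s `` {t'} \<in> elements S K"
    using s t by (auto simp: elements_def class_alg_eq quotient_alg_simps intro: quotientI)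
  then have "R s `` {t} = R s `` {t'}"
    using eq code_inj(1)[OF small_K] unfolding cls_def by (meson inj_onD)
  then show ?thesis using equiv_R[OF s] t by (simp add: eq_equiv_class_iff)
qed

lemma cls_eqI: "s \<in> sorts \<Sigma> \<Longrightarrow> (t, t') \<in> R s \<Longrightarrow> cls s t = cls s t'"
  unfolding cls_def using equiv_class_eq[OF equiv_R] by simp

lemma calgebra_F: "calgebra S F"
  by (rule calgebra_image[OF chom_cls csig calgebra_term_alg cls_surj])

lemma small_F: "s \<in> sorts \<Sigma> \<Longrightarrow> small C (ccar F s)"
  unfolding free_calg_def by (rule small_in_Set[OF small_K]) simp

text \<open>A tuple of classes lifts to a tuple of terms. The two sides at these terms are related
  by the generated congruence, and \<open>cls\<close>, being a homomorphism, carries them to the two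
  sides in \<open>F\<close>.\<close>

lemma sat_F:
  assumes e: "e \<in> und_eqns C \<Sigma> E"
  shows "sat F e"
  unfolding sat_def
proof
  let ?vs = "ceq_ctx e"
  fix ds assume "ds \<in> listset (map (\<lambda>(s, i). ccar F s) ?vs)"
  then have ds: "ds \<in> listset (map (ccar F) (map fst ?vs))"
    by (simp add: case_prod_unfold comp_def)
  obtain ts where ts: "ts \<in> listset (map (ccar T) (map fst ?vs))" "map2 cls (map fst ?vs) ts = ds"
    by (rule listset_map2_surj[where A = "ccar T" and h = cls, OF cls_surj _ ds])
      (use und_eqns_ctx[OF e] in simp_all)
  have ts': "ts \<in> listset (map (\<lambda>(s, i). ccar T s) ?vs)"
    using ts(1) by (simp add: case_prod_unfold comp_def)
  have ds': "map2 (\<lambda>(s, i). cls s) ?vs ts = ds"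
    unfolding ts(2)[symmetric] by (auto intro: nth_equalityI simp: case_prod_unfold)
  have wf: "wf_trm S (ctx_consts ?vs) (ceq_sort e) (ceq_lhs e)"
           "wf_trm S (ctx_consts ?vs) (ceq_sort e) (ceq_rhs e)"
    using wf_und_eqns[OF e] by (auto simp: wf_ceqn_def)
  have "cls (ceq_sort e) (interp T ?vs (ceq_lhs e) ts) = cls (ceq_sort e) (interp T ?vs (ceq_rhs e) ts)"
    using wf_trm_sort[OF wf(1) csig]
    by (intro cls_eqI generated_congruence_contains[OF e ts']) simp
  then show "interp F ?vs (ceq_lhs e) ds = interp F ?vs (ceq_rhs e) ds"
    using interp_hom[OF wf(1) chom_cls calgebra_term_alg ts']
          interp_hom[OF wf(2) chom_cls calgebra_term_alg ts'] by (simp add: ds')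
qed

lemma unit_eq: "s \<in> sorts \<Sigma> \<Longrightarrow> x \<in> Y s \<Longrightarrow> \<eta> s x = cls s (Const s x)"
  by (simp add: free_unit_def cls_def)

lemma unit_funcset: "s \<in> sorts \<Sigma> \<Longrightarrow> \<eta> s \<in> Y s \<rightarrow>\<^sub>E ccar F s"
  by (rule PiE_I) (auto simp: unit_eq cls_in wf_trm.Const, simp add: free_unit_def)

text \<open>Composition with \<open>cls\<close> gives a homomorphism out of the term algebra, which
  is evaluation at its values on the constants.\<close>

lemma chom_F_unique:
  assumes h: "chom S F D h" and h\<eta>: "\<And>s x. s \<in> sorts \<Sigma> \<Longrightarrow> x \<in> Y s \<Longrightarrow> h s (\<eta> s x) = f s x"
    and t: "wf_trm S Y s t"
  shows "h s (cls s t) = eval D f t"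
proof -
  have "h s (cls s t) = eval D (\<lambda>s x. h s (cls s (Const s x))) t"
    using eval_term_hom[OF t chom_comp[OF chom_cls h csig]] by simp
  also have "\<dots> = eval D f t"
    by (rule eval_cong[OF t]) (simp add: h\<eta> unit_eq[symmetric])
  finally show ?thesis .
qed

text \<open>The extension evaluates a chosen representative. Since \<open>D\<close> satisfies the
  equations, the generated congruence lies inside the kernel of evaluation, so the choice does not
  affect the value.\<close>

lemma chom_F_exists:
  assumes D: "calgebra S D" "\<And>e. e \<in> und_eqns C \<Sigma> E \<Longrightarrow> sat D e"
    and f: "\<And>s x. s \<in> sorts \<Sigma> \<Longrightarrow> x \<in> Y s \<Longrightarrow> f s x \<in> ccar D s"
  shows "\<exists>h. chom S F D h \<and> (\<forall>s\<in>sorts \<Sigma>. \<forall>x\<in>Y s. h s (\<eta> s x) = f s x)"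
proof -
  define h where "h s y = eval D f (SOME t. wf_trm S Y s t \<and> cls s t = y)" for s y
  have f': "f s x \<in> ccar D s" if "s \<in> csorts S" "x \<in> Y s" for s x using f that by simp
  have hc: "h s (cls s t) = eval D f t" if s: "s \<in> csorts S" and t: "t \<in> ccar T s" for s t
  proof -
    define t' where "t' = (SOME t'. wf_trm S Y s t' \<and> cls s t' = cls s t)"
    have "wf_trm S Y s t' \<and> cls s t' = cls s t"
      unfolding t'_def by (rule someI[of _ t]) (use t in simp)
    then have "(t', t) \<in> R s" using s t by (intro cls_eqD) auto
    moreover have "R s \<subseteq> kernel S Y D f s"
      by (rule generated_congruence_kernel[OF D(1) f']) (simp_all add: wf_und_eqns D(2))
    ultimately have "(t', t) \<in> kernel S Y D f s" by blast
    then show ?thesis by (simp add: kernel_def h_def t'_def)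
  qed
  have "chom S F D h"
    by (rule chom_factor[OF chom_cls chom_eval[OF D(1) f'] csig calgebra_term_alg cls_surj hc])
  moreover have "h s (\<eta> s x) = f s x" if "s \<in> sorts \<Sigma>" "x \<in> Y s" for s x
    using hc[of s "Const s x"] that by (simp add: unit_eq wf_trm.Const)
  ultimately show ?thesis by blast
qed

section \<open>Compatible families as theory algebras\<close>

definition compatibles :: "('s \<Rightarrow> 'v) set" where
  "compatibles = {B \<in> carrier (SFib C (sorts \<Sigma>) (ccar F)). compatible C \<Sigma> E X B}"

lemma compatibles_iff:
  "B \<in> compatibles \<longleftrightarrow> B \<in> SObj C (sorts \<Sigma>) \<and> (\<forall>s\<in>sorts \<Sigma>. Und C (B s) = ccar F s) \<and>
     (\<forall>s\<in>sorts \<Sigma>. \<eta> s \<in> Hom C (X s) (B s)) \<and>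
     (\<forall>\<sigma>\<in>syms \<Sigma>. joint_op C \<Sigma> F \<sigma> \<in> Hom C (dom_obj C B (args \<Sigma> \<sigma>) (param \<Sigma> \<sigma>)) (B (res \<Sigma> \<sigma>)))"
proof -
  have "\<eta> \<in> SHom C (sorts \<Sigma>) X B \<longleftrightarrow> (\<forall>s\<in>sorts \<Sigma>. \<eta> s \<in> Hom C (X s) (B s))"
    by (auto simp: SHom_def PiE_iff free_unit_def)
  then show ?thesis by (auto simp: compatibles_def compatible_def SFib_def)
qed

lemma compatiblesD:
  assumes "B \<in> compatibles"
  shows compatibles_Obj: "s \<in> sorts \<Sigma> \<Longrightarrow> B s \<in> Obj C"
    and Und_compatibles: "s \<in> sorts \<Sigma> \<Longrightarrow> Und C (B s) = ccar F s"
    and unit_Hom: "s \<in> sorts \<Sigma> \<Longrightarrow> \<eta> s \<in> Hom C (X s) (B s)"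
    and joint_op_Hom: "\<sigma> \<in> syms \<Sigma> \<Longrightarrow>
          joint_op C \<Sigma> F \<sigma> \<in> Hom C (dom_obj C B (args \<Sigma> \<sigma>) (param \<Sigma> \<sigma>)) (B (res \<Sigma> \<sigma>))"
    and restrict_compatibles: "(\<lambda>s\<in>sorts \<Sigma>. B s) = B"
  using assms unfolding compatibles_iff SObj_def by auto

lemma is_alg_compatible: "B \<in> compatibles \<Longrightarrow> is_alg C \<Sigma> (enr_alg C \<Sigma> B F)"
  by (rule is_alg_enr_alg) (auto simp: compatibles_Obj joint_op_Hom)

lemma car_compatible: "B \<in> compatibles \<Longrightarrow> car (enr_alg C \<Sigma> B F) = B"
  by (simp add: enr_alg_def restrict_compatibles)

lemma und_alg_compatible: "B \<in> compatibles \<Longrightarrow> calg_eq S (und_alg C (enr_alg C \<Sigma> B F)) F"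
  by (rule und_alg_enr_alg) (simp add: Und_compatibles)

text \<open>Satisfaction of the enriched equations depends only on the underlying algebra, which
  agrees here with \<open>F\<close>.\<close>

lemma is_theory_alg_compatible: "B \<in> compatibles \<Longrightarrow> is_theory_alg C \<Sigma> E (enr_alg C \<Sigma> B F)"
  using calg_eq_sat[OF und_alg_compatible calgebra_und_alg[OF is_alg_compatible] wf_und_eqns sat_F und_eqns_ctx]
  by (simp add: theory_alg_iff is_alg_compatible)

lemma joint_op_funcset:
  assumes B: "\<And>s. s \<in> sorts \<Sigma> \<Longrightarrow> B s \<in> Obj C" "\<And>s. s \<in> sorts \<Sigma> \<Longrightarrow> Und C (B s) = ccar F s"
    and s: "\<sigma> \<in> syms \<Sigma>"
  shows "joint_op C \<Sigma> F \<sigma> \<in> Und C (dom_obj C B (args \<Sigma> \<sigma>) (param \<Sigma> \<sigma>)) \<rightarrow>\<^sub>E ccar F (res \<Sigma> \<sigma>)"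
proof -
  have O: "B ` sorts \<Sigma> \<subseteq> Obj C" using B by blast
  have m: "map (\<lambda>s. Und C (B s)) (args \<Sigma> \<sigma>) = map (ccar F) (args \<Sigma> \<sigma>)"
    using args_sorts[OF s] B(2) by auto
  show ?thesis
    unfolding Und_dom_obj_args[OF O s] m
  proof (rule PiE_I)
    fix z assume "z \<in> cart C (Und C (param \<Sigma> \<sigma>)) (tuples C (map (ccar F) (args \<Sigma> \<sigma>)))"
    then obtain p xs where z: "z = upair C p (tuple C xs)" "p \<in> Und C (param \<Sigma> \<sigma>)"
      "xs \<in> listset (map (ccar F) (args \<Sigma> \<sigma>))" by (rule cart_tuplesE)
    have "cop F (\<sigma>, p) xs \<in> ccar F (cres S (\<sigma>, p))"
      using calgebra_F s z unfolding calgebra_def by fastforce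
    then show "joint_op C \<Sigma> F \<sigma> z \<in> ccar F (res \<Sigma> \<sigma>)"
      using z by (simp add: joint_op_apply)
  qed (simp add: joint_op_def)
qed

section \<open>The infimum of the compatible families\<close>

definition least_compatible :: "'s \<Rightarrow> 'v" where
  "least_compatible = (\<lambda>s\<in>sorts \<Sigma>. SOME V. V \<in> Obj C \<and> Und C V = ccar F s \<and>
     initial_source C V ((\<lambda>B. (\<lambda>x\<in>ccar F s. x, B s)) ` compatibles))"

lemma least_compatible:
  assumes "s \<in> sorts \<Sigma>"
  shows least_compatible_Obj: "least_compatible s \<in> Obj C"
    and Und_least_compatible: "Und C (least_compatible s) = ccar F s"
    and least_compatible_initial:
      "initial_source C (least_compatible s) ((\<lambda>B. (\<lambda>x\<in>ccar F s. x, B s)) ` compatibles)"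
proof -
  \<comment> \<open>\<open>compatibles\<close> may be a large class and is not yet known to be
    nonempty; the lifting axiom covers both cases.\<close>
  have "structured_source C (ccar F s) ((\<lambda>B. (\<lambda>x\<in>ccar F s. x, B s)) ` compatibles)"
    using assms by (auto simp: structured_source_def small_F compatibles_Obj Und_compatibles)
  then have "\<exists>V. V \<in> Obj C \<and> Und C V = ccar F s \<and>
     initial_source C V ((\<lambda>B. (\<lambda>x\<in>ccar F s. x, B s)) ` compatibles)"
    using initial_lift by blast
  from someI_ex[OF this] assms
  show "least_compatible s \<in> Obj C" "Und C (least_compatible s) = ccar F s"
    "initial_source C (least_compatible s) ((\<lambda>B. (\<lambda>x\<in>ccar F s. x, B s)) ` compatibles)"
    by (simp_all add: least_compatible_def)
qed

lemma least_compatible_le: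
  "s \<in> sorts \<Sigma> \<Longrightarrow> B \<in> compatibles \<Longrightarrow> (\<lambda>x\<in>ccar F s. x) \<in> Hom C (least_compatible s) (B s)"
  using least_compatible_initial[of s] unfolding initial_source_def by blast

lemma Hom_least_compatible:
  assumes s: "s \<in> sorts \<Sigma>" and W: "W \<in> Obj C" and g: "g \<in> Und C W \<rightarrow>\<^sub>E ccar F s"
    and H: "\<And>B. B \<in> compatibles \<Longrightarrow> g \<in> Hom C W (B s)"
  shows "g \<in> Hom C W (least_compatible s)"
proof -
  have "compose (Und C W) (\<lambda>x\<in>ccar F s. x) g = g"
    using g by (intro Id_compose) (auto simp: PiE_def)
  then have "\<forall>(f, Z)\<in>(\<lambda>B. (\<lambda>x\<in>ccar F s. x, B s)) ` compatibles. compose (Und C W) f g \<in> Hom C W Z"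
    using H by auto
  moreover have "g \<in> Und C W \<rightarrow>\<^sub>E Und C (least_compatible s)"
    using g by (simp add: Und_least_compatible[OF s])
  ultimately show ?thesis
    using least_compatible_initial[OF s] W unfolding initial_source_def by blast
qed

text \<open>For each compatible \<open>B\<close>, the identities into \<open>B\<close> induce an
  admissible map from the domain over the least family to the domain over \<open>B\<close>.
  Following it by the operation on \<open>B\<close> gives the same underlying function, which is
  thus admissible into every \<open>B\<close>, and by initiality into the least family.\<close>

lemma least_compatible_in: "least_compatible \<in> compatibles"
  unfolding compatibles_iff
proof (intro conjI ballI)
  show "least_compatible \<in> SObj C (sorts \<Sigma>)"
    unfolding SObj_def by (rule PiE_I) (simp add: least_compatible_Obj, simp add: least_compatible_def)
next
  fix s assume s: "s \<in> sorts \<Sigma>"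
  show "Und C (least_compatible s) = ccar F s" by (rule Und_least_compatible[OF s])
  show "\<eta> s \<in> Hom C (X s) (least_compatible s)"
    by (rule Hom_least_compatible[OF s X_Obj[OF s] unit_funcset[OF s]]) (rule unit_Hom[OF _ s])
next
  fix \<sigma> assume s: "\<sigma> \<in> syms \<Sigma>"
  let ?L = "least_compatible" and ?j = "joint_op C \<Sigma> F \<sigma>"
  let ?dom = "\<lambda>B. dom_obj C B (args \<Sigma> \<sigma>) (param \<Sigma> \<sigma>)"
  let ?id = "\<lambda>s. \<lambda>x\<in>ccar F s. x"
  have O: "?L ` sorts \<Sigma> \<subseteq> Obj C" using least_compatible_Obj by blast
  have U: "Und C (?dom ?L) = cart C (Und C (param \<Sigma> \<sigma>)) (tuples C (map (\<lambda>s. Und C (?L s)) (args \<Sigma> \<sigma>)))"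
    by (rule Und_dom_obj_args[OF O s])
  show "?j \<in> Hom C (?dom ?L) (?L (res \<Sigma> \<sigma>))"
  proof (rule Hom_least_compatible[OF res_sort[OF s] dom_obj_args_Obj[OF O s]])
    show jf: "?j \<in> Und C (?dom ?L) \<rightarrow>\<^sub>E ccar F (res \<Sigma> \<sigma>)"
      by (rule joint_op_funcset[OF least_compatible_Obj Und_least_compatible s])
    fix B assume B: "B \<in> compatibles"
    have OB: "B ` sorts \<Sigma> \<subseteq> Obj C" using compatibles_Obj[OF B] by blast
    have "dom_map C ?L (args \<Sigma> \<sigma>) (param \<Sigma> \<sigma>) ?id \<in> Hom C (?dom ?L) (?dom B)"
      using args_sorts[OF s] param_Obj[OF s] B
      by (intro dom_map_Hom) (auto simp: least_compatible_Obj compatibles_Obj least_compatible_le)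
    then have "compose (Und C (?dom ?L)) ?j (dom_map C ?L (args \<Sigma> \<sigma>) (param \<Sigma> \<sigma>) ?id)
                 \<in> Hom C (?dom ?L) (B (res \<Sigma> \<sigma>))"
      by (rule Hom_compose[OF dom_obj_args_Obj[OF O s] dom_obj_args_Obj[OF OB s]
              compatibles_Obj[OF B res_sort[OF s]] _ joint_op_Hom[OF B s]])
    \<comment> \<open>On underlying sets the induced map of domains is the identity.\<close>
    also have "compose (Und C (?dom ?L)) ?j (dom_map C ?L (args \<Sigma> \<sigma>) (param \<Sigma> \<sigma>) ?id) = ?j"
    proof
      fix z
      show "compose (Und C (?dom ?L)) ?j (dom_map C ?L (args \<Sigma> \<sigma>) (param \<Sigma> \<sigma>) ?id) z = ?j z"
      proof (cases "z \<in> Und C (?dom ?L)")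
        case True
        then obtain p xs where z: "z = upair C p (tuple C xs)" "p \<in> Und C (param \<Sigma> \<sigma>)"
          and xs: "xs \<in> listset (map (\<lambda>s. Und C (?L s)) (args \<Sigma> \<sigma>))"
          unfolding U by (rule cart_tuplesE)
        have "map2 ?id (args \<Sigma> \<sigma>) xs = xs"
        proof (rule nth_equalityI)
          fix i assume "i < length (map2 ?id (args \<Sigma> \<sigma>) xs)"
          then show "map2 ?id (args \<Sigma> \<sigma>) xs ! i = xs ! i"
            using xs subsetD[OF args_sorts[OF s] nth_mem, of i]
            by (auto simp: listset_iff list_all2_conv_all_nth Und_least_compatible)
        qed (use xs in \<open>simp add: listset_length\<close>)
        then show ?thesis
          using True z dom_map_apply[where A = ?L, OF z(2) xs] by (simp add: compose_def)
      next
        case False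
        then show ?thesis using PiE_arb[OF jf False] by (simp add: compose_def)
      qed
    qed
    finally show "?j \<in> Hom C (?dom ?L) (B (res \<Sigma> \<sigma>))" .
  qed
qed

text \<open>
  The initial lift of the classical extension of \<open>f\<close> is compatible with \<open>X\<close>, so the extension is
  admissible on the least compatible family.
\<close>

lemma Hom_from_least_compatible:
  assumes M: "is_alg C \<Sigma> M" and f: "f \<in> SHom C (sorts \<Sigma>) X (car M)"
    and h: "chom S F (und_alg C M) h"
    and h\<eta>: "\<And>s x. s \<in> sorts \<Sigma> \<Longrightarrow> x \<in> Y s \<Longrightarrow> h s (\<eta> s x) = f s x"
    and s: "s \<in> sorts \<Sigma>"
  shows "(\<lambda>x\<in>ccar F s. h s x) \<in> Hom C (least_compatible s) (car M s)"
proof -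
  define k where "k s = (\<lambda>x\<in>ccar F s. h s x)" for s
  define B where "B = (\<lambda>s\<in>sorts \<Sigma>. SOME V. V \<in> Obj C \<and> Und C V = ccar F s \<and>
    initial_source C V {(k s, car M s)})"
  have MO: "car M s \<in> Obj C" if "s \<in> sorts \<Sigma>" for s by (rule is_alg_car[OF M that])
  have kf: "k s \<in> ccar F s \<rightarrow>\<^sub>E Und C (car M s)" if "s \<in> sorts \<Sigma>" for s
    using chom_in[OF h] that by (auto simp: k_def)
  have Bs: "B s \<in> Obj C \<and> Und C (B s) = ccar F s \<and> initial_source C (B s) {(k s, car M s)}"
    if s: "s \<in> sorts \<Sigma>" for s
  proof -
    have "structured_source C (ccar F s) {(k s, car M s)}"
      using kf[OF s] MO[OF s] small_F[OF s] by (simp add: structured_source_def)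
    then have "\<exists>V. V \<in> Obj C \<and> Und C V = ccar F s \<and> initial_source C V {(k s, car M s)}"
      using initial_lift by blast
    from someI_ex[OF this] s show ?thesis by (simp add: B_def)
  qed
  have BO: "B s \<in> Obj C" and BU: "Und C (B s) = ccar F s"
    and kH: "k s \<in> Hom C (B s) (car M s)" if "s \<in> sorts \<Sigma>" for s
    using Bs[OF that] by (auto simp: initial_source_def)
  have BH: "g \<in> Hom C W (B s)"
    if "s \<in> sorts \<Sigma>" "W \<in> Obj C" "g \<in> Und C W \<rightarrow>\<^sub>E ccar F s" "compose (Und C W) (k s) g \<in> Hom C W (car M s)" for s g W
    using Bs[OF that(1)] that(2-) by (auto simp: initial_source_def)
  have "B \<in> compatibles"
    unfolding compatibles_iff
  proof (intro conjI ballI)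
    show "B \<in> SObj C (sorts \<Sigma>)"
      unfolding SObj_def by (rule PiE_I) (simp add: BO, simp add: B_def)
  next
    fix s assume s: "s \<in> sorts \<Sigma>"
    show "Und C (B s) = ccar F s" by (rule BU[OF s])
    have fs: "f s \<in> Hom C (X s) (car M s)" using f s by (auto simp: SHom_def)
    \<comment> \<open>Initiality of \<open>B s\<close> reduces admissibility of the unit to this
      composite, and \<open>f s\<close> is admissible by assumption.\<close>
    have "compose (Y s) (k s) (\<eta> s) = f s"
    proof (rule PiE_ext[where s = "\<lambda>_. Und C (car M s)"])
      show "f s \<in> Y s \<rightarrow>\<^sub>E Und C (car M s)" by (rule Hom_funcset[OF fs X_Obj[OF s] MO[OF s]])
      show "compose (Y s) (k s) (\<eta> s) \<in> Y s \<rightarrow>\<^sub>E Und C (car M s)"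
        using unit_funcset[OF s] kf[OF s] by (auto simp: compose_def)
      fix x assume x: "x \<in> Y s"
      then have "\<eta> s x \<in> ccar F s" using unit_funcset[OF s] by auto
      then show "compose (Y s) (k s) (\<eta> s) x = f s x" using x s by (simp add: compose_def k_def h\<eta>)
    qed
    then show "\<eta> s \<in> Hom C (X s) (B s)"
      using BH[OF s X_Obj[OF s] unit_funcset[OF s]] fs by simp
  next
    fix \<sigma> assume s: "\<sigma> \<in> syms \<Sigma>"
    let ?j = "joint_op C \<Sigma> F \<sigma>"
    let ?dom = "\<lambda>B. dom_obj C B (args \<Sigma> \<sigma>) (param \<Sigma> \<sigma>)"
    have O: "B ` sorts \<Sigma> \<subseteq> Obj C" using BO by blast
    have dk: "dom_map C B (args \<Sigma> \<sigma>) (param \<Sigma> \<sigma>) k \<in> Hom C (?dom B) (?dom (car M))"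
      using args_sorts[OF s] param_Obj[OF s] by (intro dom_map_Hom) (auto simp: BO MO kH)
    have U: "Und C (?dom B) = cart C (Und C (param \<Sigma> \<sigma>)) (tuples C (map (\<lambda>s. Und C (B s)) (args \<Sigma> \<sigma>)))"
      by (rule Und_dom_obj_args[OF O s])
    \<comment> \<open>A composite of admissible maps. The homomorphism property of \<open>h\<close>
      rewrites it as \<open>k\<close> after the operation of \<open>F\<close>, the composite whose
      admissibility makes that operation admissible into \<open>B\<close>.\<close>
    have "compose (Und C (?dom B)) (opn M \<sigma>) (dom_map C B (args \<Sigma> \<sigma>) (param \<Sigma> \<sigma>) k)
            \<in> Hom C (?dom B) (car M (res \<Sigma> \<sigma>))"
      by (rule Hom_compose[OF dom_obj_args_Obj[OF O s] dom_obj_args_Obj[OF is_alg_car_image[OF M] s]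
            MO[OF res_sort[OF s]] dk is_alg_opn[OF M s]])
    also have "compose (Und C (?dom B)) (opn M \<sigma>) (dom_map C B (args \<Sigma> \<sigma>) (param \<Sigma> \<sigma>) k)
                 = compose (Und C (?dom B)) (k (res \<Sigma> \<sigma>)) ?j"
      unfolding compose_def
    proof (rule restrict_ext)
      fix z assume "z \<in> Und C (?dom B)"
      then obtain p xs where z: "z = upair C p (tuple C xs)" "p \<in> Und C (param \<Sigma> \<sigma>)"
        and xs: "xs \<in> listset (map (\<lambda>s. Und C (B s)) (args \<Sigma> \<sigma>))"
        unfolding U by (rule cart_tuplesE)
      have m: "map (\<lambda>s. Und C (B s)) (args \<Sigma> \<sigma>) = map (ccar F) (args \<Sigma> \<sigma>)"
        using args_sorts[OF s] BU by auto
      have xs': "xs \<in> listset (map (ccar F) (cargs S (\<sigma>, p)))" using xs m by simp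
      have f: "(\<sigma>, p) \<in> csyms S" using s z(2) by simp
      have "map2 k (args \<Sigma> \<sigma>) xs = map2 h (args \<Sigma> \<sigma>) xs"
        using xs' by (auto simp: listset_iff list_all2_conv_all_nth k_def in_set_zip)
      then have "opn M \<sigma> (dom_map C B (args \<Sigma> \<sigma>) (param \<Sigma> \<sigma>) k z)
          = cop (und_alg C M) (\<sigma>, p) (map2 h (cargs S (\<sigma>, p)) xs)"
        unfolding z(1) dom_map_apply[where A = B, OF z(2) xs] und_sig_simps und_alg_simps
        by (simp only:)
      also have "\<dots> = h (res \<Sigma> \<sigma>) (cop F (\<sigma>, p) xs)"
        using chom_cop[OF h f xs'] by simp
      also have "cop F (\<sigma>, p) xs = ?j z"
        using xs' by (simp add: z joint_op_apply)
      also have "h (res \<Sigma> \<sigma>) (?j z) = k (res \<Sigma> \<sigma>) (?j z)"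
        using PiE_mem[OF joint_op_funcset[OF BO BU s] \<open>z \<in> Und C (?dom B)\<close>] by (simp add: k_def)
      finally show "opn M \<sigma> (dom_map C B (args \<Sigma> \<sigma>) (param \<Sigma> \<sigma>) k z) = k (res \<Sigma> \<sigma>) (?j z)" .
    qed
    finally have kj: "compose (Und C (?dom B)) (k (res \<Sigma> \<sigma>)) ?j \<in> Hom C (?dom B) (car M (res \<Sigma> \<sigma>))" .
    have "?j \<in> Und C (?dom B) \<rightarrow>\<^sub>E ccar F (res \<Sigma> \<sigma>)" by (rule joint_op_funcset[OF BO BU s])
    from BH[OF res_sort[OF s] dom_obj_args_Obj[OF O s] this kj]
    show "?j \<in> Hom C (?dom B) (B (res \<Sigma> \<sigma>))" .
  qed
  \<comment> \<open>The least family lies below \<open>B\<close>, out of which \<open>k s\<close> is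
    admissible; the composite has underlying function \<open>k s\<close>.\<close>
  then have "(\<lambda>x\<in>ccar F s. x) \<in> Hom C (least_compatible s) (B s)" by (rule least_compatible_le[OF s])
  from Hom_compose[OF least_compatible_Obj[OF s] BO[OF s] MO[OF s] this kH[OF s]]
  have "compose (ccar F s) (k s) (\<lambda>x\<in>ccar F s. x) \<in> Hom C (least_compatible s) (car M s)"
    by (simp add: Und_least_compatible[OF s])
  also have "compose (ccar F s) (k s) (\<lambda>x\<in>ccar F s. x) = (\<lambda>x\<in>ccar F s. h s x)"
    by (auto simp: compose_def k_def fun_eq_iff)
  finally show ?thesis .
qed

section \<open>Universal property of the least compatible family, and comparison with arbitrary free
  algebras\<close>

lemma alg_hom_unique:
  assumes A: "is_alg C \<Sigma> A" "calg_eq S (und_alg C A) F" and M: "is_alg C \<Sigma> M"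
    and h: "h \<in> alg_homs C \<Sigma> A M" "\<And>s. s \<in> sorts \<Sigma> \<Longrightarrow> compose (Y s) (h s) (\<eta> s) = f s"
    and k: "chom S F (und_alg C M) k" "\<And>s x. s \<in> sorts \<Sigma> \<Longrightarrow> x \<in> Y s \<Longrightarrow> k s (\<eta> s x) = f s x"
  shows "h = (\<lambda>s\<in>sorts \<Sigma>. \<lambda>x\<in>ccar F s. k s x)"
proof -
  have hS: "h \<in> SHom C (sorts \<Sigma>) (car A) (car M)" and hc: "chom S (und_alg C A) (und_alg C M) h"
    using h(1) by (auto simp: alg_homs_iff[OF A(1) M])
  have hF: "chom S F (und_alg C M) h" by (rule chom_cong[OF hc csig A(2) calg_eq_refl])
  have h\<eta>: "h s (\<eta> s x) = f s x" if "s \<in> sorts \<Sigma>" "x \<in> Y s" for s x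
    using fun_cong[OF h(2)[OF that(1)], of x] that by (simp add: compose_def)
  show ?thesis
  proof
    fix s
    show "h s = (\<lambda>s\<in>sorts \<Sigma>. \<lambda>x\<in>ccar F s. k s x) s"
    proof (cases "s \<in> sorts \<Sigma>")
      case s: True
      have hs: "h s \<in> Hom C (car A s) (car M s)" using hS s by (auto simp: SHom_def)
      have As: "Und C (car A s) = ccar F s" using A(2) s by (simp add: calg_eq_def)
      have "h s = (\<lambda>x\<in>ccar F s. k s x)"
      proof
        fix y
        show "h s y = (\<lambda>x\<in>ccar F s. k s x) y"
        proof (cases "y \<in> ccar F s")
          case True
          \<comment> \<open>Every element is the class of a term, and both homomorphisms send that
            class to the value of the term at \<open>f\<close>. Off the carriers, extensionality
            settles the equality.\<close>
          obtain t where "wf_trm S Y s t" "y = cls s t" using clsE[OF s True] by blast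
          then show ?thesis
            using chom_F_unique[OF hF h\<eta>, of s t] chom_F_unique[OF k, of s t] True by simp
        next
          case False
          then show ?thesis
            using PiE_arb[OF Hom_funcset[OF hs is_alg_car[OF A(1) s] is_alg_car[OF M s]]] As by simp
        qed
      qed
      then show ?thesis using s by simp
    next
      case False
      then show ?thesis using hS by (auto simp: SHom_def)
    qed
  qed
qed

text \<open>The classical universal property supplies the map and its uniqueness; what remains for
  the enriched one is admissibility, given by \<open>Hom_from_least_compatible\<close>.\<close>

lemma is_free_alg_least_compatible:
  "is_free_alg C \<Sigma> E X (enr_alg C \<Sigma> least_compatible F)" (is "is_free_alg C \<Sigma> E X ?A")
  unfolding is_free_alg_def
proof (intro conjI allI impI ballI)
  note L = least_compatible_in
  note A = is_alg_compatible[OF L] and Aeq = und_alg_compatible[OF L] and Acar = car_compatible[OF L]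
  show "is_theory_alg C \<Sigma> E ?A" by (rule is_theory_alg_compatible[OF L])
  show "calg_eq S (und_alg C ?A) F" by (rule Aeq)
  show "\<eta> \<in> SHom C (sorts \<Sigma>) X (car ?A)"
    using L unfolding Acar by (simp add: compatibles_def compatible_def)
  fix M f assume thM: "is_theory_alg C \<Sigma> E M" and f: "f \<in> SHom C (sorts \<Sigma>) X (car M)"
  have M: "is_alg C \<Sigma> M" using thM by (simp add: is_theory_alg_def)
  have fH: "f s \<in> Hom C (X s) (car M s)" if "s \<in> sorts \<Sigma>" for s using f that by (auto simp: SHom_def)
  have ff: "f s \<in> Y s \<rightarrow>\<^sub>E Und C (car M s)" if "s \<in> sorts \<Sigma>" for s
    by (rule Hom_funcset[OF fH[OF that] X_Obj[OF that] is_alg_car[OF M that]])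
  have satM: "sat (und_alg C M) e" if "e \<in> und_eqns C \<Sigma> E" for e
    using theory_alg_iff[OF M] thM that by blast
  have fM: "f s x \<in> ccar (und_alg C M) s" if "s \<in> sorts \<Sigma>" "x \<in> Y s" for s x
    using ff that by auto
  obtain k where k: "chom S F (und_alg C M) k" "\<And>s x. s \<in> sorts \<Sigma> \<Longrightarrow> x \<in> Y s \<Longrightarrow> k s (\<eta> s x) = f s x"
  proof -
    have "\<exists>h. chom S F (und_alg C M) h \<and> (\<forall>s\<in>sorts \<Sigma>. \<forall>x\<in>Y s. h s (\<eta> s x) = f s x)"
      by (rule chom_F_exists[OF calgebra_und_alg[OF M] satM fM])
    then show ?thesis by (elim exE conjE) (rule that, auto)
  qed
  let ?k = "\<lambda>s\<in>sorts \<Sigma>. \<lambda>x\<in>ccar F s. k s x"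
  show "\<exists>!h. h \<in> alg_homs C \<Sigma> ?A M \<and> (\<forall>s\<in>sorts \<Sigma>. compose (Y s) (h s) (\<eta> s) = f s)"
  proof (rule ex1I[of _ ?k])
    have "?k \<in> SHom C (sorts \<Sigma>) (car ?A) (car M)"
      unfolding SHom_def Acar using Hom_from_least_compatible[OF M f k] by auto
    moreover have "chom S F (und_alg C M) ?k"
      using chom_restrict[OF k(1) csig calgebra_F] by simp
    then have "chom S (und_alg C ?A) (und_alg C M) ?k"
      by (rule chom_cong[OF _ csig calg_eq_sym[OF Aeq csig] calg_eq_refl])
    ultimately have "?k \<in> alg_homs C \<Sigma> ?A M" by (simp add: alg_homs_iff[OF A M])
    moreover have "compose (Y s) (?k s) (\<eta> s) = f s" if s: "s \<in> sorts \<Sigma>" for s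
    proof
      fix x
      show "compose (Y s) (?k s) (\<eta> s) x = f s x"
      proof (cases "x \<in> Y s")
        case True
        then have "\<eta> s x \<in> ccar F s" using unit_funcset[OF s] by auto
        then show ?thesis using True s by (simp add: compose_def k(2))
      next
        case False
        then show ?thesis using PiE_arb[OF ff[OF s] False] by (simp add: compose_def)
      qed
    qed
    ultimately show "?k \<in> alg_homs C \<Sigma> ?A M \<and> (\<forall>s\<in>sorts \<Sigma>. compose (Y s) (?k s) (\<eta> s) = f s)"
      by blast
  next
    fix h assume "h \<in> alg_homs C \<Sigma> ?A M \<and> (\<forall>s\<in>sorts \<Sigma>. compose (Y s) (h s) (\<eta> s) = f s)"
    then show "h = ?k" using alg_hom_unique[OF A Aeq M _ _ k] by blast
  qed
qed

text \<open>\<open>is_free_alg\<close> prescribes the underlying classical algebra and the unit. The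
  operations of \<open>A\<close> are therefore the functions \<open>joint_op\<close> of
  \<open>F\<close>, and their admissibility is part of \<open>A\<close> being an algebra.\<close>

lemma free_alg_compatible:
  assumes free: "is_free_alg C \<Sigma> E X A"
  shows "car A \<in> compatibles"
  unfolding compatibles_iff
proof (intro conjI ballI)
  have A: "is_alg C \<Sigma> A" and eq: "calg_eq S (und_alg C A) F" and u: "\<eta> \<in> SHom C (sorts \<Sigma>) X (car A)"
    using free by (auto simp: is_free_alg_def is_theory_alg_def)
  show "car A \<in> SObj C (sorts \<Sigma>)" using A by (simp add: is_alg_def)
  fix s assume "s \<in> sorts \<Sigma>"
  then show "Und C (car A s) = ccar F s" using eq by (simp add: calg_eq_def)
  show "\<eta> s \<in> Hom C (X s) (car A s)" using u \<open>s \<in> sorts \<Sigma>\<close> by (auto simp: SHom_def)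
next
  fix \<sigma> assume s: "\<sigma> \<in> syms \<Sigma>"
  have A: "is_alg C \<Sigma> A" and eq: "calg_eq S (und_alg C A) F"
    using free by (auto simp: is_free_alg_def is_theory_alg_def)
  let ?D = "dom_obj C (car A) (args \<Sigma> \<sigma>) (param \<Sigma> \<sigma>)"
  have U: "Und C (car A s) = ccar F s" if "s \<in> sorts \<Sigma>" for s using eq that by (simp add: calg_eq_def)
  note O = is_alg_car_image[OF A]
  have oH: "opn A \<sigma> \<in> Hom C ?D (car A (res \<Sigma> \<sigma>))" by (rule is_alg_opn[OF A s])
  have "joint_op C \<Sigma> F \<sigma> = opn A \<sigma>"
  proof (rule PiE_ext[OF joint_op_funcset[OF is_alg_car[OF A] U s]])
    show "opn A \<sigma> \<in> Und C ?D \<rightarrow>\<^sub>E ccar F (res \<Sigma> \<sigma>)"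
      using Hom_funcset[OF oH dom_obj_args_Obj[OF O s] is_alg_car[OF A res_sort[OF s]]]
      by (simp add: U res_sort[OF s])
    fix z assume "z \<in> Und C ?D"
    then obtain p xs where z: "z = upair C p (tuple C xs)" "p \<in> Und C (param \<Sigma> \<sigma>)"
      and xs: "xs \<in> listset (map (\<lambda>s. Und C (car A s)) (args \<Sigma> \<sigma>))"
      unfolding Und_dom_obj_args[OF O s] by (rule cart_tuplesE)
    have m: "map (\<lambda>s. Und C (car A s)) (args \<Sigma> \<sigma>) = map (ccar F) (args \<Sigma> \<sigma>)"
      using args_sorts[OF s] U by auto
    have "(\<sigma>, p) \<in> csyms S" "xs \<in> listset (map (ccar (und_alg C A)) (cargs S (\<sigma>, p)))"
      using s z(2) xs by (simp_all add: und_alg_def)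
    then have "cop (und_alg C A) (\<sigma>, p) xs = cop F (\<sigma>, p) xs"
      using eq unfolding calg_eq_def by blast
    then show "joint_op C \<Sigma> F \<sigma> z = opn A \<sigma> z"
      using xs m z by (simp add: joint_op_apply)
  qed
  with oH show "joint_op C \<Sigma> F \<sigma> \<in> Hom C ?D (car A (res \<Sigma> \<sigma>))" by simp
qed

text \<open>The universal property is applied to the unit regarded as a morphism from
  \<open>X\<close> to \<open>B\<close>. The resulting homomorphism and the identity both extend the
  unit, so classical uniqueness makes them equal.\<close>

lemma free_alg_le:
  assumes free: "is_free_alg C \<Sigma> E X A" and B: "B \<in> compatibles" and s: "s \<in> sorts \<Sigma>"
  shows "(\<lambda>x\<in>ccar F s. x) \<in> Hom C (car A s) (B s)"
proof -
  let ?B = "enr_alg C \<Sigma> B F"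
  have A: "is_alg C \<Sigma> A" and eq: "calg_eq S (und_alg C A) F"
    using free by (auto simp: is_free_alg_def is_theory_alg_def)
  note BA = is_alg_compatible[OF B] and Bcar = car_compatible[OF B]
  have u: "\<eta> \<in> SHom C (sorts \<Sigma>) X (car ?B)"
    using B unfolding Bcar by (simp add: compatibles_def compatible_def)
  obtain h where h: "h \<in> alg_homs C \<Sigma> A ?B" "\<And>s. s \<in> sorts \<Sigma> \<Longrightarrow> compose (Y s) (h s) (\<eta> s) = \<eta> s"
    using free u is_theory_alg_compatible[OF B] unfolding is_free_alg_def by blast
  have "chom S F (und_alg C ?B) (\<lambda>_ x. x)"
    by (rule chom_id[OF calg_eq_sym[OF und_alg_compatible[OF B] csig]])
  from alg_hom_unique[OF A eq BA h this] have "h = (\<lambda>s\<in>sorts \<Sigma>. \<lambda>x\<in>ccar F s. x)" by simp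
  moreover have "h s \<in> Hom C (car A s) (car ?B s)"
    using h(1) s by (auto simp: alg_homs_iff[OF A BA] SHom_def)
  ultimately show ?thesis using s by (simp add: Bcar)
qed

lemma free_alg_is_glb:
  "is_glb (SFib C (sorts \<Sigma>) (ccar F)) (car (free_alg C \<Sigma> E X)) compatibles"
proof -
  have free: "is_free_alg C \<Sigma> E X (free_alg C \<Sigma> E X)"
    unfolding free_alg_def by (rule someI[of "is_free_alg C \<Sigma> E X"], rule is_free_alg_least_compatible)
  have "car (free_alg C \<Sigma> E X) \<in> compatibles" by (rule free_alg_compatible[OF free])
  moreover have "compatibles \<subseteq> carrier (SFib C (sorts \<Sigma>) (ccar F))" by (auto simp: compatibles_def)
  ultimately show ?thesis
    using free_alg_le[OF free]
    \<comment> \<open>The carrier is itself compatible and lies below all compatible families; a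
      least element of a class is its infimum.\<close>
    by (auto simp: greatest_def Lower_def SFib_def Fib_def)
qed

end

theorem theorem4p3p4:
  fixes \<V> :: "('u, 'v) concrete_monoidal"
    and \<Sigma> :: "('s, 'o, 'v) esig"
    and \<E> :: "('s, 'o, 'u, 'v) aeqn set"
    and X :: "'s \<Rightarrow> 'v"
  assumes "topological_monoidal_category \<V>"
    and "enriched_theory \<V> \<Sigma> \<E>"
    and "X \<in> SObj \<V> (sorts \<Sigma>)"
  shows "is_glb (SFib \<V> (sorts \<Sigma>) (ccar (free_calg \<V> \<Sigma> \<E> X)))
           (car (free_alg \<V> \<Sigma> \<E> X))
           {B \<in> carrier (SFib \<V> (sorts \<Sigma>) (ccar (free_calg \<V> \<Sigma> \<E> X))). compatible \<V> \<Sigma> \<E> X B}"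
proof -
  interpret topological_monoidal_category \<V> by (rule assms(1))
  interpret theory_over \<V> \<Sigma> \<E> X
    by unfold_locales (use assms in \<open>auto simp: enriched_theory_def\<close>)
  show ?thesis using free_alg_is_glb unfolding compatibles_def .
qed

end
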